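(* Let $\mathcal C$ be a two-dimensional cone with vertex $0$ and length $l\ge 4\pi$. Then there exists a minimizer $u\ge 0$ of the one-phase functional $$J(u)=\int_{\mathcal C_1}|Du|^2+\chi_{\{u>0\}}$$ such that two different positive phases meet at the vertex, i.e. $\{u>0\}$ has two distinct connected components each having $0$ in its boundary.
   Context: $\mathcal C\subset\mathbb R^3$ is the cone with vertex at the origin generated by a smooth simple closed curve on the unit sphere; its length $l$ is the length of that curve. $\mathcal C\setminus\{0\}$ with the induced metric is isometric, in polar coordinates $(r,\theta)$, $r>0$, to the quotient of the universal cover of $\mathbb R^2\setminus\{0\}$ by $\theta\sim\theta+l$, with flat metric $dr^2+r^2d\theta^2$. $\mathcal C_1=\mathcal C\cap B_1$ is the part of the cone within distance $1$ of the vertex. $Du$ is the tangential gradient and integrals are with respect to area on $\mathcal C$. A minimizer is $u\in H^1(\mathcal C_1)$ with $J(u)\le J(w)$ for all $w\in H^1(\mathcal C_1)$ with $w-u\in H^1_0(\mathcal C_1)$. *)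

theory Defs
  imports "HOL-Analysis.Analysis"
begin

primrec Ck :: "nat \<Rightarrow> ('a::euclidean_space \<Rightarrow> 'b::euclidean_space) \<Rightarrow> bool" where
  "Ck 0 f \<longleftrightarrow> continuous_on UNIV f"
| "Ck (Suc k) f \<longleftrightarrow> (\<forall>x. f differentiable (at x)) \<and>
     (\<forall>v. Ck k (\<lambda>x. frechet_derivative f (at x) v))"

text \<open>A smooth closed curve is given by a regular parametrisation of period 1; the parametrisation
  need not be by arc length.\<close>

definition smooth_simple_closed_curve :: "(real \<Rightarrow> real^3) \<Rightarrow> bool" where
  "smooth_simple_closed_curve \<gamma> \<longleftrightarrow>
     (\<forall>k. Ck k \<gamma>) \<and> (\<forall>t. \<gamma> (t + 1) = \<gamma> t) \<and> inj_on \<gamma> {0..<1} \<and>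
     (\<forall>t. vector_derivative \<gamma> (at t) \<noteq> 0)"

definition curve_length :: "(real \<Rightarrow> real^3) \<Rightarrow> real" where
  "curve_length \<gamma> = integral {0..1} (\<lambda>t. norm (vector_derivative \<gamma> (at t)))"

definition cone_ball :: "(real \<Rightarrow> real^3) \<Rightarrow> (real^3) set" where
  "cone_ball \<gamma> = (cone hull (range \<gamma>)) \<inter> ball 0 1"

definition cone_map :: "(real \<Rightarrow> real^3) \<Rightarrow> real \<times> real \<Rightarrow> real^3" where
  "cone_map \<gamma> = (\<lambda>(r, t). r *\<^sub>R \<gamma> t)"

text \<open>Area on the cone. For a curve on the unit sphere, \<open>\<gamma>\<close> and \<open>\<gamma>'\<close> are orthogonal, so the area
  element of \<open>cone_map \<gamma>\<close> is \<open>r \<bar>\<gamma>'(t)\<bar> dr dt\<close>, which is \<open>r dr d\<theta>\<close> for the arc length \<open>\<theta>\<close>.\<close>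

definition cone_area :: "(real \<Rightarrow> real^3) \<Rightarrow> (real^3) measure" where
  "cone_area \<gamma> =
     distr (density lborel (\<lambda>(r, t). ennreal (indicator ({0<..} \<times> {0..<1}) (r, t) *
                                       (r * norm (vector_derivative \<gamma> (at t))))))
           borel (cone_map \<gamma>)"

definition C1c :: "'a::euclidean_space set \<Rightarrow> ('a \<Rightarrow> real) set" where
  "C1c \<Omega> = {\<phi>. Ck 1 \<phi> \<and> compact (closure {x. \<phi> x \<noteq> 0}) \<and> closure {x. \<phi> x \<noteq> 0} \<subseteq> \<Omega>}"

definition locally_integrable :: "'a::euclidean_space set \<Rightarrow> ('a \<Rightarrow> real) \<Rightarrow> bool" where
  "locally_integrable \<Omega> f \<longleftrightarrow> (\<forall>K. compact K \<and> K \<subseteq> \<Omega> \<longrightarrow> set_integrable lborel K f)"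

text \<open>\<open>g\<close> is the weak derivative of \<open>f\<close> in direction \<open>v\<close> on the open set \<open>\<Omega>\<close>; as in Gilbarg and
  Trudinger, first-order weak derivatives are tested against \<open>C\<^sup>1\<close> functions of compact support.\<close>

definition weak_directional_derivative ::
    "'a::euclidean_space set \<Rightarrow> 'a \<Rightarrow> ('a \<Rightarrow> real) \<Rightarrow> ('a \<Rightarrow> real) \<Rightarrow> bool" where
  "weak_directional_derivative \<Omega> v f g \<longleftrightarrow>
     locally_integrable \<Omega> f \<and> locally_integrable \<Omega> g \<and>
     (\<forall>\<phi>\<in>C1c \<Omega>. (LINT z:\<Omega>|lborel. f z * frechet_derivative \<phi> (at z) v) =
                  - (LINT z:\<Omega>|lborel. g z * \<phi> z))"

text \<open>\<open>G\<close> is a weak tangential gradient of \<open>u\<close> on \<open>cone_ball \<gamma> - {0}\<close>: it is tangent to the cone, and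
  in the parametrisation \<open>cone_map \<gamma>\<close>, which covers the punctured cone, the weak derivatives of
  \<open>u\<close> are given by the chain rule. The vertex can be left out since a point has zero capacity in
  dimension two.\<close>

definition weak_tangential_gradient ::
    "(real \<Rightarrow> real^3) \<Rightarrow> (real^3 \<Rightarrow> real) \<Rightarrow> (real^3 \<Rightarrow> real^3) \<Rightarrow> bool" where
  "weak_tangential_gradient \<gamma> u G \<longleftrightarrow>
     set_borel_measurable borel (cone_ball \<gamma>) G \<and>
     (\<forall>z \<in> {0<..<1} \<times> UNIV. G (cone_map \<gamma> z) \<in> range (frechet_derivative (cone_map \<gamma>) (at z))) \<and>
     (\<forall>v. weak_directional_derivative ({0<..<1} \<times> UNIV) v
            (\<lambda>z. u (cone_map \<gamma> z))
            (\<lambda>z. G (cone_map \<gamma> z) \<bullet> frechet_derivative (cone_map \<gamma>) (at z) v))"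

text \<open>Weak tangential gradients are unique up to null sets, so the choice is immaterial.\<close>

definition tangential_gradient ::
    "(real \<Rightarrow> real^3) \<Rightarrow> (real^3 \<Rightarrow> real) \<Rightarrow> (real^3 \<Rightarrow> real^3)" where
  "tangential_gradient \<gamma> u = (SOME G. weak_tangential_gradient \<gamma> u G)"

definition cone_L2 :: "(real \<Rightarrow> real^3) \<Rightarrow> (real^3 \<Rightarrow> 'b::euclidean_space) set" where
  "cone_L2 \<gamma> = {f. set_borel_measurable borel (cone_ball \<gamma>) f \<and>
                   set_integrable (cone_area \<gamma>) (cone_ball \<gamma>) (\<lambda>x. (norm (f x))\<^sup>2)}"

definition cone_H1 :: "(real \<Rightarrow> real^3) \<Rightarrow> (real^3 \<Rightarrow> real) set" where
  "cone_H1 \<gamma> = {u. u \<in> cone_L2 \<gamma> \<and> (\<exists>G. weak_tangential_gradient \<gamma> u G) \<and>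
                   tangential_gradient \<gamma> u \<in> cone_L2 \<gamma>}"

definition cone_H1_norm :: "(real \<Rightarrow> real^3) \<Rightarrow> (real^3 \<Rightarrow> real) \<Rightarrow> real" where
  "cone_H1_norm \<gamma> u =
     sqrt (LINT x:cone_ball \<gamma>|cone_area \<gamma>. (u x)\<^sup>2 + (norm (tangential_gradient \<gamma> u x))\<^sup>2)"

text \<open>The closure in \<open>H\<^sup>1\<close> of the restrictions to the cone of \<open>C\<^sup>1\<close> functions with compact support in
  the open unit ball of \<open>\<real>\<^sup>3\<close>; these need not vanish near the vertex.\<close>

definition cone_H10 :: "(real \<Rightarrow> real^3) \<Rightarrow> (real^3 \<Rightarrow> real) set" where
  "cone_H10 \<gamma> = {v \<in> cone_H1 \<gamma>. \<exists>\<phi> :: nat \<Rightarrow> real^3 \<Rightarrow> real.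
     (\<forall>n. \<phi> n \<in> C1c (ball 0 1)) \<and> (\<lambda>n. cone_H1_norm \<gamma> (\<lambda>x. \<phi> n x - v x)) \<longlonglongrightarrow> 0}"

definition one_phase_functional :: "(real \<Rightarrow> real^3) \<Rightarrow> (real^3 \<Rightarrow> real) \<Rightarrow> real" where
  "one_phase_functional \<gamma> u =
     (LINT x:cone_ball \<gamma>|cone_area \<gamma>.
        (norm (tangential_gradient \<gamma> u x))\<^sup>2 + indicator {y. u y > 0} x)"

definition is_minimizer :: "(real \<Rightarrow> real^3) \<Rightarrow> (real^3 \<Rightarrow> real) \<Rightarrow> bool" where
  "is_minimizer \<gamma> u \<longleftrightarrow> u \<in> cone_H1 \<gamma> \<and>
     (\<forall>w \<in> cone_H1 \<gamma>. (\<lambda>x. w x - u x) \<in> cone_H10 \<gamma> \<longrightarrow>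
        one_phase_functional \<gamma> u \<le> one_phase_functional \<gamma> w)"

definition positivity_set :: "(real \<Rightarrow> real^3) \<Rightarrow> (real^3 \<Rightarrow> real) \<Rightarrow> (real^3) set" where
  "positivity_set \<gamma> u = {x \<in> cone_ball \<gamma>. u x > 0}"

end

theory Submission
  imports Defs
begin

text \<open>Let \<open>l \<ge> 4\<pi>\<close> be the length of the curve and \<open>\<theta>\<close> its arc length. The minimizer is
\<open>u = r max 0 (- cos \<theta>)\<close> for \<open>0 \<le> \<theta> \<le> 4\<pi>\<close>, extended by \<open>0\<close> to \<open>4\<pi> \<le> \<theta> \<le> l\<close>: two half-plane
solutions, supported in sectors of opening \<open>\<pi>\<close>, which touch only at the vertex and are separated
by two gaps of opening at least \<open>\<pi>\<close>.

Minimality is shown by a calibration. Let \<open>e\<close> be the vector field that equals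
\<open>- cos \<theta> \<partial>\<^sub>r + sin \<theta> \<partial>\<^sub>\<theta>\<close> for \<open>\<theta> \<le> 4\<pi>\<close>, where \<open>\<partial>\<^sub>\<theta>\<close> has unit length, and \<open>- \<partial>\<^sub>r\<close> for \<open>\<theta> \<ge> 4\<pi>\<close>. The
first part is a constant field of the plane, lifted to the double cover of the punctured plane;
the second has divergence \<open>- 1 / r\<close>. So \<open>e\<close> is a continuous field of unit length with
\<open>div e \<le> 0\<close>, with \<open>div e = 0\<close> off the set \<open>{\<theta> > 4\<pi>}\<close>, where \<open>u = 0\<close>, and with \<open>e = Du\<close> wherever
\<open>u > 0\<close>. It is here that \<open>l \<ge> 4\<pi>\<close> is used. For a competitor \<open>w\<close>, on \<open>{w > 0}\<close>,
\<open>\<bar>Dw\<bar>\<^sup>2 + 1 \<ge> 2 \<bar>Dw\<bar> \<ge> 2 e \<bullet> Dw\<close>, and equality holds for \<open>w = u\<close>. Hence, writing \<open>w\<^sup>+ = max 0 w\<close>,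
\<open>J(w) - J(u) \<ge> 2 \<integral> e \<bullet> D(w\<^sup>+ - u) = - 2 \<integral> (w\<^sup>+ - u) div e \<ge> 0\<close>.

To give this a meaning for Sobolev functions, \<open>w\<^sup>+\<close> is replaced by \<open>trunc m w\<close>, a \<open>C\<^sup>1\<close>
approximation whose derivative increases to the indicator of \<open>{w > 0}\<close> as \<open>m \<rightarrow> \<infinity>\<close>, and \<open>w\<close> is
replaced by \<open>u + \<phi>\<close> with a test function \<open>\<phi>\<close>. In polar coordinates such functions are \<open>C\<^sup>1\<close> up to
finitely many rays, and the integration by parts is Fubini and the one-dimensional fundamental
theorem of calculus (\<open>calibration_polar\<close>). The inequality passes to all \<open>w\<close> because \<open>H\<^sup>1\<^sub>0\<close> is the
closure of the test functions (\<open>integral_limit_lower_bound\<close>, \<open>functional_lower_bound\<close>), and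
\<open>m \<rightarrow> \<infinity>\<close> gives \<open>u_minimizer\<close>.

All of this concerns explicit gradients, while the functional is built on an arbitrarily chosen
weak gradient. The two agree almost everywhere (\<open>weak_tangential_gradient_unique\<close>) by the
fundamental lemma of the calculus of variations. Finally, the rays \<open>\<theta> = 0\<close> and \<open>\<theta> = 2\<pi>\<close>, on
which \<open>u\<close> vanishes, cut the cone into two closed sectors that separate the two phases
(\<open>two_phases\<close>).\<close>

section \<open>Continuously differentiable test functions\<close>

lemma Ck_1_iff:
  "Ck 1 f \<longleftrightarrow> (\<forall>x. f differentiable (at x)) \<and>
     (\<forall>v. continuous_on UNIV (\<lambda>x. frechet_derivative f (at x) v))"
  unfolding One_nat_def Ck.simps ..

lemma Ck_1I:
  assumes "\<And>x. (f has_derivative f' x) (at x)" and "\<And>v. continuous_on UNIV (\<lambda>x. f' x v)"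
  shows "Ck 1 f"
proof -
  have "frechet_derivative f (at x) = f' x" for x
    using frechet_derivative_at[OF assms(1)] by simp
  then show ?thesis
    unfolding Ck_1_iff using assms by (auto simp: differentiable_def)
qed

lemma Ck_1_continuous: "Ck 1 f \<Longrightarrow> continuous_on UNIV f"
  unfolding Ck_1_iff
  by (meson UNIV_I continuous_at_imp_continuous_on differentiable_imp_continuous_within)

definition grad :: "('a::euclidean_space \<Rightarrow> real) \<Rightarrow> 'a \<Rightarrow> 'a" where
  "grad \<phi> x = (\<Sum>b\<in>Basis. frechet_derivative \<phi> (at x) b *\<^sub>R b)"

lemma has_derivative_grad:
  assumes "Ck 1 \<phi>"
  shows "(\<phi> has_derivative (\<lambda>v. grad \<phi> x \<bullet> v)) (at x)"
proof -
  have d: "(\<phi> has_derivative frechet_derivative \<phi> (at x)) (at x)"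
    using assms by (simp add: Ck_1_iff frechet_derivative_works[symmetric])
  interpret linear "frechet_derivative \<phi> (at x)"
    using has_derivative_linear[OF d] .
  have "frechet_derivative \<phi> (at x) v = grad \<phi> x \<bullet> v" for v
  proof -
    have "frechet_derivative \<phi> (at x) v =
        frechet_derivative \<phi> (at x) (\<Sum>b\<in>Basis. (v \<bullet> b) *\<^sub>R b)"
      by (simp add: euclidean_representation)
    also have "\<dots> = grad \<phi> x \<bullet> v"
      by (simp add: sum scale grad_def inner_sum_left inner_sum_right inner_commute[of _ v] mult.commute)
    finally show ?thesis .
  qed
  with d show ?thesis by (metis (no_types, lifting) ext)
qed

lemma frechet_derivative_grad:
  "Ck 1 \<phi> \<Longrightarrow> frechet_derivative \<phi> (at x) v = grad \<phi> x \<bullet> v"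
  using frechet_derivative_at[OF has_derivative_grad] by metis

lemma continuous_grad: "Ck 1 \<phi> \<Longrightarrow> continuous_on UNIV (grad \<phi>)"
  unfolding grad_def[abs_def] Ck_1_iff by (auto intro!: continuous_intros)

lemma C1c_outside:
  assumes "\<phi> \<in> C1c \<Omega>" and "x \<notin> \<Omega>"
  shows "\<phi> x = 0"
  using assms closure_subset[of "{x. \<phi> x \<noteq> 0}"] by (auto simp: C1c_def)

text \<open>The support is closed, so the function vanishes identically near any point outside it.\<close>

lemma grad_zero_outside_support:
  assumes "Ck 1 \<phi>" and "x \<notin> closure {x. \<phi> x \<noteq> 0}"
  shows "grad \<phi> x = 0"
proof -
  have op: "open (- closure {x. \<phi> x \<noteq> 0})" by (rule open_Compl) (rule closed_closure)
  have z: "\<phi> y = 0" if "y \<in> - closure {x. \<phi> x \<noteq> 0}" for y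
    using that closure_subset[of "{x. \<phi> x \<noteq> 0}"] by auto
  have "((\<lambda>_. 0) has_derivative (\<lambda>_. 0)) (at x)" by simp
  then have "(\<phi> has_derivative (\<lambda>_. 0)) (at x)"
    by (rule has_derivative_transform_within_open[OF _ op _ z[symmetric]]) (use assms(2) in blast)
  then have "(\<lambda>v. grad \<phi> x \<bullet> v) = (\<lambda>_. 0)"
    using has_derivative_unique[OF has_derivative_grad[OF assms(1)]] by blast
  then show ?thesis by (metis inner_eq_zero_iff)
qed

section \<open>The fundamental lemma of the calculus of variations\<close>

text \<open>The simplest \<open>C\<^sup>1\<close> function that is positive exactly on the positive half-line; bump functions
and truncations are assembled from it.\<close>

definition pos_sq :: "real \<Rightarrow> real" where "pos_sq t = (max 0 t)\<^sup>2"

lemma pos_sq_deriv: "(pos_sq has_real_derivative 2 * max 0 t) (at t)"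
proof -
  consider "t < 0" | "t = 0" | "t > 0" by linarith
  then show ?thesis
  proof cases
    case 1
    have "((\<lambda>_. 0) has_real_derivative 2 * max 0 t) (at t)" using 1 by simp
    then show ?thesis
      by (rule has_field_derivative_transform_within_open[where S="{..<0}"])
         (use 1 in \<open>auto simp: pos_sq_def\<close>)
  next
    case 2
    have "((\<lambda>h. (max 0 h)\<^sup>2 / h) \<longlongrightarrow> 0) (at (0::real))"
    proof (rule Lim_null_comparison)
      show "((\<lambda>h. \<bar>h\<bar>) \<longlongrightarrow> 0) (at (0::real))"
        by (intro tendsto_rabs_zero tendsto_ident_at)
      show "\<forall>\<^sub>F h::real in at 0. norm ((max 0 h)\<^sup>2 / h) \<le> \<bar>h\<bar>"
        by (rule always_eventually) (auto simp: max_def power2_eq_square)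
    qed
    then show ?thesis using 2 by (simp add: DERIV_def pos_sq_def)
  next
    case 3
    have "((\<lambda>t. t\<^sup>2) has_real_derivative 2 * max 0 t) (at t)"
      using 3 by (auto intro!: derivative_eq_intros)
    then show ?thesis
      by (rule has_field_derivative_transform_within_open[where S="{0<..}"])
         (use 3 in \<open>auto simp: pos_sq_def\<close>)
  qed
qed

lemma pos_sq_nonneg [simp]: "pos_sq t \<ge> 0" by (simp add: pos_sq_def)
lemma pos_sq_zero_iff [simp]: "pos_sq t = 0 \<longleftrightarrow> t \<le> 0" by (auto simp: pos_sq_def max_def)

lemma continuous_on_pos_sq [continuous_intros]:
  "continuous_on S f \<Longrightarrow> continuous_on S (\<lambda>x. pos_sq (f x))"
  unfolding pos_sq_def by (intro continuous_intros)

definition box_bump :: "'a::euclidean_space \<Rightarrow> 'a \<Rightarrow> 'a \<Rightarrow> real" where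
  "box_bump a b x = (\<Prod>i\<in>Basis. pos_sq (x \<bullet> i - a \<bullet> i) * pos_sq (b \<bullet> i - x \<bullet> i))"

lemma box_bump_nonneg: "box_bump a b x \<ge> 0"
  by (auto simp: box_bump_def intro!: prod_nonneg)

lemma box_bump_pos_iff: "box_bump a b x > 0 \<longleftrightarrow> x \<in> box a b"
proof -
  have "box_bump a b x \<noteq> 0 \<longleftrightarrow> x \<in> box a b"
    by (auto simp: box_bump_def mem_box)
  then show ?thesis using box_bump_nonneg[of a b x] by linarith
qed

definition box_bump' :: "'a::euclidean_space \<Rightarrow> 'a \<Rightarrow> 'a \<Rightarrow> 'a \<Rightarrow> real" where
  "box_bump' a b x v = (\<Sum>i\<in>Basis.
     (pos_sq (x \<bullet> i - a \<bullet> i) * (- (2 * max 0 (b \<bullet> i - x \<bullet> i) * (v \<bullet> i))) +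
      2 * max 0 (x \<bullet> i - a \<bullet> i) * (v \<bullet> i) * pos_sq (b \<bullet> i - x \<bullet> i)) *
     (\<Prod>j\<in>Basis - {i}. pos_sq (x \<bullet> j - a \<bullet> j) * pos_sq (b \<bullet> j - x \<bullet> j)))"

lemma box_bump_has_derivative: "(box_bump a b has_derivative box_bump' a b x) (at x)"
proof -
  have 1: "((\<lambda>x. pos_sq (x \<bullet> i - a \<bullet> i)) has_derivative
      (\<lambda>v. 2 * max 0 (x \<bullet> i - a \<bullet> i) * (v \<bullet> i))) (at x)" for i
  proof -
    have "((\<lambda>x. x \<bullet> i - a \<bullet> i) has_derivative (\<lambda>v. v \<bullet> i)) (at x)"
      by (auto intro!: derivative_eq_intros)
    from has_derivative_compose[OF this, of pos_sq "\<lambda>h. 2 * max 0 (x \<bullet> i - a \<bullet> i) * h"]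
    show ?thesis using pos_sq_deriv[of "x \<bullet> i - a \<bullet> i"]
      by (simp add: has_field_derivative_def)
  qed
  have 2: "((\<lambda>x. pos_sq (b \<bullet> i - x \<bullet> i)) has_derivative
      (\<lambda>v. - (2 * max 0 (b \<bullet> i - x \<bullet> i) * (v \<bullet> i)))) (at x)" for i
  proof -
    have "((\<lambda>x. b \<bullet> i - x \<bullet> i) has_derivative (\<lambda>v. - (v \<bullet> i))) (at x)"
      by (auto intro!: derivative_eq_intros)
    from has_derivative_compose[OF this, of pos_sq "\<lambda>h. 2 * max 0 (b \<bullet> i - x \<bullet> i) * h"]
    show ?thesis using pos_sq_deriv[of "b \<bullet> i - x \<bullet> i"]
      by (simp add: has_field_derivative_def)
  qed
  show ?thesis
    unfolding box_bump_def[abs_def] box_bump'_def[abs_def]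
    by (rule has_derivative_prod, rule has_derivative_mult[OF 1 2])
qed

lemma box_bump'_continuous: "continuous_on UNIV (\<lambda>x. box_bump' a b x v)"
  unfolding box_bump'_def by (intro continuous_intros)

text \<open>With \<open>h\<close> the bump, the functions \<open>n h / (1 + n h)\<close> increase to the indicator of \<open>{h > 0}\<close>; this is how
  indicators of boxes are reached from \<open>C\<^sup>1\<close> test functions.\<close>

definition box_cutoff :: "nat \<Rightarrow> 'a::euclidean_space \<Rightarrow> 'a \<Rightarrow> 'a \<Rightarrow> real" where
  "box_cutoff n a b x = 1 - inverse (1 + real n * box_bump a b x)"

lemma box_cutoff_props:
  "0 \<le> box_cutoff n a b x" "box_cutoff n a b x \<le> 1"
  "x \<notin> box a b \<Longrightarrow> box_cutoff n a b x = 0"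
proof -
  have "1 + real n * box_bump a b x \<ge> 1" using box_bump_nonneg[of a b x] by simp
  then show "0 \<le> box_cutoff n a b x" "box_cutoff n a b x \<le> 1"
    by (auto simp: box_cutoff_def inverse_le_1_iff)
  show "x \<notin> box a b \<Longrightarrow> box_cutoff n a b x = 0"
    using box_bump_pos_iff[of a b x] box_bump_nonneg[of a b x]
    by (simp add: box_cutoff_def less_le)
qed

lemma box_cutoff_tendsto:
  "(\<lambda>n. box_cutoff n a b x) \<longlonglongrightarrow> indicat_real (box a b) x"
proof (cases "x \<in> box a b")
  case True
  then have "box_bump a b x > 0" by (simp add: box_bump_pos_iff)
  then have "filterlim (\<lambda>n. 1 + real n * box_bump a b x) at_top sequentially"
    by (intro filterlim_tendsto_add_at_top[OF tendsto_const]
        filterlim_at_top_mult_tendsto_pos[OF tendsto_const _ filterlim_real_sequentially])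
  then have "(\<lambda>n. inverse (1 + real n * box_bump a b x)) \<longlonglongrightarrow> 0"
    by (rule tendsto_inverse_0_at_top)
  then have "(\<lambda>n. 1 - inverse (1 + real n * box_bump a b x)) \<longlonglongrightarrow> 1 - 0"
    by (intro tendsto_intros)
  then show ?thesis using True by (simp add: box_cutoff_def)
qed (simp add: box_cutoff_props)

lemma box_cutoff_C1c:
  assumes "cbox a b \<subseteq> \<Omega>"
  shows "box_cutoff n a b \<in> C1c \<Omega>"
proof -
  let ?D = "\<lambda>x. 1 + real n * box_bump a b x"
  have D: "?D x \<noteq> 0" for x
    using box_bump_nonneg[of a b x] by (smt (verit) mult_nonneg_nonneg of_nat_0_le_iff)
  have cb: "continuous_on UNIV (box_bump a b)"
    unfolding box_bump_def[abs_def] by (intro continuous_intros)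
  have "Ck 1 (box_cutoff n a b)"
  proof (rule Ck_1I)
    fix x
    show "(box_cutoff n a b has_derivative
        (\<lambda>v. inverse (?D x) * (real n * box_bump' a b x v) * inverse (?D x))) (at x)"
      unfolding box_cutoff_def[abs_def]
      by (rule derivative_eq_intros box_bump_has_derivative D refl | simp)+
  next
    fix v
    show "continuous_on UNIV
        (\<lambda>x. inverse (?D x) * (real n * box_bump' a b x v) * inverse (?D x))"
      using D by (intro continuous_intros cb box_bump'_continuous) auto
  qed
  moreover have sub: "closure {x. box_cutoff n a b x \<noteq> 0} \<subseteq> cbox a b"
    using box_cutoff_props(3)[of _ a b n] box_subset_cbox[of a b]
    by (intro closure_minimal) (auto simp: closed_cbox)
  moreover have "compact (closure {x. box_cutoff n a b x \<noteq> 0})"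
    using sub compact_cbox by (meson closed_closure compact_Int_closed inf.absorb_iff2 compact_eq_bounded_closed bounded_subset)
  ultimately show ?thesis using assms by (auto simp: C1c_def)
qed

text \<open>Boxes form an intersection-stable generator of the Borel sets, and the sets over which the
integral vanishes form a Dynkin system.\<close>

lemma AE_zero_of_box_integrals:
  fixes f :: "'a::euclidean_space \<Rightarrow> real"
  assumes f: "integrable lborel f"
    and box: "\<And>c d. (LINT z:box c d|lborel. f z) = 0"
    and tot: "(LINT z|lborel. f z) = 0"
  shows "AE z in lborel. f z = 0"
proof (rule sigma_finite_measure.density_zero[OF sigma_finite_lborel f])
  fix A :: "'a set" assume "A \<in> sets lborel"
  then have A: "A \<in> sigma_sets UNIV (range (\<lambda>(a, b). box a b))"
    by (simp add: borel_eq_box)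
  have st: "Int_stable (range (\<lambda>(a, b). box a b :: 'a set))"
  proof (rule Int_stableI, clarify)
    fix a b c d :: 'a
    obtain e h where "box a b \<inter> box c d = box e h" using box_Int_box[of a b c d] by blast
    then show "box a b \<inter> box c d \<in> range (\<lambda>(a, b). box a b)"
      by (auto intro: range_eqI[where x="(e, h)"])
  qed
  have pow: "range (\<lambda>(a, b). box a b :: 'a set) \<subseteq> Pow UNIV" by simp
  show "(LINT z:A|lborel. f z) = 0"
    using st pow A
  proof (induction rule: sigma_sets_induct_disjoint)
    case (basic A)
    then show ?case using box by auto
  next
    case empty
    then show ?case by (simp add: set_lebesgue_integral_def)
  next
    case (compl A)
    then have A: "A \<in> sets lborel" by (simp add: borel_eq_box)
    have "(LINT z:UNIV - A|lborel. f z) = (LINT z|lborel. f z - indicator A z *\<^sub>R f z)"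
      unfolding set_lebesgue_integral_def
      by (rule Bochner_Integration.integral_cong) (auto simp: indicator_def)
    also have "\<dots> = 0"
      using tot compl A f integrable_mult_indicator[OF A f]
      by (simp add: set_lebesgue_integral_def)
    finally show ?case .
  next
    case (union A)
    then have A: "A i \<in> sets lborel" for i by (auto simp: borel_eq_box)
    have *: "set_integrable lborel (\<Union>(range A)) f"
      unfolding set_integrable_def using A f by (intro integrable_mult_indicator) auto
    show ?case
      using lebesgue_integral_countable_add[of A lborel f] A union(1) * union
      by (auto simp: disjoint_family_on_def)
  qed
qed

lemma open_box_AE:
  fixes \<Omega> :: "'a::euclidean_space set"
  assumes "open \<Omega>" and "\<And>a b. cbox a b \<subseteq> \<Omega> \<Longrightarrow> AE z in lborel. z \<in> box a b \<longrightarrow> P z"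
  shows "AE z in lborel. z \<in> \<Omega> \<longrightarrow> P z"
proof -
  obtain D where D: "countable D" "D \<subseteq> Pow \<Omega>" "\<And>X. X \<in> D \<Longrightarrow> \<exists>a b. X = cbox a b" "\<Union>D = \<Omega>"
    using open_countable_Union_open_cbox[OF assms(1)] by metis
  have "AE z in lborel. \<forall>X\<in>D. z \<in> X \<longrightarrow> P z"
  proof (rule AE_ball_countable'[OF _ D(1)])
    fix X assume "X \<in> D"
    with D obtain a b where X: "X = cbox a b" "cbox a b \<subseteq> \<Omega>" by blast
    have "cbox a b - box a b \<in> null_sets lborel"
      using negligible_frontier_interval[of a b]
      by (simp add: negligible_iff_null_sets null_sets_completion_iff)
    then have "AE z in lborel. z \<notin> cbox a b - box a b" by (rule AE_not_in)
    with assms(2)[OF X(2)] show "AE z in lborel. z \<in> X \<longrightarrow> P z"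
      unfolding X by eventually_elim auto
  qed
  then show ?thesis
    by eventually_elim (use D(4) in auto)
qed

text \<open>Over a box whose closure lies in \<open>\<Omega>\<close> the integral of \<open>g\<close> is the limit of the integrals against
the cutoffs, by dominated convergence, and so vanishes.\<close>

lemma fundamental_lemma_variations:
  fixes g :: "'a::euclidean_space \<Rightarrow> real"
  assumes "open \<Omega>" and g: "locally_integrable \<Omega> g"
    and zero: "\<And>\<phi>. \<phi> \<in> C1c \<Omega> \<Longrightarrow> (LINT z:\<Omega>|lborel. g z * \<phi> z) = 0"
  shows "AE z in lborel. z \<in> \<Omega> \<longrightarrow> g z = 0"
proof (rule open_box_AE[OF \<open>open \<Omega>\<close>])
  fix a b :: 'a assume ab: "cbox a b \<subseteq> \<Omega>"
  define F where "F z = indicat_real (cbox a b) z * g z" for z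
  have F: "integrable lborel F"
    using g ab unfolding locally_integrable_def set_integrable_def F_def by simp
  have sub: "(LINT z:box c d|lborel. F z) = 0" if cd: "cbox c d \<subseteq> cbox a b" for c d
  proof -
    have cut: "(LINT z|lborel. box_cutoff n c d z * F z) = 0" for n
    proof -
      have "(LINT z|lborel. box_cutoff n c d z * F z) =
          (LINT z:\<Omega>|lborel. g z * box_cutoff n c d z)"
        unfolding set_lebesgue_integral_def
      proof (rule Bochner_Integration.integral_cong[OF refl])
        fix z show "box_cutoff n c d z * F z = indicator \<Omega> z *\<^sub>R (g z * box_cutoff n c d z)"
          using box_cutoff_props(3)[of z c d n] box_subset_cbox[of c d] cd ab
          by (cases "z \<in> box c d") (auto simp: F_def indicator_def)
      qed
      also have "\<dots> = 0"
        using cd ab by (intro zero box_cutoff_C1c) auto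
      finally show ?thesis .
    qed
    have m: "box_cutoff n c d \<in> borel_measurable lborel" for n
      using box_cutoff_C1c[OF subset_refl, of n c d] Ck_1_continuous
      by (auto simp: C1c_def intro: borel_measurable_continuous_onI)
    have "(\<lambda>n. LINT z|lborel. box_cutoff n c d z * F z) \<longlonglongrightarrow>
        (LINT z|lborel. indicator (box c d) z * F z)"
    proof (rule integral_dominated_convergence[where w="\<lambda>z. norm (F z)"])
      show "AE z in lborel. norm (box_cutoff n c d z * F z) \<le> norm (F z)" for n
        using box_cutoff_props(1,2)[of n c d]
        by (intro AE_I2) (simp add: abs_mult mult_left_le_one_le)
    qed (use F m in \<open>auto intro!: tendsto_intros box_cutoff_tendsto borel_measurable_times\<close>)
    then show ?thesis
      unfolding cut by (simp add: set_lebesgue_integral_def LIMSEQ_const_iff)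
  qed
  define f where "f z = indicat_real (box a b) z * F z" for z
  have f: "integrable lborel f"
    using integrable_mult_indicator[OF _ F, of "box a b"] by (simp add: f_def[abs_def])
  have "AE z in lborel. f z = 0"
  proof (rule AE_zero_of_box_integrals[OF f])
    show "(LINT z|lborel. f z) = 0"
      using sub[OF subset_refl] by (simp add: set_lebesgue_integral_def f_def)
    show "(LINT z:box c d|lborel. f z) = 0" for c d
    proof -
      obtain e h where eh: "box a b \<inter> box c d = box e h" using box_Int_box[of a b c d] by blast
      have "(LINT z:box c d|lborel. f z) = (LINT z:box e h|lborel. F z)"
        unfolding set_lebesgue_integral_def f_def
        by (rule Bochner_Integration.integral_cong)
           (auto simp: indicator_def simp flip: eh)
      also have "\<dots> = 0"
      proof (cases "box e h = {}")
        case False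
        then have "cbox e h = closure (box e h)" by (simp add: closure_box)
        also have "\<dots> \<subseteq> cbox a b"
          unfolding eh[symmetric] using box_subset_cbox[of a b]
          by (intro closure_minimal) auto
        finally show ?thesis by (rule sub)
      qed (simp add: set_lebesgue_integral_def)
      finally show ?thesis .
    qed
  qed
  then show "AE z in lborel. z \<in> box a b \<longrightarrow> g z = 0"
    by eventually_elim (use box_subset_cbox[of a b] in \<open>auto simp: f_def F_def indicator_def split: if_splits\<close>)
qed

section \<open>Integration by parts for piecewise smooth functions\<close>

text \<open>Being Borel and bounded on bounded sets is preserved by sums and products and gives
integrability over every bounded Borel set. This settles every integrability question about the
explicit functions below.\<close>

definition locally_bounded_borel :: "('a::euclidean_space \<Rightarrow> real) \<Rightarrow> bool" where
  "locally_bounded_borel g \<longleftrightarrow>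
     g \<in> borel_measurable borel \<and> (\<forall>R. \<exists>B. \<forall>z. norm z \<le> R \<longrightarrow> \<bar>g z\<bar> \<le> B)"

lemma lbb_continuous: "continuous_on UNIV g \<Longrightarrow> locally_bounded_borel g"
proof -
  assume g: "continuous_on UNIV g"
  have "\<exists>B. \<forall>z. norm z \<le> R \<longrightarrow> \<bar>g z\<bar> \<le> B" for R
  proof -
    have "compact (g ` cball 0 R)"
      using g by (intro compact_continuous_image) (auto intro: continuous_on_subset)
    then obtain B where "\<forall>x \<in> g ` cball 0 R. norm x \<le> B"
      using compact_imp_bounded bounded_iff by metis
    then show ?thesis by (auto intro!: exI[of _ B])
  qed
  with g show ?thesis
    by (auto simp: locally_bounded_borel_def intro: borel_measurable_continuous_onI)
qed

lemma lbb_add: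
  assumes "locally_bounded_borel f" "locally_bounded_borel g"
  shows "locally_bounded_borel (\<lambda>z. f z + g z)"
proof -
  have "\<exists>B. \<forall>z. norm z \<le> R \<longrightarrow> \<bar>f z + g z\<bar> \<le> B" for R
  proof -
    obtain A B where "\<And>z. norm z \<le> R \<Longrightarrow> \<bar>f z\<bar> \<le> A" "\<And>z. norm z \<le> R \<Longrightarrow> \<bar>g z\<bar> \<le> B"
      using assms unfolding locally_bounded_borel_def by metis
    then show ?thesis by (intro exI[of _ "A + B"]) (smt (verit))
  qed
  with assms show ?thesis by (auto simp: locally_bounded_borel_def)
qed

lemma lbb_mult:
  assumes "locally_bounded_borel f" "locally_bounded_borel g"
  shows "locally_bounded_borel (\<lambda>z. f z * g z)"
proof -
  have "\<exists>B. \<forall>z. norm z \<le> R \<longrightarrow> \<bar>f z * g z\<bar> \<le> B" for R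
  proof -
    obtain A B where "\<And>z. norm z \<le> R \<Longrightarrow> \<bar>f z\<bar> \<le> A" "\<And>z. norm z \<le> R \<Longrightarrow> \<bar>g z\<bar> \<le> B"
      using assms unfolding locally_bounded_borel_def by metis
    then have "\<bar>f z * g z\<bar> \<le> A * B" if "norm z \<le> R" for z
      using that by (auto simp: abs_mult intro!: mult_mono') 
    then show ?thesis by blast
  qed
  with assms show ?thesis by (auto simp: locally_bounded_borel_def)
qed

lemma lbb_const: "locally_bounded_borel (\<lambda>_. c)"
  by (auto simp: locally_bounded_borel_def)

lemma lbb_diff:
  assumes "locally_bounded_borel f" "locally_bounded_borel g"
  shows "locally_bounded_borel (\<lambda>z. f z - g z)"
  using lbb_add[OF assms(1) lbb_mult[OF lbb_const[of "-1"] assms(2)]] by simp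

lemma lbb_slice:
  fixes g :: "real \<times> real \<Rightarrow> real"
  assumes "locally_bounded_borel g"
  shows "locally_bounded_borel (\<lambda>r. g (r, t))" "locally_bounded_borel (\<lambda>t. g (r, t))"
proof -
  have 1: "\<exists>B. \<forall>r. norm r \<le> R \<longrightarrow> \<bar>g (r, t)\<bar> \<le> B" for R t
  proof -
    obtain B where B: "\<And>z. norm z \<le> R + \<bar>t\<bar> \<Longrightarrow> \<bar>g z\<bar> \<le> B"
      using assms unfolding locally_bounded_borel_def by metis
    show ?thesis 
      by (intro exI[of _ B] allI impI B order.trans[OF norm_Pair_le]) simp
  qed
  have 2: "\<exists>B. \<forall>t. norm t \<le> R \<longrightarrow> \<bar>g (r, t)\<bar> \<le> B" for R r
  proof -
    obtain B where B: "\<And>z. norm z \<le> \<bar>r\<bar> + R \<Longrightarrow> \<bar>g z\<bar> \<le> B"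
      using assms unfolding locally_bounded_borel_def by metis
    show ?thesis 
      by (intro exI[of _ B] allI impI B order.trans[OF norm_Pair_le]) simp
  qed
  have m: "g \<in> borel_measurable borel" using assms by (simp add: locally_bounded_borel_def)
  have "(\<lambda>r. g (r, t)) \<in> borel_measurable borel"
    by (rule measurable_compose[OF _ m]) (intro borel_measurable_continuous_onI continuous_intros)
  moreover have "(\<lambda>t. g (r, t)) \<in> borel_measurable borel"
    by (rule measurable_compose[OF _ m]) (intro borel_measurable_continuous_onI continuous_intros)
  ultimately show "locally_bounded_borel (\<lambda>r. g (r, t))" "locally_bounded_borel (\<lambda>t. g (r, t))"
    using 1 2 by (auto simp: locally_bounded_borel_def)
qed

lemma lbb_bound:
  assumes "g \<in> borel_measurable borel" "\<And>z. \<bar>g z\<bar> \<le> h z" "locally_bounded_borel h"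
  shows "locally_bounded_borel g"
proof -
  have "\<exists>B. \<forall>z. norm z \<le> R \<longrightarrow> \<bar>g z\<bar> \<le> B" for R
  proof -
    obtain B where "\<And>z. norm z \<le> R \<Longrightarrow> \<bar>h z\<bar> \<le> B"
      using assms(3) unfolding locally_bounded_borel_def by metis
    then show ?thesis using assms(2) by (intro exI[of _ B]) (smt (verit))
  qed
  with assms(1) show ?thesis by (simp add: locally_bounded_borel_def)
qed

lemma lbb_snd:
  assumes "locally_bounded_borel g"
  shows "locally_bounded_borel (\<lambda>z::real \<times> real. g (snd z))"
proof -
  have "\<exists>B. \<forall>z::real \<times> real. norm z \<le> R \<longrightarrow> \<bar>g (snd z)\<bar> \<le> B" for R
  proof -
    obtain B where B: "\<And>z. norm z \<le> R \<Longrightarrow> \<bar>g z\<bar> \<le> B"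
      using assms unfolding locally_bounded_borel_def by metis
    have "\<bar>g (snd z)\<bar> \<le> B" if "norm z \<le> R" for z :: "real \<times> real"
      using norm_snd_le[of "snd z" "fst z"] that by (intro B) simp
    then show ?thesis by blast
  qed
  moreover have "(\<lambda>z::real \<times> real. g (snd z)) \<in> borel_measurable borel"
  proof -
    have "(snd :: real \<times> real \<Rightarrow> real) \<in> borel_measurable borel"
      by (rule borel_measurable_continuous_onI) (intro continuous_intros)
    moreover have "g \<in> borel_measurable borel" using assms by (simp add: locally_bounded_borel_def)
    ultimately show ?thesis by (rule measurable_compose)
  qed
  ultimately show ?thesis by (simp add: locally_bounded_borel_def)
qed

lemma lbb_sum_square:
  assumes "locally_bounded_borel f" "locally_bounded_borel g"
  shows "locally_bounded_borel (\<lambda>z. (f z)\<^sup>2 + (g z)\<^sup>2)"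
  unfolding power2_eq_square by (intro lbb_add lbb_mult assms)

lemma lbb_set_integrable:
  assumes "locally_bounded_borel g" "bounded S" "S \<in> sets borel"
  shows "set_integrable lborel S g"
proof -
  obtain R where R: "\<And>z. z \<in> S \<Longrightarrow> norm z \<le> R" using assms(2) by (auto simp: bounded_iff)
  obtain B where B: "\<And>z. norm z \<le> R \<Longrightarrow> \<bar>g z\<bar> \<le> B"
    using assms(1) unfolding locally_bounded_borel_def by metis
  have m: "g \<in> borel_measurable borel" using assms by (simp add: locally_bounded_borel_def)
  show ?thesis
    unfolding set_integrable_def
  proof (rule integrableI_bounded_set[where A=S and B=B])
    show "emeasure lborel S < \<infinity>" using emeasure_bounded_finite[OF assms(2)] .
    show "AE x\<in>S in lborel. norm (indicat_real S x *\<^sub>R g x) \<le> B"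
      using R B by (auto simp: indicator_def)
  qed (use assms(3) m in auto)
qed

text \<open>The interval is left undetermined at its end points because the coordinate rectangle of the
cone is open in \<open>r\<close> and half-open in \<open>t\<close>.\<close>

lemma integral_of_derivative_zero:
  fixes F g :: "real \<Rightarrow> real"
  assumes "a \<le> b" and "finite S"
    and der: "\<And>x. x \<in> {a<..<b} - S \<Longrightarrow> (F has_real_derivative g x) (at x)"
    and cont: "continuous_on {a..b} F" and ends: "F a = F b"
    and g: "locally_bounded_borel g"
    and I: "{a<..<b} \<subseteq> I" "I \<subseteq> {a..b}"
  shows "(LINT x:I|lborel. g x) = 0"
proof -
  have "(g has_integral (F b - F a)) {a..b}"
    using assms(1-4)
    by (intro fundamental_theorem_of_calculus_interior_strong[OF \<open>finite S\<close>])
       (auto simp: has_real_derivative_iff_has_vector_derivative)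
  then have "integral {a..b} g = 0" using ends by (simp add: integral_unique)
  then have *: "(LINT x:{a..b}|lborel. g x) = 0"
    using set_borel_integral_eq_integral(2)[of "{a..b}" g] lbb_set_integrable[OF g, of "{a..b}"]
    by simp
  have I_eq: "I = {a<..<b} \<union> (I \<inter> {a, b})" using I by force
  have Im: "I \<in> sets borel"
    by (subst I_eq) (intro sets.Un borel_open open_greaterThanLessThan borel_closed finite_imp_closed, auto)
  have m: "g \<in> borel_measurable borel" using g by (simp add: locally_bounded_borel_def)
  have "(LINT x:I|lborel. g x) = (LINT x:{a..b}|lborel. g x)"
    unfolding set_lebesgue_integral_def
  proof (rule integral_cong_AE)
    have "AE x in lborel. x \<noteq> a \<and> x \<noteq> b" using AE_lborel_singleton[of a] AE_lborel_singleton[of b] by eventually_elim auto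
    then show "AE x in lborel. indicat_real I x *\<^sub>R g x = indicat_real {a..b} x *\<^sub>R g x"
      by eventually_elim (use I in \<open>auto simp: indicator_def subset_iff\<close>)
  qed (use Im m in auto)
  with * show ?thesis by simp
qed

lemma set_integral_Times_zero:
  fixes g :: "real \<times> real \<Rightarrow> real"
  assumes g: "locally_bounded_borel g"
    and I: "bounded I" "I \<in> sets borel" and J: "bounded J" "J \<in> sets borel"
    and zero: "(\<forall>t\<in>J. (LINT r:I|lborel. g (r, t)) = 0) \<or>
               (\<forall>r\<in>I. (LINT t:J|lborel. g (r, t)) = 0)"
  shows "(LINT z:I \<times> J|lborel. g z) = 0"
proof -
  let ?h = "\<lambda>r t. indicat_real I r * (indicat_real J t * g (r, t))"
  have IJ: "bounded (I \<times> J)" "I \<times> J \<in> sets borel"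
    using I J by (auto simp: bounded_Times borel_prod[symmetric])
  have eq: "(\<lambda>z. indicat_real (I \<times> J) z *\<^sub>R g z) = case_prod ?h"
    by (auto simp: fun_eq_iff indicator_def)
  have int: "integrable (lborel \<Otimes>\<^sub>M lborel) (case_prod ?h)"
    using lbb_set_integrable[OF g IJ] unfolding set_integrable_def eq lborel_prod .
  have eq2: "(LINT z:I \<times> J|lborel. g z) = integral\<^sup>L (lborel \<Otimes>\<^sub>M lborel) (case_prod ?h)"
    unfolding set_lebesgue_integral_def eq lborel_prod ..
  show ?thesis using zero
  proof
    assume z: "\<forall>t\<in>J. (LINT r:I|lborel. g (r, t)) = 0"
    have "(LINT r|lborel. ?h r t) = 0" for t
      using z by (cases "t \<in> J") (auto simp: set_lebesgue_integral_def)
    then show ?thesis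
      unfolding eq2 lborel_pair.integral_snd[OF int, symmetric] by simp
  next
    assume z: "\<forall>r\<in>I. (LINT t:J|lborel. g (r, t)) = 0"
    have "(LINT t|lborel. ?h r t) = 0" for r
      using z by (cases "r \<in> I") (auto simp: set_lebesgue_integral_def)
    then show ?thesis
      unfolding eq2 lborel_pair.integral_fst[OF int, symmetric] by (simp only: Bochner_Integration.integral_zero)
  qed
qed

lemma lbb_locally_integrable: "locally_bounded_borel g \<Longrightarrow> locally_integrable \<Omega> g"
  unfolding locally_integrable_def
  by (auto intro!: lbb_set_integrable dest: compact_imp_bounded simp: borel_compact)

lemma grad_partials:
  assumes "Ck 1 \<phi>"
  shows "((\<lambda>r. \<phi> (r, t)) has_real_derivative fst (grad \<phi> (r, t))) (at r)"
    and "((\<lambda>t. \<phi> (r, t)) has_real_derivative snd (grad \<phi> (r, t))) (at t)"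
proof -
  have d: "(\<phi> has_derivative (\<lambda>v. grad \<phi> (r, t) \<bullet> v)) (at (r, t))"
    by (rule has_derivative_grad[OF assms])
  have "((\<lambda>r. (r, t)) has_derivative (\<lambda>h. (h, 0))) (at r)"
    by (auto intro!: derivative_eq_intros)
  from has_derivative_compose[OF this d]
  show "((\<lambda>r. \<phi> (r, t)) has_real_derivative fst (grad \<phi> (r, t))) (at r)"
    by (simp add: has_field_derivative_def inner_prod_def)
  have "((\<lambda>t. (r, t)) has_derivative (\<lambda>h. (0, h))) (at t)"
    by (auto intro!: derivative_eq_intros)
  from has_derivative_compose[OF this d]
  show "((\<lambda>t. \<phi> (r, t)) has_real_derivative snd (grad \<phi> (r, t))) (at t)"
    by (simp add: has_field_derivative_def inner_prod_def)
qed

text \<open>After multiplication by a test function the integrand has compact support, so on each line the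
fundamental theorem of calculus gives \<open>0\<close>; it tolerates finitely many exceptional points as long
as the function is continuous there.\<close>

lemma weak_derivative_piecewise_smooth:
  fixes f p q :: "real \<times> real \<Rightarrow> real"
  assumes f: "continuous_on UNIV f"
    and p: "\<And>r t. ((\<lambda>r. f (r, t)) has_real_derivative p (r, t)) (at r)"
    and q: "\<And>r t. t \<notin> N \<Longrightarrow> ((\<lambda>t. f (r, t)) has_real_derivative q (r, t)) (at t)"
    and N: "\<And>a b. finite (N \<inter> {a..b})"
    and lbb: "locally_bounded_borel p" "locally_bounded_borel q"
  shows "weak_directional_derivative \<Omega> v f (\<lambda>z. fst v * p z + snd v * q z)"
  unfolding weak_directional_derivative_def
proof (intro conjI ballI)
  have lf: "locally_bounded_borel f" by (rule lbb_continuous[OF f])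
  have lg: "locally_bounded_borel (\<lambda>z. fst v * p z + snd v * q z)"
    by (intro lbb_add lbb_mult lbb_const lbb)
  show "locally_integrable \<Omega> f" "locally_integrable \<Omega> (\<lambda>z. fst v * p z + snd v * q z)"
    using lf lg by (auto intro: lbb_locally_integrable)
  fix \<phi> :: "real \<times> real \<Rightarrow> real" assume phi: "\<phi> \<in> C1c \<Omega>"
  then have C: "Ck 1 \<phi>" and sub: "closure {x. \<phi> x \<noteq> 0} \<subseteq> \<Omega>"
    and "compact (closure {x. \<phi> x \<noteq> 0})" by (auto simp: C1c_def)
  then obtain M where M: "M > 0" "\<And>x. x \<in> closure {x. \<phi> x \<noteq> 0} \<Longrightarrow> norm x \<le> M"
    using compact_imp_bounded bounded_pos by metis
  define R where "R = M + 1"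
  have R: "R > 0" using M by (simp add: R_def)
  define I where "I = {-R<..<R}"
  have inQ: "x \<in> I \<times> I" if "x \<in> closure {x. \<phi> x \<noteq> 0}" for x
  proof -
    have "norm x < R" using M(2)[OF that] by (simp add: R_def)
    then have "\<bar>fst x\<bar> < R" "\<bar>snd x\<bar> < R"
      using norm_fst_le[of "fst x" "snd x"] norm_snd_le[of "snd x" "fst x"] by auto
    then show ?thesis by (cases x) (auto simp: I_def)
  qed
  have phi0: "\<phi> x = 0" "grad \<phi> x = 0" if "x \<notin> closure {x. \<phi> x \<noteq> 0}" for x
    using that closure_subset[of "{x. \<phi> x \<noteq> 0}"] grad_zero_outside_support[OF C that] by auto
  have phi_end: "\<phi> (r, t) = 0" if "\<not> (\<bar>r\<bar> < R \<and> \<bar>t\<bar> < R)" for r t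
    using phi0(1)[of "(r, t)"] inQ[of "(r, t)"] that
    by (cases "(r, t) \<in> closure {x. \<phi> x \<noteq> 0}") (auto simp: I_def abs_less_iff)
  have restr: "(LINT z:\<Omega>|lborel. F z) = (LINT z:I \<times> I|lborel. F z)"
    if F: "\<And>x. x \<notin> closure {x. \<phi> x \<noteq> 0} \<Longrightarrow> F x = 0" for F :: "real \<times> real \<Rightarrow> real"
    unfolding set_lebesgue_integral_def
  proof (rule Bochner_Integration.integral_cong[OF refl])
    fix z show "indicator \<Omega> z *\<^sub>R F z = indicator (I \<times> I) z *\<^sub>R F z"
      using F[of z] inQ[of z] sub by (cases "z \<in> closure {x. \<phi> x \<noteq> 0}") (auto simp: indicator_def)
  qed
  have lphi: "locally_bounded_borel \<phi>" by (rule lbb_continuous[OF Ck_1_continuous[OF C]])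
  have l1: "locally_bounded_borel (\<lambda>z. fst (grad \<phi> z))" "locally_bounded_borel (\<lambda>z. snd (grad \<phi> z))"
    by (intro lbb_continuous continuous_intros continuous_grad[OF C])+
  have bI: "bounded I" "I \<in> sets borel" by (auto simp: I_def)
  have bQ: "bounded (I \<times> I)" "I \<times> I \<in> sets borel"
    using bI by (auto simp: bounded_Times borel_prod[symmetric])
  define h1 where "h1 z = p z * \<phi> z + fst (grad \<phi> z) * f z" for z
  define h2 where "h2 z = q z * \<phi> z + snd (grad \<phi> z) * f z" for z
  have lh: "locally_bounded_borel h1" "locally_bounded_borel h2"
    unfolding h1_def[abs_def] h2_def[abs_def] by (intro lbb_add lbb_mult lbb lphi l1 lf)+
  have cp: "continuous_on S (\<lambda>r. f (r, t))" "continuous_on S (\<lambda>t. f (r, t))"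
     "continuous_on S (\<lambda>r. \<phi> (r, t))" "continuous_on S (\<lambda>t. \<phi> (r, t))" for S r t
    by (rule continuous_on_compose2[OF f] continuous_on_compose2[OF Ck_1_continuous[OF C]];
        auto intro!: continuous_intros)+
  have z1: "(LINT z:I \<times> I|lborel. h1 z) = 0"
  proof (rule set_integral_Times_zero[OF lh(1) bI bI], rule disjI1, rule ballI)
    fix t
    show "(LINT r:I|lborel. h1 (r, t)) = 0"
    proof (rule integral_of_derivative_zero[where a="-R" and b=R and S="{}" and F="\<lambda>r. f (r, t) * \<phi> (r, t)"])
      show "((\<lambda>r. f (r, t) * \<phi> (r, t)) has_real_derivative h1 (r, t)) (at r)" for r
        unfolding h1_def by (rule DERIV_mult[OF p grad_partials(1)[OF C]])
    qed (use R lbb_slice[OF lh(1)] phi_end in \<open>auto simp: I_def intro!: continuous_intros cp\<close>)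
  qed
  have z2: "(LINT z:I \<times> I|lborel. h2 z) = 0"
  proof (rule set_integral_Times_zero[OF lh(2) bI bI], rule disjI2, rule ballI)
    fix r
    show "(LINT t:I|lborel. h2 (r, t)) = 0"
    proof (rule integral_of_derivative_zero[where a="-R" and b=R and S="N \<inter> {-R..R}" and F="\<lambda>t. f (r, t) * \<phi> (r, t)"])
      show "((\<lambda>t. f (r, t) * \<phi> (r, t)) has_real_derivative h2 (r, t)) (at t)"
        if "t \<in> {-R<..<R} - N \<inter> {-R..R}" for t
        unfolding h2_def by (rule DERIV_mult[OF q grad_partials(2)[OF C]]) (use that in auto)
    qed (use R N lbb_slice[OF lh(2)] phi_end in \<open>auto simp: I_def intro!: continuous_intros cp\<close>)
  qed
  have i1: "set_integrable lborel (I \<times> I) (\<lambda>z. f z * (grad \<phi> z \<bullet> v))"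
    unfolding inner_prod_def inner_real_def by (intro lbb_set_integrable[OF _ bQ] lbb_mult lbb_add lf l1 lbb_const)
  have i2: "set_integrable lborel (I \<times> I) (\<lambda>z. (fst v * p z + snd v * q z) * \<phi> z)"
    by (intro lbb_set_integrable[OF _ bQ] lbb_mult lg lphi)
  have "(LINT z:I \<times> I|lborel. f z * (grad \<phi> z \<bullet> v)) + (LINT z:I \<times> I|lborel. (fst v * p z + snd v * q z) * \<phi> z)
     = (LINT z:I \<times> I|lborel. f z * (grad \<phi> z \<bullet> v) + (fst v * p z + snd v * q z) * \<phi> z)"
    using set_integral_add(2)[OF i1 i2] by simp
  also have "\<dots> = (LINT z:I \<times> I|lborel. fst v * h1 z + snd v * h2 z)"
    by (simp add: h1_def h2_def inner_prod_def algebra_simps)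
  also have "\<dots> = (LINT z:I \<times> I|lborel. fst v * h1 z) + (LINT z:I \<times> I|lborel. snd v * h2 z)"
    by (intro set_integral_add(2) lbb_set_integrable[OF _ bQ] lbb_mult lbb_const lh)
  also have "\<dots> = 0" using z1 z2 by simp
  finally have "(LINT z:I \<times> I|lborel. f z * (grad \<phi> z \<bullet> v)) =
      - (LINT z:I \<times> I|lborel. (fst v * p z + snd v * q z) * \<phi> z)" by simp
  moreover have "(LINT z:\<Omega>|lborel. f z * (grad \<phi> z \<bullet> v)) =
      (LINT z:I \<times> I|lborel. f z * (grad \<phi> z \<bullet> v))"
    by (rule restr, drule phi0(2)) simp
  moreover have "(LINT z:\<Omega>|lborel. (fst v * p z + snd v * q z) * \<phi> z) =
      (LINT z:I \<times> I|lborel. (fst v * p z + snd v * q z) * \<phi> z)"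
    by (rule restr, drule phi0(1)) simp
  ultimately show "(LINT z:\<Omega>|lborel. f z * frechet_derivative \<phi> (at z) v) =
      - (LINT z:\<Omega>|lborel. (fst v * p z + snd v * q z) * \<phi> z)"
    unfolding frechet_derivative_grad[OF C] by simp
qed

section \<open>Weak directional derivatives\<close>

lemma locally_integrable_mult_test:
  fixes g \<psi> :: "'a::euclidean_space \<Rightarrow> real"
  assumes g: "locally_integrable \<Omega> g" and "continuous_on UNIV \<psi>"
    and K: "compact K" "K \<subseteq> \<Omega>" "\<And>x. x \<notin> K \<Longrightarrow> \<psi> x = 0"
  shows "set_integrable lborel \<Omega> (\<lambda>z. g z * \<psi> z)"
proof -
  have "locally_bounded_borel \<psi>" by (rule lbb_continuous) fact
  then have m: "\<psi> \<in> borel_measurable borel" and "\<exists>B. \<forall>z. norm z \<le> R \<longrightarrow> \<bar>\<psi> z\<bar> \<le> B" for R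
    by (auto simp: locally_bounded_borel_def)
  moreover obtain R where R: "\<And>z. z \<in> K \<Longrightarrow> norm z \<le> R"
    using compact_imp_bounded[OF K(1)] by (auto simp: bounded_iff)
  ultimately obtain B where B: "\<And>z. z \<in> K \<Longrightarrow> \<bar>\<psi> z\<bar> \<le> B" by metis
  have i: "integrable lborel (\<lambda>z. indicator K z *\<^sub>R g z)"
    using g K unfolding locally_integrable_def set_integrable_def by blast
  have "integrable lborel (\<lambda>z. (indicator K z *\<^sub>R g z) * \<psi> z)"
  proof (rule Bochner_Integration.integrable_bound)
    show "integrable lborel (\<lambda>z. B * (indicator K z *\<^sub>R g z))"
      using i by (rule integrable_mult_right)
    show "(\<lambda>z. (indicator K z *\<^sub>R g z) * \<psi> z) \<in> borel_measurable lborel"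
      using borel_measurable_integrable[OF i] m by (intro borel_measurable_times) auto
    show "AE z in lborel. norm ((indicator K z *\<^sub>R g z) * \<psi> z) \<le> norm (B * (indicator K z *\<^sub>R g z))"
    proof (intro AE_I2)
      fix z
      show "norm ((indicator K z *\<^sub>R g z) * \<psi> z) \<le> norm (B * (indicator K z *\<^sub>R g z))"
        using B[of z] by (cases "z \<in> K") (auto simp: abs_mult mult.commute[of "g z"] intro!: mult_right_mono)
    qed
  qed
  then show ?thesis
    unfolding set_integrable_def
    by (rule back_subst[where P="integrable lborel"]) (use K in \<open>auto simp: fun_eq_iff indicator_def\<close>)
qed

lemma weak_directional_derivative_test_integrable:
  assumes "weak_directional_derivative \<Omega> v f g" and phi: "\<phi> \<in> C1c \<Omega>"
  shows "set_integrable lborel \<Omega> (\<lambda>z. f z * frechet_derivative \<phi> (at z) v)"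
    and "set_integrable lborel \<Omega> (\<lambda>z. g z * \<phi> z)"
proof -
  have l: "locally_integrable \<Omega> f" "locally_integrable \<Omega> g"
    using assms(1) by (auto simp: weak_directional_derivative_def)
  have C: "Ck 1 \<phi>" "compact (closure {x. \<phi> x \<noteq> 0})" "closure {x. \<phi> x \<noteq> 0} \<subseteq> \<Omega>"
    using phi by (auto simp: C1c_def)
  show "set_integrable lborel \<Omega> (\<lambda>z. f z * frechet_derivative \<phi> (at z) v)"
  proof (rule locally_integrable_mult_test[OF l(1) _ C(2,3)])
    show "frechet_derivative \<phi> (at x) v = 0" if "x \<notin> closure {x. \<phi> x \<noteq> 0}" for x
      unfolding frechet_derivative_grad[OF C(1)] grad_zero_outside_support[OF C(1) that] by simp
  qed (use C(1) in \<open>simp add: Ck_1_iff\<close>)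
  show "set_integrable lborel \<Omega> (\<lambda>z. g z * \<phi> z)"
  proof (rule locally_integrable_mult_test[OF l(2) Ck_1_continuous[OF C(1)] C(2,3)])
    show "\<phi> x = 0" if "x \<notin> closure {x. \<phi> x \<noteq> 0}" for x
      using that closure_subset[of "{x. \<phi> x \<noteq> 0}"] by blast
  qed
qed

lemma locally_integrable_linear:
  assumes "locally_integrable \<Omega> f" "locally_integrable \<Omega> g"
  shows "locally_integrable \<Omega> (\<lambda>z. a * f z + b * g z)"
  using assms unfolding locally_integrable_def
  by (auto intro!: set_integral_add(1) set_integrable_mult_right)

lemma weak_directional_derivative_linear:
  assumes 1: "weak_directional_derivative \<Omega> v f f'" and 2: "weak_directional_derivative \<Omega> v g g'"
  shows "weak_directional_derivative \<Omega> v (\<lambda>z. a * f z + b * g z) (\<lambda>z. a * f' z + b * g' z)"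
  unfolding weak_directional_derivative_def
proof (intro conjI ballI)
  show "locally_integrable \<Omega> (\<lambda>z. a * f z + b * g z)" "locally_integrable \<Omega> (\<lambda>z. a * f' z + b * g' z)"
    using 1 2 by (auto simp: weak_directional_derivative_def intro!: locally_integrable_linear)
  fix \<phi> assume phi: "\<phi> \<in> C1c \<Omega>"
  note i = weak_directional_derivative_test_integrable[OF 1 phi]
    weak_directional_derivative_test_integrable[OF 2 phi]
  let ?D = "\<lambda>z. frechet_derivative \<phi> (at z) v"
  have e: "(LINT z:\<Omega>|lborel. f z * ?D z) = - (LINT z:\<Omega>|lborel. f' z * \<phi> z)"
     "(LINT z:\<Omega>|lborel. g z * ?D z) = - (LINT z:\<Omega>|lborel. g' z * \<phi> z)"
    using 1 2 phi by (auto simp: weak_directional_derivative_def)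
  have "(LINT z:\<Omega>|lborel. (a * f z + b * g z) * ?D z)
      = (LINT z:\<Omega>|lborel. a * (f z * ?D z) + b * (g z * ?D z))"
    by (simp add: algebra_simps)
  also have "\<dots> = a * (LINT z:\<Omega>|lborel. f z * ?D z) + b * (LINT z:\<Omega>|lborel. g z * ?D z)"
    using i by (subst set_integral_add(2)) (auto intro!: set_integrable_mult_right)
  also have "\<dots> = - (a * (LINT z:\<Omega>|lborel. f' z * \<phi> z) + b * (LINT z:\<Omega>|lborel. g' z * \<phi> z))"
    unfolding e by simp
  also have "a * (LINT z:\<Omega>|lborel. f' z * \<phi> z) + b * (LINT z:\<Omega>|lborel. g' z * \<phi> z)
      = (LINT z:\<Omega>|lborel. a * (f' z * \<phi> z) + b * (g' z * \<phi> z))"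
    using i by (subst set_integral_add(2)) (auto intro!: set_integrable_mult_right)
  also have "\<dots> = (LINT z:\<Omega>|lborel. (a * f' z + b * g' z) * \<phi> z)"
    by (simp add: algebra_simps)
  finally show "(LINT z:\<Omega>|lborel. (a * f z + b * g z) * ?D z)
      = - (LINT z:\<Omega>|lborel. (a * f' z + b * g' z) * \<phi> z)" .
qed

lemma weak_directional_derivative_cong:
  assumes "weak_directional_derivative \<Omega> v f g"
    and "\<And>z. z \<in> \<Omega> \<Longrightarrow> f' z = f z" "\<And>z. z \<in> \<Omega> \<Longrightarrow> g' z = g z"
  shows "weak_directional_derivative \<Omega> v f' g'"
proof -
  have li: "locally_integrable \<Omega> h'" if "locally_integrable \<Omega> h" "\<And>z. z \<in> \<Omega> \<Longrightarrow> h' z = h z"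
    for h h' :: "'a \<Rightarrow> real"
    unfolding locally_integrable_def
  proof (intro allI impI)
    fix K assume K: "compact K \<and> K \<subseteq> \<Omega>"
    have "(\<lambda>z. indicator K z *\<^sub>R h' z) = (\<lambda>z. indicat_real K z *\<^sub>R h z)"
      using that(2) K by (auto simp: indicator_def fun_eq_iff)
    then show "set_integrable lborel K h'"
      using that(1) K by (simp add: set_integrable_def locally_integrable_def)
  qed
  have ic: "(LINT z:\<Omega>|lborel. h' z * k z) = (LINT z:\<Omega>|lborel. h z * k z)"
    if "\<And>z. z \<in> \<Omega> \<Longrightarrow> h' z = h z" for h h' k :: "'a \<Rightarrow> real"
    unfolding set_lebesgue_integral_def
    by (rule Bochner_Integration.integral_cong) (auto simp: indicator_def that)
  have "locally_integrable \<Omega> f'" "locally_integrable \<Omega> g'"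
    using assms(1) li[OF _ assms(2)] li[OF _ assms(3)]
    by (simp_all add: weak_directional_derivative_def)
  with assms(1) show ?thesis
    unfolding weak_directional_derivative_def
    by (simp add: ic[OF assms(2)] ic[OF assms(3)])
qed

text \<open>The difference of two weak derivatives is a weak derivative of \<open>0\<close>.\<close>

lemma weak_directional_derivative_unique:
  assumes "open \<Omega>" and 1: "weak_directional_derivative \<Omega> v f g"
    and 2: "weak_directional_derivative \<Omega> v f h"
  shows "AE z in lborel. z \<in> \<Omega> \<longrightarrow> g z = h z"
proof -
  have w: "weak_directional_derivative \<Omega> v (\<lambda>z. 0) (\<lambda>z. g z - h z)"
    using weak_directional_derivative_linear[OF 1 2, of 1 "-1"] by simp
  have "AE z in lborel. z \<in> \<Omega> \<longrightarrow> g z - h z = 0"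
  proof (rule fundamental_lemma_variations[OF assms(1)])
    show "locally_integrable \<Omega> (\<lambda>z. g z - h z)"
      using w by (simp add: weak_directional_derivative_def)
    show "(LINT z:\<Omega>|lborel. (g z - h z) * \<phi> z) = 0" if "\<phi> \<in> C1c \<Omega>" for \<phi>
    proof -
      have "(LINT z:\<Omega>|lborel. 0 * frechet_derivative \<phi> (at z) v) =
          - (LINT z:\<Omega>|lborel. (g z - h z) * \<phi> z)"
        using w that unfolding weak_directional_derivative_def by blast
      then show ?thesis by (simp add: set_lebesgue_integral_def)
    qed
  qed
  then show ?thesis by simp
qed

section \<open>Polar coordinates on the cone\<close>

locale spherical_curve =
  fixes \<gamma> :: "real \<Rightarrow> real^3"
  assumes curve: "smooth_simple_closed_curve \<gamma>" and sphere: "range \<gamma> \<subseteq> sphere 0 1"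
begin

definition \<gamma>' :: "real \<Rightarrow> real^3" where "\<gamma>' t = vector_derivative \<gamma> (at t)"
definition speed :: "real \<Rightarrow> real" where "speed t = norm (\<gamma>' t)"
definition C :: "(real^3) set" where "C = cone hull (range \<gamma>)"
abbreviation A :: "(real^3) set" where "A \<equiv> cone_ball \<gamma>"
abbreviation cm :: "real \<times> real \<Rightarrow> real^3" where "cm \<equiv> cone_map \<gamma>"
abbreviation \<Omega> :: "(real \<times> real) set" where "\<Omega> \<equiv> {0<..<1} \<times> UNIV"

lemma Ck1: "Ck 1 \<gamma>" and speed_pos: "speed t > 0" and per1: "\<gamma> (t + 1) = \<gamma> t"
  and inj: "inj_on \<gamma> {0..<1}"
  using curve unfolding smooth_simple_closed_curve_def speed_def \<gamma>'_def by auto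

lemma norm_\<gamma> [simp]: "norm (\<gamma> t) = 1" using sphere by (auto simp: image_subset_iff)
lemma inner_\<gamma> [simp]: "\<gamma> t \<bullet> \<gamma> t = 1" by (simp add: dot_square_norm)

lemma \<gamma>_vector_derivative: "(\<gamma> has_vector_derivative \<gamma>' t) (at t)"
  using Ck1 unfolding \<gamma>'_def Ck_1_iff
  by (metis vector_derivative_works differentiable_def has_derivative_linear
      differentiableI_vector vector_derivative_works differentiable_def)

lemma \<gamma>_continuous: "continuous_on S \<gamma>"
  using Ck_1_continuous[OF Ck1] continuous_on_subset by blast

lemma \<gamma>'_continuous: "continuous_on S \<gamma>'"
proof -
  have "\<gamma>' t = frechet_derivative \<gamma> (at t) 1" for t
    using frechet_derivative_at[OF \<gamma>_vector_derivative[of t, unfolded has_vector_derivative_def]]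
    by (metis scaleR_one)
  then have "continuous_on UNIV \<gamma>'"
    using Ck1 unfolding Ck_1_iff by (metis (no_types, lifting) ext)
  then show ?thesis using continuous_on_subset by blast
qed

lemma speed_continuous: "continuous_on S speed"
  unfolding speed_def[abs_def] by (intro continuous_intros \<gamma>'_continuous)

lemma per: "\<gamma> (t + of_int n) = \<gamma> t"
proof -
  have nat: "\<gamma> (t + real m) = \<gamma> t" for t m
  proof (induction m)
    case (Suc m)
    have "\<gamma> (t + real (Suc m)) = \<gamma> ((t + real m) + 1)" by (simp add: add_ac)
    then show ?case using Suc per1 by metis
  qed simp
  show ?thesis
  proof (cases "n \<ge> 0")
    case True
    then show ?thesis using nat[of t "nat n"] by simp
  next
    case False
    then show ?thesis using nat[of "t + of_int n" "nat (- n)"] by simp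
  qed
qed

lemma per_frac: "\<gamma> (frac t) = \<gamma> t"
  using per[of t "- \<lfloor>t\<rfloor>"] by (simp add: frac_def)

lemma per': "\<gamma>' (t + of_int n) = \<gamma>' t"
proof -
  have "(\<gamma> has_vector_derivative \<gamma>' (t + of_int n)) (at (t + of_int n))"
    by (rule \<gamma>_vector_derivative)
  then have "((\<gamma> \<circ> (\<lambda>t. t + of_int n)) has_vector_derivative (1 *\<^sub>R \<gamma>' (t + of_int n))) (at t)"
    by (intro vector_diff_chain_at) (auto intro!: derivative_eq_intros)
  then have "(\<gamma> has_vector_derivative \<gamma>' (t + of_int n)) (at t)"
    by (simp add: o_def per)
  then show ?thesis using \<gamma>_vector_derivative vector_derivative_unique_at by blast
qed

lemma per'_frac: "\<gamma>' (frac t) = \<gamma>' t"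
  using per'[of t "- \<lfloor>t\<rfloor>"] by (simp add: frac_def)

lemma speed_frac: "speed (frac t) = speed t" by (simp add: speed_def per'_frac)

lemma \<gamma>_eq_iff: "\<gamma> t = \<gamma> t' \<longleftrightarrow> frac t = frac t'"
proof
  assume "\<gamma> t = \<gamma> t'"
  then have "\<gamma> (frac t) = \<gamma> (frac t')" by (simp add: per_frac)
  then show "frac t = frac t'" by (rule inj_onD[OF inj]) (auto simp: frac_lt_1)
qed (metis per_frac)

lemma \<gamma>_orth [simp]: "\<gamma> t \<bullet> \<gamma>' t = 0" "\<gamma>' t \<bullet> \<gamma> t = 0"
proof -
  have "((\<lambda>t. \<gamma> t \<bullet> \<gamma> t) has_derivative (\<lambda>h. \<gamma> t \<bullet> (h *\<^sub>R \<gamma>' t) + (h *\<^sub>R \<gamma>' t) \<bullet> \<gamma> t)) (at t)"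
    using \<gamma>_vector_derivative[of t] unfolding has_vector_derivative_def
    by (intro has_derivative_inner)
  moreover have "((\<lambda>t. \<gamma> t \<bullet> \<gamma> t) has_derivative (\<lambda>h. 0)) (at t)" by simp
  ultimately have "(\<lambda>h. \<gamma> t \<bullet> (h *\<^sub>R \<gamma>' t) + (h *\<^sub>R \<gamma>' t) \<bullet> \<gamma> t) = (\<lambda>h. 0)"
    by (rule has_derivative_unique)
  from fun_cong[OF this, of 1] show "\<gamma> t \<bullet> \<gamma>' t = 0" "\<gamma>' t \<bullet> \<gamma> t = 0"
    by (auto simp: inner_commute)
qed

lemma inner_\<gamma>' [simp]: "\<gamma>' t \<bullet> \<gamma>' t = (speed t)\<^sup>2"
  by (simp add: speed_def dot_square_norm)

lemma cm_simp [simp]: "cm (r, t) = r *\<^sub>R \<gamma> t" by (simp add: cone_map_def)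

lemma cm_continuous: "continuous_on S cm"
  unfolding cone_map_def case_prod_beta
  by (intro continuous_intros continuous_on_compose2[OF \<gamma>_continuous[of UNIV]]) auto

lemma cm_derivative: "frechet_derivative cm (at (r, t)) v = fst v *\<^sub>R \<gamma> t + (r * snd v) *\<^sub>R \<gamma>' t"
proof -
  have g: "(\<gamma> has_derivative (\<lambda>h. h *\<^sub>R \<gamma>' t)) (at t)"
    using \<gamma>_vector_derivative[of t] by (simp add: has_vector_derivative_def)
  have snd: "(snd has_derivative snd) (at (r, t))" and fst: "(fst has_derivative fst) (at (r, t))"
    by (auto intro!: bounded_linear_imp_has_derivative bounded_linear_fst bounded_linear_snd)
  have "((\<lambda>z. \<gamma> (snd z)) has_derivative (\<lambda>v. snd v *\<^sub>R \<gamma>' t)) (at (r, t))"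
    using has_derivative_compose[OF snd, of \<gamma> "\<lambda>h. h *\<^sub>R \<gamma>' t"] g by simp
  from has_derivative_scaleR[OF fst this]
  have "(cm has_derivative (\<lambda>v. r *\<^sub>R (snd v *\<^sub>R \<gamma>' t) + fst v *\<^sub>R \<gamma> t)) (at (r, t))"
    unfolding cone_map_def case_prod_beta by simp
  then have "frechet_derivative cm (at (r, t)) = (\<lambda>v. r *\<^sub>R (snd v *\<^sub>R \<gamma>' t) + fst v *\<^sub>R \<gamma> t)"
    by (rule frechet_derivative_at[symmetric])
  then show ?thesis by (simp add: add.commute)
qed

lemma C_iff: "x \<in> C \<longleftrightarrow> (\<exists>r\<ge>0. \<exists>t. x = r *\<^sub>R \<gamma> t)"
proof
  assume "x \<in> C"
  then obtain c y where "x = c *\<^sub>R y" "c \<ge> 0" "y \<in> range \<gamma>"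
    unfolding C_def cone_hull_expl mem_Collect_eq by iprover
  then show "\<exists>r\<ge>0. \<exists>t. x = r *\<^sub>R \<gamma> t" by auto
next
  assume "\<exists>r\<ge>0. \<exists>t. x = r *\<^sub>R \<gamma> t"
  then obtain r t where "x = r *\<^sub>R \<gamma> t" "r \<ge> 0" by iprover
  then show "x \<in> C" unfolding C_def by (simp add: mem_cone_hull hull_inc)
qed

lemma C_iff_frac: "x \<in> C \<longleftrightarrow> (\<exists>r\<ge>0. \<exists>t\<in>{0..<1}. x = r *\<^sub>R \<gamma> t)"
proof -
  have "\<exists>t'\<in>{0..<1}. r *\<^sub>R \<gamma> t = r *\<^sub>R \<gamma> t'" for r t
    by (rule bexI[of _ "frac t"]) (auto simp: per_frac frac_lt_1)
  then show ?thesis unfolding C_iff by metis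
qed

lemma A_eq: "A = C \<inter> ball 0 1" by (simp add: cone_ball_def C_def)

lemma cm_in_A_iff: "r \<ge> 0 \<Longrightarrow> r *\<^sub>R \<gamma> t \<in> A \<longleftrightarrow> r < 1"
  unfolding A_eq using C_iff by auto

lemma zero_in_A: "0 \<in> A" using cm_in_A_iff[of 0 0] by simp

lemma ray_eq_iff: "r > 0 \<Longrightarrow> r' \<ge> 0 \<Longrightarrow> r *\<^sub>R \<gamma> t = r' *\<^sub>R \<gamma> t' \<longleftrightarrow> r = r' \<and> frac t = frac t'"
proof
  assume r: "r > 0" "r' \<ge> 0" and e: "r *\<^sub>R \<gamma> t = r' *\<^sub>R \<gamma> t'"
  have "norm (r *\<^sub>R \<gamma> t) = norm (r' *\<^sub>R \<gamma> t')" by (simp add: e)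
  then have "r = r'" using r by simp
  then show "r = r' \<and> frac t = frac t'" using e r by (simp add: \<gamma>_eq_iff)
next
  assume "r = r' \<and> frac t = frac t'"
  then show "r *\<^sub>R \<gamma> t = r' *\<^sub>R \<gamma> t'" using \<gamma>_eq_iff by metis
qed

text \<open>The angular coordinate of a point of the punctured cone, inverse to the parametrisation. The
constant value off the punctured cone keeps it Borel.\<close>

definition \<tau> :: "real^3 \<Rightarrow> real" where
  "\<tau> x = (if x \<in> C - {0} then THE t. t \<in> {0..<1} \<and> x = norm x *\<^sub>R \<gamma> t else 0)"

lemma \<tau>_cm: assumes "r > 0" shows "\<tau> (r *\<^sub>R \<gamma> t) = frac t"
proof -
  have "(THE t'. t' \<in> {0..<1} \<and> r *\<^sub>R \<gamma> t = norm (r *\<^sub>R \<gamma> t) *\<^sub>R \<gamma> t') = frac t"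
  proof (rule the_equality)
    show "frac t \<in> {0..<1} \<and> r *\<^sub>R \<gamma> t = norm (r *\<^sub>R \<gamma> t) *\<^sub>R \<gamma> (frac t)"
      using assms by (simp add: per_frac frac_lt_1)
  next
    fix t' assume "t' \<in> {0..<1} \<and> r *\<^sub>R \<gamma> t = norm (r *\<^sub>R \<gamma> t) *\<^sub>R \<gamma> t'"
    then show "t' = frac t" using assms by (simp add: \<gamma>_eq_iff frac_eq)
  qed
  moreover have "r *\<^sub>R \<gamma> t \<in> C - {0}" 
  proof -
    have "r *\<^sub>R \<gamma> t \<in> C" unfolding C_iff using assms less_imp_le by blast
    moreover have "r *\<^sub>R \<gamma> t \<noteq> 0" using assms norm_\<gamma>[of t] by (metis norm_eq_zero norm_scaleR scaleR_eq_0_iff zero_neq_one less_irrefl)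
    ultimately show ?thesis by simp
  qed
  ultimately show ?thesis unfolding \<tau>_def by (simp only: if_True)
qed

lemma compact_sector: "compact (cm ` ({0..R} \<times> {a..b}))"
  by (intro compact_continuous_image cm_continuous compact_Times compact_Icc)

lemma sector_borel: "{r *\<^sub>R \<gamma> t | r t. r \<ge> 0 \<and> t \<in> {a..b}} \<in> sets borel"
proof -
  have "{r *\<^sub>R \<gamma> t | r t. r \<ge> 0 \<and> t \<in> {a..b}} = (\<Union>n::nat. cm ` ({0..real n} \<times> {a..b}))"
  proof (rule set_eqI, rule iffI)
    fix x assume "x \<in> {r *\<^sub>R \<gamma> t | r t. r \<ge> 0 \<and> t \<in> {a..b}}"
    then obtain r t where rt: "x = r *\<^sub>R \<gamma> t" "r \<ge> 0" "t \<in> {a..b}" by auto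
    obtain n where "r \<le> real n" using real_arch_simple by blast
    with rt have "x = cm (r, t)" "(r, t) \<in> {0..real n} \<times> {a..b}" by auto
    then show "x \<in> (\<Union>n::nat. cm ` ({0..real n} \<times> {a..b}))" by blast
  next
    fix x assume "x \<in> (\<Union>n::nat. cm ` ({0..real n} \<times> {a..b}))"
    then show "x \<in> {r *\<^sub>R \<gamma> t | r t. r \<ge> 0 \<and> t \<in> {a..b}}" by fastforce
  qed
  also have "\<dots> \<in> sets borel"
    by (rule sets.countable_UN) (blast intro: borel_compact compact_sector)
  finally show ?thesis .
qed

lemma C_borel: "C \<in> sets borel"
proof -
  have "C = {r *\<^sub>R \<gamma> t | r t. r \<ge> 0 \<and> t \<in> {0..1}}"
  proof (intro set_eqI iffI)
    fix x assume "x \<in> C"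
    then obtain r t where "x = r *\<^sub>R \<gamma> t" "r \<ge> 0" "t \<in> {0..<1}" unfolding C_iff_frac by blast
    then show "x \<in> {r *\<^sub>R \<gamma> t | r t. r \<ge> 0 \<and> t \<in> {0..1}}" by fastforce
  next
    fix x assume "x \<in> {r *\<^sub>R \<gamma> t | r t. r \<ge> 0 \<and> t \<in> {0..1}}"
    then show "x \<in> C" unfolding C_iff by blast
  qed
  then show ?thesis using sector_borel[of 0 1] by simp
qed

lemma A_borel: "A \<in> sets borel"
  unfolding A_eq using C_borel by auto

text \<open>The sublevel sets of \<open>\<tau>\<close> are cones over compact arcs, hence countable unions of compact sets;
the discontinuity of \<open>\<tau>\<close> at the seam does no harm.\<close>

lemma \<tau>_borel: "\<tau> \<in> borel_measurable borel"
proof (rule borel_measurableI_le)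
  fix a :: real
  have C0: "- (C - {0}) \<in> sets borel" using C_borel by auto
  have \<tau>_range: "0 \<le> \<tau> x \<and> \<tau> x < 1 \<and> (x \<in> C - {0} \<longrightarrow> x = norm x *\<^sub>R \<gamma> (\<tau> x))" for x
  proof (cases "x \<in> C - {0}")
    case True
    then have "x \<in> C" and "x \<noteq> 0" by auto
    then obtain r t where rt: "x = r *\<^sub>R \<gamma> t" "r \<ge> 0" "x \<noteq> 0"
      unfolding C_iff by blast
    then have "r > 0" by (cases "r = 0") auto
    with rt show ?thesis using \<tau>_cm by (simp add: frac_lt_1 per_frac)
  next
    case False then show ?thesis unfolding \<tau>_def by (simp only: if_False) simp
  qed
  consider "a < 0" | "0 \<le> a" "a < 1" | "1 \<le> a" by linarith
  then show "{x \<in> space borel. \<tau> x \<le> a} \<in> sets borel"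
  proof cases
    case 1
    then have "{x \<in> space borel. \<tau> x \<le> a} = {}" using \<tau>_range by (auto simp: not_le) (smt (verit))
    then show ?thesis by (simp only: sets.empty_sets)
  next
    case 3
    then have "{x \<in> space borel. \<tau> x \<le> a} = UNIV" using \<tau>_range by (auto) (smt (verit))
    then show ?thesis by simp
  next
    case 2
    have "{x \<in> space borel. \<tau> x \<le> a} = - (C - {0}) \<union> {r *\<^sub>R \<gamma> t | r t. r \<ge> 0 \<and> t \<in> {0..a}}"
    proof (intro set_eqI iffI)
      fix x assume x: "x \<in> {x \<in> space borel. \<tau> x \<le> a}"
      show "x \<in> - (C - {0}) \<union> {r *\<^sub>R \<gamma> t | r t. r \<ge> 0 \<and> t \<in> {0..a}}"
        using \<tau>_range[of x] x norm_ge_zero[of x] by fastforce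
    next
      fix x assume x: "x \<in> - (C - {0}) \<union> {r *\<^sub>R \<gamma> t | r t. r \<ge> 0 \<and> t \<in> {0..a}}"
      show "x \<in> {x \<in> space borel. \<tau> x \<le> a}"
      proof (cases "x \<in> C - {0}")
        case False
        then have "\<tau> x = 0" unfolding \<tau>_def by (simp only: if_False)
        then show ?thesis using 2 by simp
      next
        case True
        with x obtain r t where "x = r *\<^sub>R \<gamma> t" "r \<ge> 0" "t \<in> {0..a}" by auto
        moreover with True have "r > 0" by (cases "r = 0") auto
        ultimately show ?thesis using \<tau>_cm 2 by (simp add: frac_eq)
      qed
    qed
    then show ?thesis using C0 sector_borel[of 0 a] by (auto simp only: sets.Un)
  qed
qed

lemma weak_tangential_gradient_linear:
  assumes 1: "weak_tangential_gradient \<gamma> u G" and 2: "weak_tangential_gradient \<gamma> w H"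
  shows "weak_tangential_gradient \<gamma> (\<lambda>x. a * u x + b * w x) (\<lambda>x. a *\<^sub>R G x + b *\<^sub>R H x)"
  unfolding weak_tangential_gradient_def
proof (intro conjI ballI allI)
  have "(\<lambda>x. a *\<^sub>R (indicat_real A x *\<^sub>R G x) + b *\<^sub>R (indicat_real A x *\<^sub>R H x)) \<in> borel_measurable borel"
    using 1 2 unfolding weak_tangential_gradient_def set_borel_measurable_def
    by (auto intro!: borel_measurable_add borel_measurable_scaleR[OF borel_measurable_const] simp del: scaleR_scaleR)
  then show "set_borel_measurable borel A (\<lambda>x. a *\<^sub>R G x + b *\<^sub>R H x)"
    unfolding set_borel_measurable_def by (simp add: algebra_simps)
  fix v
  show "weak_directional_derivative \<Omega> v (\<lambda>z. a * u (cm z) + b * w (cm z))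
      (\<lambda>z. (a *\<^sub>R G (cm z) + b *\<^sub>R H (cm z)) \<bullet> frechet_derivative cm (at z) v)"
    using weak_directional_derivative_linear[of \<Omega> v _ _ _ _ a b] 1 2
    unfolding weak_tangential_gradient_def inner_add_left inner_scaleR_left by blast
next
  fix z :: "real \<times> real" assume z: "z \<in> \<Omega>"
  obtain r t where rt: "z = (r, t)" by (cases z)
  have "G (cm z) \<in> range (frechet_derivative cm (at z))" "H (cm z) \<in> range (frechet_derivative cm (at z))"
    using 1 2 z unfolding weak_tangential_gradient_def by blast+
  then obtain v v' where v: "G (cm z) = frechet_derivative cm (at z) v" "H (cm z) = frechet_derivative cm (at z) v'"
    by blast
  have "a *\<^sub>R G (cm z) + b *\<^sub>R H (cm z) = frechet_derivative cm (at z) (a *\<^sub>R v + b *\<^sub>R v')"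
    unfolding v unfolding rt cm_derivative by (simp add: algebra_simps)
  then show "a *\<^sub>R G (cm z) + b *\<^sub>R H (cm z) \<in> range (frechet_derivative cm (at z))" by blast
qed

definition Q :: "(real \<times> real) set" where "Q = {0<..<1} \<times> {0..<1}"

text \<open>The area of the truncated cone in polar coordinates. Restricting the space to \<open>Q\<close>, and not only
the density, lets functions that are measurable on the cone alone be pulled back directly.\<close>

definition \<mu> :: "(real \<times> real) measure" where
  "\<mu> = density (restrict_space lborel Q) (\<lambda>z. ennreal (fst z * speed (snd z)))"

lemma Q_borel [measurable]: "Q \<in> sets borel" by (auto simp: Q_def borel_prod[symmetric])

lemma Q_bounded: "bounded Q" by (auto simp: Q_def bounded_Times)

lemma space_\<mu>: "space \<mu> = Q" by (simp add: \<mu>_def space_restrict_space)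

lemma weight_lbb: "locally_bounded_borel (\<lambda>z::real \<times> real. fst z * speed (snd z))"
  by (intro lbb_continuous continuous_intros continuous_on_compose2[OF speed_continuous[of UNIV]]) auto

lemma weight_borel: "(\<lambda>z::real \<times> real. fst z * speed (snd z)) \<in> borel_measurable borel"
  using weight_lbb by (simp add: locally_bounded_borel_def)

lemma weight_pos: "z \<in> Q \<Longrightarrow> fst z * speed (snd z) > 0"
  using speed_pos by (auto simp: Q_def)

lemma \<mu>_measurable_iff:
  fixes f :: "real \<times> real \<Rightarrow> 'b::euclidean_space"
  shows "f \<in> borel_measurable \<mu> \<longleftrightarrow> (\<lambda>z. indicator Q z *\<^sub>R f z) \<in> borel_measurable borel"
  unfolding \<mu>_def using borel_measurable_restrict_space_iff[of Q lborel f] by simp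

lemma borel_measurable_\<mu>:
  fixes f :: "real \<times> real \<Rightarrow> 'b::euclidean_space"
  shows "f \<in> borel_measurable borel \<Longrightarrow> f \<in> borel_measurable \<mu>"
  unfolding \<mu>_measurable_iff by measurable

lemma weight_AE: "AE z in restrict_space lborel Q. 0 \<le> fst z * speed (snd z)"
  by (subst AE_restrict_space_iff) (auto intro!: AE_I2 less_imp_le[OF weight_pos])

lemma \<mu>_integrable_iff:
  fixes f :: "real \<times> real \<Rightarrow> 'b::euclidean_space"
  assumes f: "f \<in> borel_measurable \<mu>"
  shows "integrable \<mu> f \<longleftrightarrow> set_integrable lborel Q (\<lambda>z. (fst z * speed (snd z)) *\<^sub>R f z)"
proof -
  have f': "f \<in> borel_measurable (restrict_space lborel Q)" using f by (simp add: \<mu>_def)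
  have w: "(\<lambda>z. fst z * speed (snd z)) \<in> borel_measurable (restrict_space lborel Q)"
    using weight_borel by (intro measurable_restrict_space1) simp
  show ?thesis
    unfolding \<mu>_def integrable_density[OF f' w weight_AE] set_integrable_def
    by (subst integrable_restrict_space) auto
qed

lemma \<mu>_integral:
  fixes f :: "real \<times> real \<Rightarrow> 'b::euclidean_space"
  assumes f: "f \<in> borel_measurable \<mu>"
  shows "integral\<^sup>L \<mu> f = (LINT z:Q|lborel. (fst z * speed (snd z)) *\<^sub>R f z)"
proof -
  have f': "f \<in> borel_measurable (restrict_space lborel Q)" using f by (simp add: \<mu>_def)
  have w: "(\<lambda>z. fst z * speed (snd z)) \<in> borel_measurable (restrict_space lborel Q)"
    using weight_borel by (intro measurable_restrict_space1) simp
  show ?thesis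
    unfolding \<mu>_def integral_density[OF f' w weight_AE] set_lebesgue_integral_def
    by (subst integral_restrict_space) auto
qed

lemma finite_\<mu>: "finite_measure \<mu>"
proof -
  have "integrable \<mu> (\<lambda>_. 1::real)"
    using lbb_set_integrable[OF weight_lbb Q_bounded Q_borel]
    by (subst \<mu>_integrable_iff) auto
  then have "(\<integral>\<^sup>+ z. ennreal (norm (1::real)) \<partial>\<mu>) < \<infinity>" by (simp only: integrable_iff_bounded)
  then show ?thesis by (intro finite_measureI) auto
qed

lemma \<mu>_AE:
  assumes "AE z in lborel. z \<in> \<Omega> \<longrightarrow> P z"
  shows "AE z in \<mu>. P z"
proof -
  have w: "(\<lambda>z. ennreal (fst z * speed (snd z))) \<in> borel_measurable (restrict_space lborel Q)"
    using weight_borel by (intro measurable_restrict_space1) simp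
  have "AE z in restrict_space lborel Q. P z"
    by (subst AE_restrict_space_iff, simp) (rule eventually_mono[OF assms], auto simp: Q_def)
  then show ?thesis unfolding \<mu>_def AE_density[OF w] by auto
qed

lemma cm_Q_in_A: "z \<in> Q \<Longrightarrow> cm z \<in> A"
  using cm_in_A_iff by (auto simp: Q_def)

lemma cm_borel: "cm \<in> borel_measurable borel"
  by (rule borel_measurable_continuous_onI[OF cm_continuous])

lemma pullback_measurable:
  fixes f :: "real^3 \<Rightarrow> 'b::euclidean_space"
  assumes "set_borel_measurable borel A f"
  shows "(\<lambda>z. f (cm z)) \<in> borel_measurable \<mu>"
proof -
  have "(\<lambda>z. indicator Q z *\<^sub>R (indicat_real A (cm z) *\<^sub>R f (cm z))) \<in> borel_measurable borel"
    using measurable_compose[OF cm_borel assms[unfolded set_borel_measurable_def]] by measurable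
  also have "(\<lambda>z. indicator Q z *\<^sub>R (indicat_real A (cm z) *\<^sub>R f (cm z))) = (\<lambda>z. indicator Q z *\<^sub>R f (cm z))"
    using cm_Q_in_A by (auto simp: fun_eq_iff indicator_def)
  finally show ?thesis by (simp add: \<mu>_measurable_iff)
qed

lemma cone_area_transfer:
  fixes f :: "real^3 \<Rightarrow> 'b::euclidean_space"
  assumes f: "set_borel_measurable borel A f"
  shows "set_integrable (cone_area \<gamma>) A f \<longleftrightarrow> integrable \<mu> (\<lambda>z. f (cm z))"
    and "(LINT x:A|cone_area \<gamma>. f x) = (LINT z|\<mu>. f (cm z))"
proof -
  define k where "k = (\<lambda>(r, t). indicat_real ({0<..} \<times> {0..<1}) (r, t) * (r * norm (vector_derivative \<gamma> (at t))))"
  have area: "cone_area \<gamma> = distr (density lborel (\<lambda>z. ennreal (k z))) borel cm"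
    unfolding cone_area_def k_def by (rule arg_cong[where f="\<lambda>f. distr (density lborel f) borel cm"]) auto
  have k_eq: "k = (\<lambda>z. indicator ({0<..} \<times> {0..<1}) z * (fst z * speed (snd z)))"
    by (auto simp: k_def speed_def \<gamma>'_def)
  have P: "{0<..} \<times> {0..<1} \<in> sets (borel :: (real \<times> real) measure)"
    by (auto simp: borel_prod[symmetric])
  have k: "k \<in> borel_measurable lborel" using weight_borel P unfolding k_eq by simp
  have k0: "AE z in lborel. 0 \<le> k z"
    unfolding k_eq using speed_pos by (auto intro!: AE_I2 simp: indicator_def less_imp_le)
  have cmm: "cm \<in> measurable (density lborel (\<lambda>z. ennreal (k z))) borel" using cm_borel by simp
  have h: "(\<lambda>x. indicat_real A x *\<^sub>R f x) \<in> borel_measurable borel"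
    using f by (simp add: set_borel_measurable_def)
  have h2: "(\<lambda>z. indicat_real A (cm z) *\<^sub>R f (cm z)) \<in> borel_measurable lborel"
    using measurable_compose[OF cm_borel h] by simp
  have eq: "(\<lambda>z. k z *\<^sub>R (indicat_real A (cm z) *\<^sub>R f (cm z))) =
      (\<lambda>z. indicator Q z *\<^sub>R ((fst z * speed (snd z)) *\<^sub>R f (cm z)))"
  proof
    fix z :: "real \<times> real"
    obtain r t where z: "z = (r, t)" by (cases z)
    show "k z *\<^sub>R (indicat_real A (cm z) *\<^sub>R f (cm z)) =
      indicator Q z *\<^sub>R ((fst z * speed (snd z)) *\<^sub>R f (cm z))"
      unfolding k_eq z using cm_in_A_iff[of r t] by (auto simp: indicator_def Q_def)
  qed
  note f' = pullback_measurable[OF f]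
  show "set_integrable (cone_area \<gamma>) A f \<longleftrightarrow> integrable \<mu> (\<lambda>z. f (cm z))"
    unfolding set_integrable_def area integrable_distr_eq[OF cmm h]
      integrable_density[OF h2 k k0] eq \<mu>_integrable_iff[OF f', unfolded set_integrable_def] ..
  show "(LINT x:A|cone_area \<gamma>. f x) = (LINT z|\<mu>. f (cm z))"
    unfolding set_lebesgue_integral_def area integral_distr[OF cmm h]
      integral_density[OF h2 k k0] eq \<mu>_integral[OF f', unfolded set_lebesgue_integral_def] ..
qed

text \<open>The derivatives in the directions \<open>(1, 0)\<close> and \<open>(0, 1)\<close> are almost everywhere determined. They
are the components along the orthogonal vectors \<open>\<gamma>\<close> and \<open>r \<gamma>'\<close>, which span the tangent plane.\<close>

lemma weak_tangential_gradient_unique: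
  assumes 1: "weak_tangential_gradient \<gamma> u G" and 2: "weak_tangential_gradient \<gamma> u H"
  shows "AE z in \<mu>. G (cm z) = H (cm z)"
proof (rule \<mu>_AE)
  have op: "open \<Omega>" by (intro open_Times) auto
  have ae: "AE z in lborel. z \<in> \<Omega> \<longrightarrow> G (cm z) \<bullet> frechet_derivative cm (at z) v =
      H (cm z) \<bullet> frechet_derivative cm (at z) v" for v
    using 1 2 unfolding weak_tangential_gradient_def
    by (intro weak_directional_derivative_unique[OF op]) blast+
  from ae[of "(1, 0)"] ae[of "(0, 1)"]
  show "AE z in lborel. z \<in> \<Omega> \<longrightarrow> G (cm z) = H (cm z)"
  proof eventually_elim
    case (elim z)
    show ?case
    proof
      assume z: "z \<in> \<Omega>"
      obtain r t where rt: "z = (r, t)" by (cases z)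
      have r: "r > 0" using z rt by auto
      have "G (cm z) \<in> range (frechet_derivative cm (at z))" "H (cm z) \<in> range (frechet_derivative cm (at z))"
        using 1 2 z unfolding weak_tangential_gradient_def by blast+
      then obtain a b a' b' where e: "G (cm z) = a *\<^sub>R \<gamma> t + b *\<^sub>R \<gamma>' t" "H (cm z) = a' *\<^sub>R \<gamma> t + b' *\<^sub>R \<gamma>' t"
        unfolding rt cm_derivative image_iff by metis
      have "a = a'" "b = b'"
        using elim z r speed_pos[of t] unfolding e unfolding rt cm_derivative
        by (auto simp: inner_add_left)
      then show "G (cm z) = H (cm z)" unfolding e by simp
    qed
  qed
qed

end

section \<open>The two-phase profile\<close>

lemma DERIV_periodic:
  fixes f :: "real \<Rightarrow> real"
  assumes "\<And>t. f t = f (frac t)" and "frac t \<noteq> 0"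
    and "(f has_real_derivative D) (at (frac t))"
  shows "(f has_real_derivative D) (at t)"
proof -
  have t: "t = frac t + of_int \<lfloor>t\<rfloor>" by (simp add: frac_def)
  have "f (x - of_int n) = f x" for x n
  proof -
    have "frac (x - of_int n) = frac x" by (simp add: frac_def)
    then show ?thesis using assms(1)[of x] assms(1)[of "x - of_int n"] by simp
  qed
  from this[of _ "\<lfloor>t\<rfloor>"] have eq: "f = (\<lambda>x. f (x + (- of_int \<lfloor>t\<rfloor>)))" by (simp add: fun_eq_iff)
  have "((\<lambda>x. f (x + (- of_int \<lfloor>t\<rfloor>))) has_real_derivative D) (at t)"
    by (subst DERIV_shift[symmetric]) (use assms(3) in \<open>simp add: frac_def\<close>)
  then show ?thesis by (subst eq)
qed

lemma cos_zeros_upto_4pi: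
  assumes "0 \<le> x" "x \<le> 4 * pi" "cos x = 0"
  shows "x \<in> {pi / 2, 3 * pi / 2, 5 * pi / 2, 7 * pi / 2}"
proof -
  obtain i :: int where i: "odd i" "x = of_int i * (pi / 2)"
    using assms(3) cos_zero_iff_int by auto
  have "of_int i * pi \<ge> 0" using i(2) assms(1) by simp
  then have "i \<ge> 0" using pi_gt_zero by (simp add: zero_le_mult_iff)
  have "of_int i * pi \<le> 8 * pi" using i(2) assms(2) by linarith
  then have "of_int i \<le> (8::real)" using pi_gt_zero by (simp only: mult_le_cancel_right_pos)
  then have "i \<le> 8" by simp
  have "i \<in> {0..8}" using \<open>i \<ge> 0\<close> \<open>i \<le> 8\<close> by simp
  then have "i = 0 \<or> i = 1 \<or> i = 2 \<or> i = 3 \<or> i = 4 \<or> i = 5 \<or> i = 6 \<or> i = 7 \<or> i = 8" by auto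
  then have "i = 1 \<or> i = 3 \<or> i = 5 \<or> i = 7" using i(1) by (elim disjE) simp_all
  then show ?thesis using i(2) by auto
qed

text \<open>The length enters twice: both sectors must fit on the cone, and \<open>\<beta>\<close> must vanish on both sides of
the seam.\<close>

locale long_spherical_curve = spherical_curve +
  assumes long: "curve_length \<gamma> \<ge> 4 * pi"
begin

definition \<theta> :: "real \<Rightarrow> real" where "\<theta> t = integral {0..t} speed"

lemma \<theta>_0: "\<theta> 0 = 0" by (simp add: \<theta>_def)

lemma \<theta>_1: "\<theta> 1 \<ge> 4 * pi"
  using long by (simp add: \<theta>_def curve_length_def speed_def[abs_def] \<gamma>'_def[abs_def])

lemma \<theta>_deriv: assumes "0 < t" shows "(\<theta> has_real_derivative speed t) (at t)"
proof -
  have "(\<theta> has_real_derivative speed t) (at t within {0..t + 1})"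
    unfolding \<theta>_def[abs_def] using assms
    by (intro integral_has_real_derivative speed_continuous) auto
  then show ?thesis using assms by (simp add: at_within_Icc_at)
qed

lemma \<theta>_continuous: "continuous_on {0..1} \<theta>"
  unfolding \<theta>_def[abs_def]
  by (intro indefinite_integral_continuous_1 integrable_continuous_real speed_continuous)

lemma \<theta>_less: assumes "0 \<le> t" "t < t'" "t' \<le> 1" shows "\<theta> t < \<theta> t'"
proof (rule DERIV_pos_imp_increasing_open[OF assms(2)])
  show "\<exists>y. (\<theta> has_real_derivative y) (at x) \<and> 0 < y" if "t < x" "x < t'" for x
    using \<theta>_deriv[of x] speed_pos[of x] that assms(1) by auto
  show "continuous_on {t..t'} \<theta>"
    using assms by (intro continuous_on_subset[OF \<theta>_continuous]) auto
qed

lemma \<theta>_inj: "inj_on \<theta> {0..1}"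
  by (rule linorder_inj_onI) (use \<theta>_less in force)+

lemma \<theta>_nonneg: "0 \<le> t \<Longrightarrow> t \<le> 1 \<Longrightarrow> 0 \<le> \<theta> t"
  using \<theta>_less[of 0 t] \<theta>_0 by (cases "t = 0") auto

lemma \<theta>_attains: assumes "0 \<le> y" "y \<le> 4 * pi" obtains t where "t \<in> {0..1}" "\<theta> t = y"
  using IVT'[of \<theta> 0 y 1] \<theta>_continuous \<theta>_0 \<theta>_1 assms by auto

text \<open>The radial and angular components of the calibration. Freezing the angle at \<open>4\<pi>\<close> turns the field
into \<open>- \<partial>\<^sub>r\<close> on the remaining part of the cone and makes both components continuous across the
seam, where they equal \<open>- 1\<close> and \<open>0\<close>.\<close>

definition \<alpha> :: "real \<Rightarrow> real" where "\<alpha> t = - cos (min (\<theta> (frac t)) (4 * pi))"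
definition \<beta> :: "real \<Rightarrow> real" where "\<beta> t = sin (min (\<theta> (frac t)) (4 * pi))"
definition profile :: "real \<Rightarrow> real" where "profile t = max 0 (\<alpha> t)"
definition profile' :: "real \<Rightarrow> real" where "profile' t = (if \<alpha> t > 0 then \<beta> t * speed t else 0)"

lemma frac_frac' [simp]: "frac (frac t) = frac (t::real)" by (simp add: frac_eq frac_lt_1)

lemma frac_per: "\<alpha> (frac t) = \<alpha> t" "\<beta> (frac t) = \<beta> t" "profile (frac t) = profile t" "profile' (frac t) = profile' t"
  by (simp_all add: \<alpha>_def \<beta>_def profile_def profile'_def speed_frac)

lemma sin_4pi: "sin (4 * pi) = 0" and cos_4pi: "cos (4 * pi) = 1"
  using sin_npi[of 4] cos_npi[of 4] by auto

lemma \<alpha>_eq: "t \<in> {0..1} \<Longrightarrow> \<alpha> t = - cos (min (\<theta> t) (4 * pi))"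
  and \<beta>_eq: "t \<in> {0..1} \<Longrightarrow> \<beta> t = sin (min (\<theta> t) (4 * pi))"
proof -
  assume t: "t \<in> {0..1}"
  consider "t < 1" | "t = 1" using t by fastforce
  then have "\<alpha> t = - cos (min (\<theta> t) (4 * pi)) \<and> \<beta> t = sin (min (\<theta> t) (4 * pi))"
  proof cases
    case 1
    then have "frac t = t" using t by (simp add: frac_eq)
    then show ?thesis by (simp add: \<alpha>_def \<beta>_def)
  next
    case 2
    have "frac (1::real) = 0" by simp
    then show ?thesis unfolding \<alpha>_def \<beta>_def 2 using \<theta>_0 \<theta>_1 by (simp add: min_def sin_4pi cos_4pi)
  qed
  then show "\<alpha> t = - cos (min (\<theta> t) (4 * pi))" "\<beta> t = sin (min (\<theta> t) (4 * pi))" by auto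
qed

lemma \<alpha>_\<beta>_square: "(\<alpha> t)\<^sup>2 + (\<beta> t)\<^sup>2 = 1" by (simp add: \<alpha>_def \<beta>_def)

lemma \<beta>_ends: "\<beta> 0 = 0" "\<beta> 1 = 0"
  using \<theta>_0 \<theta>_1 by (auto simp: \<beta>_eq min_def sin_4pi)

lemma \<alpha>_\<beta>_continuous: "continuous_on {0..1} \<alpha>" "continuous_on {0..1} \<beta>"
proof -
  have "continuous_on {0..1} (\<lambda>t. - cos (min (\<theta> t) (4 * pi)))"
    "continuous_on {0..1} (\<lambda>t. sin (min (\<theta> t) (4 * pi)))"
    by (intro continuous_intros \<theta>_continuous)+
  then show "continuous_on {0..1} \<alpha>" "continuous_on {0..1} \<beta>"
    using \<alpha>_eq \<beta>_eq by (metis (no_types, lifting) continuous_on_cong)+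
qed

text \<open>The parameters at which \<open>\<alpha>\<close>, \<open>\<beta>\<close> or \<open>profile\<close> may fail to be differentiable: the seam, the four
boundary rays of the two phases, and the ray where the angle is frozen.\<close>

definition kinks0 :: "real set" where
  "kinks0 = {t \<in> {0..1}. \<theta> t \<in> {0, pi / 2, 3 * pi / 2, 5 * pi / 2, 7 * pi / 2, 4 * pi}}"

lemma finite_kinks0: "finite kinks0"
proof -
  have "kinks0 = \<theta> -` {0, pi / 2, 3 * pi / 2, 5 * pi / 2, 7 * pi / 2, 4 * pi} \<inter> {0..1}"
    by (auto simp: kinks0_def)
  then show ?thesis using finite_vimage_IntI[OF _ \<theta>_inj] by simp
qed

definition kinks :: "real set" where "kinks = {t. frac t \<in> kinks0}"

lemma finite_kinks: "finite (kinks \<inter> {a..b})"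
proof -
  have "kinks \<inter> {a..b} \<subseteq> (\<Union>n\<in>{\<lfloor>a\<rfloor>..\<lfloor>b\<rfloor>}. (\<lambda>x. x + of_int n) ` kinks0)"
  proof
    fix t assume t: "t \<in> kinks \<inter> {a..b}"
    have "t = frac t + of_int \<lfloor>t\<rfloor>" by (simp add: frac_def)
    moreover have "\<lfloor>t\<rfloor> \<in> {\<lfloor>a\<rfloor>..\<lfloor>b\<rfloor>}" using t by (auto simp: floor_mono)
    ultimately show "t \<in> (\<Union>n\<in>{\<lfloor>a\<rfloor>..\<lfloor>b\<rfloor>}. (\<lambda>x. x + of_int n) ` kinks0)"
      using t unfolding kinks_def by blast
  qed
  then show ?thesis by (rule finite_subset) (simp add: finite_kinks0)
qed

lemma not_kinks0: assumes "t \<notin> kinks0" "0 \<le> t" "t \<le> 1"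
  shows "0 < t" "\<theta> t \<noteq> 4 * pi" "\<alpha> t \<noteq> 0"
proof -
  show "0 < t" using assms \<theta>_0 by (cases "t = 0") (auto simp: kinks0_def)
  show "\<theta> t \<noteq> 4 * pi" using assms by (auto simp: kinks0_def)
  show "\<alpha> t \<noteq> 0"
  proof
    assume "\<alpha> t = 0"
    then have "cos (min (\<theta> t) (4 * pi)) = 0" using assms by (simp add: \<alpha>_eq)
    then have "min (\<theta> t) (4 * pi) \<in> {pi / 2, 3 * pi / 2, 5 * pi / 2, 7 * pi / 2}"
      using assms \<theta>_nonneg by (intro cos_zeros_upto_4pi) auto
    then show False using assms pi_gt_zero by (auto simp: kinks0_def min_def split: if_splits)
  qed
qed

lemma \<alpha>_\<beta>_deriv:
  assumes "0 < t" "t < 1" "t \<notin> kinks0"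
  shows "(\<alpha> has_real_derivative \<beta> t * speed t) (at t)"
    and "(\<beta> has_real_derivative (if \<theta> t < 4 * pi then - \<alpha> t * speed t else 0)) (at t)"
proof -
  have d\<theta>: "(\<theta> has_real_derivative speed t) (at t)" using assms by (intro \<theta>_deriv)
  have cont: "isCont \<theta> t" using d\<theta> DERIV_isCont by blast
  have ne: "\<theta> t \<noteq> 4 * pi" using not_kinks0 assms by auto
  have ev01: "\<forall>\<^sub>F x in nhds t. x \<in> {0<..<1}"
    using assms by (intro eventually_nhds_in_open) auto
  have "(\<alpha> has_real_derivative \<beta> t * speed t) (at t) \<and>
     (\<beta> has_real_derivative (if \<theta> t < 4 * pi then - \<alpha> t * speed t else 0)) (at t)"
  proof (cases "\<theta> t < 4 * pi")
    case True
    have "\<forall>\<^sub>F x in nhds t. \<theta> x < 4 * pi"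
      by (metis True cont continuous_at order_tendstoD(2) eventually_nhds_conv_at)
    then have ev: "\<forall>\<^sub>F x in nhds t. \<alpha> x = - cos (\<theta> x)" "\<forall>\<^sub>F x in nhds t. \<beta> x = sin (\<theta> x)"
      using ev01 by (eventually_elim, simp add: \<alpha>_eq \<beta>_eq)+
    have "((\<lambda>x. - cos (\<theta> x)) has_real_derivative \<beta> t * speed t) (at t)"
      "((\<lambda>x. sin (\<theta> x)) has_real_derivative - \<alpha> t * speed t) (at t)"
      using assms True by (auto intro!: derivative_eq_intros d\<theta> simp: \<alpha>_eq \<beta>_eq)
    then show ?thesis
      using True DERIV_cong_ev[OF refl ev(1) refl] DERIV_cong_ev[OF refl ev(2) refl] by simp
  next
    case False
    then have gt: "\<theta> t > 4 * pi" using ne by simp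
    have "\<forall>\<^sub>F x in nhds t. \<theta> x > 4 * pi"
      by (metis gt cont continuous_at order_tendstoD(1) eventually_nhds_conv_at)
    then have ev: "\<forall>\<^sub>F x in nhds t. \<alpha> x = - 1" "\<forall>\<^sub>F x in nhds t. \<beta> x = 0"
      using ev01 by (eventually_elim, simp add: \<alpha>_eq \<beta>_eq sin_4pi cos_4pi min_def)+
    have "\<beta> t = 0" using assms gt by (simp add: \<beta>_eq sin_4pi min_def)
    then show ?thesis
      using False DERIV_cong_ev[OF refl ev(1) refl] DERIV_cong_ev[OF refl ev(2) refl] by simp
  qed
  then show "(\<alpha> has_real_derivative \<beta> t * speed t) (at t)"
    and "(\<beta> has_real_derivative (if \<theta> t < 4 * pi then - \<alpha> t * speed t else 0)) (at t)" by auto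
qed

lemma profile_deriv: assumes "t \<notin> kinks" shows "(profile has_real_derivative profile' t) (at t)"
proof -
  define x where "x = frac t"
  have x: "x \<notin> kinks0" "0 \<le> x" "x < 1" using assms by (auto simp: kinks_def x_def frac_lt_1)
  note nF = not_kinks0[OF x(1,2) less_imp_le[OF x(3)]]
  have d\<alpha>: "(\<alpha> has_real_derivative \<beta> x * speed x) (at x)"
    using \<alpha>_\<beta>_deriv(1) nF x by auto
  then have "isCont \<alpha> x" by (rule DERIV_isCont)
  have "(profile has_real_derivative profile' x) (at x)"
  proof (cases "\<alpha> x > 0")
    case True
    have "\<forall>\<^sub>F y in nhds x. \<alpha> y > 0"
      by (metis True \<open>isCont \<alpha> x\<close> continuous_at order_tendstoD(1) eventually_nhds_conv_at)
    then have "\<forall>\<^sub>F y in nhds x. profile y = \<alpha> y" by eventually_elim (simp add: profile_def)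
    from DERIV_cong_ev[OF refl this refl] show ?thesis using d\<alpha> True by (simp add: profile'_def)
  next
    case False
    then have "\<alpha> x < 0" using nF(3) by simp
    then have "\<forall>\<^sub>F y in nhds x. \<alpha> y < 0"
      by (metis \<open>isCont \<alpha> x\<close> continuous_at order_tendstoD(2) eventually_nhds_conv_at)
    then have "\<forall>\<^sub>F y in nhds x. profile y = 0" by eventually_elim (simp add: profile_def)
    from DERIV_cong_ev[OF refl this refl] show ?thesis using False by (simp add: profile'_def)
  qed
  then have "(profile has_real_derivative profile' t) (at (frac t))" by (simp only: x_def frac_per)
  then show ?thesis
    by (rule DERIV_periodic[of profile, OF frac_per(3)[symmetric], rotated]) (use nF(1) in \<open>simp add: x_def\<close>)
qed

definition u :: "real^3 \<Rightarrow> real" where "u x = norm x * profile (\<tau> x)"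

lemma u_cm: "r \<ge> 0 \<Longrightarrow> u (r *\<^sub>R \<gamma> t) = r * profile t"
  by (cases "r = 0") (auto simp: u_def \<tau>_cm frac_per)

lemma profile_bounds: "0 \<le> profile t" "profile t \<le> 1" 
  by (auto simp: profile_def \<alpha>_def)

lemma A_subset_K: "A \<subseteq> cm ` ({0..1} \<times> {0..1})"
proof
  fix x assume "x \<in> A"
  then obtain r t where rt: "x = r *\<^sub>R \<gamma> t" "r \<ge> 0" "t \<in> {0..<1}"
    unfolding A_eq using C_iff_frac by blast
  then have "r < 1" using \<open>x \<in> A\<close> cm_in_A_iff by auto
  with rt show "x \<in> cm ` ({0..1} \<times> {0..1})" by (intro image_eqI[of _ _ "(r, t)"]) auto
qed

text \<open>The closed truncated cone is a compact quotient of a square, so the graph of \<open>u\<close> over it is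
  the continuous image of a compact set, hence closed. This avoids discussing the seam.\<close>

lemma u_continuous: "continuous_on (cm ` ({0..1} \<times> {0..1})) u"
proof (rule continuous_from_closed_graph[where T="{0..1}"])
  let ?S = "{0..1} \<times> {0..1} :: (real \<times> real) set"
  show "u \<in> cm ` ?S \<rightarrow> {0..1}"
    using profile_bounds by (auto simp: u_cm intro!: mult_nonneg_nonneg mult_le_one)
  have "(\<lambda>x. (x, u x)) ` cm ` ?S = (\<lambda>z. (cm z, fst z * profile (snd z))) ` ?S"
    unfolding image_image by (rule image_cong) (auto simp: u_cm)
  moreover have "continuous_on ?S (\<lambda>z. profile (snd z))"
    unfolding profile_def by (intro continuous_intros continuous_on_compose2[OF \<alpha>_\<beta>_continuous(1)]) auto
  then have "continuous_on ?S (\<lambda>z. (cm z, fst z * profile (snd z)))"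
    by (intro continuous_intros cm_continuous)
  then have "compact ((\<lambda>z. (cm z, fst z * profile (snd z))) ` ?S)"
    by (intro compact_continuous_image compact_Times compact_Icc)
  ultimately show "closed ((\<lambda>x. (x, u x)) ` cm ` ?S)" by (simp add: compact_imp_closed)
qed (rule compact_Icc)

lemma u_continuous_A: "continuous_on A u"
  using u_continuous A_subset_K continuous_on_subset by blast

text \<open>Continuity at the integers, where the parametrisation by \<open>frac\<close> jumps, is inherited from \<open>u\<close>.\<close>

lemma profile_continuous: "continuous_on S profile"
proof -
  have "continuous_on UNIV (\<lambda>t. u (\<gamma> t))"
  proof (rule continuous_on_compose2[OF u_continuous \<gamma>_continuous])
    show "range \<gamma> \<subseteq> cm ` ({0..1} \<times> {0..1})"
    proof clarify
      fix t show "\<gamma> t \<in> cm ` ({0..1} \<times> {0..1})"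
        by (rule image_eqI[of _ _ "(1, frac t)"]) (auto simp: per_frac frac_lt_1 less_imp_le)
    qed
  qed
  moreover have "(\<lambda>t. u (\<gamma> t)) = profile" using u_cm[of 1] by (auto simp: fun_eq_iff)
  ultimately show ?thesis using continuous_on_subset by (metis subset_UNIV)
qed

lemma \<theta>_frac_borel: "(\<lambda>t. \<theta> (frac t)) \<in> borel_measurable borel"
proof -
  have f: "(frac :: real \<Rightarrow> real) \<in> borel_measurable borel" unfolding frac_def[abs_def] by measurable
  have "(\<lambda>t. indicat_real {0..1} t *\<^sub>R \<theta> t) \<in> borel_measurable borel"
    by (rule borel_measurable_continuous_on_indicator[OF _ \<theta>_continuous]) simp
  from measurable_compose[OF f this] show ?thesis
    by (rule back_subst[where P="\<lambda>f. f \<in> borel_measurable borel"])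
       (auto simp: fun_eq_iff indicator_def frac_lt_1 less_imp_le)
qed

lemma \<alpha>_\<beta>_borel: "\<alpha> \<in> borel_measurable borel" "\<beta> \<in> borel_measurable borel"
  using \<theta>_frac_borel unfolding \<alpha>_def[abs_def] \<beta>_def[abs_def] by measurable

lemma \<alpha>_\<beta>_abs: "\<bar>\<alpha> t\<bar> \<le> 1" "\<bar>\<beta> t\<bar> \<le> 1" by (auto simp: \<alpha>_def \<beta>_def)

lemma \<alpha>_\<beta>_lbb: "locally_bounded_borel \<alpha>" "locally_bounded_borel \<beta>"
  by (rule lbb_bound[OF _ _ lbb_const[of 1]]; simp add: \<alpha>_\<beta>_borel \<alpha>_\<beta>_abs)+

lemma speed_borel: "speed \<in> borel_measurable borel"
  by (rule borel_measurable_continuous_onI[OF speed_continuous])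

lemma profile'_borel: "profile' \<in> borel_measurable borel"
  unfolding profile'_def[abs_def] using \<alpha>_\<beta>_borel speed_borel by measurable

lemma profile'_lbb: "locally_bounded_borel profile'"
proof (rule lbb_bound[OF profile'_borel _ lbb_continuous[OF speed_continuous]])
  show "\<bar>profile' t\<bar> \<le> speed t" for t
    using \<alpha>_\<beta>_abs(2)[of t] speed_pos[of t] by (auto simp: profile'_def abs_mult intro!: mult_left_le_one_le)
qed

section \<open>Explicit tangential gradients\<close>

definition grad_u :: "real^3 \<Rightarrow> real^3" where
  "grad_u x = profile (\<tau> x) *\<^sub>R \<gamma> (\<tau> x) + (profile' (\<tau> x) / (speed (\<tau> x))\<^sup>2) *\<^sub>R \<gamma>' (\<tau> x)"

text \<open>On the punctured cone, the projection of the gradient of \<open>\<phi>\<close> to the tangent plane.\<close>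

definition tan_grad :: "(real^3 \<Rightarrow> real) \<Rightarrow> real^3 \<Rightarrow> real^3" where
  "tan_grad \<phi> x = (grad \<phi> x \<bullet> \<gamma> (\<tau> x)) *\<^sub>R \<gamma> (\<tau> x) +
     (grad \<phi> x \<bullet> \<gamma>' (\<tau> x) / (speed (\<tau> x))\<^sup>2) *\<^sub>R \<gamma>' (\<tau> x)"

definition perturb :: "(real^3 \<Rightarrow> real) \<Rightarrow> real^3 \<Rightarrow> real" where
  "perturb \<phi> x = u x + \<phi> x"

definition grad_perturb :: "(real^3 \<Rightarrow> real) \<Rightarrow> real^3 \<Rightarrow> real^3" where
  "grad_perturb \<phi> x = grad_u x + tan_grad \<phi> x"

text \<open>The function \<open>perturb \<phi>\<close> in polar coordinates, its radial derivative, and its angular derivative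
divided by \<open>r\<close>. The formulas make sense for all real \<open>r\<close>, so that no boundary at \<open>r = 0\<close> has to be
considered in the coordinate plane.\<close>

definition perturb_pol :: "(real^3 \<Rightarrow> real) \<Rightarrow> real \<times> real \<Rightarrow> real" where
  "perturb_pol \<phi> z = fst z * profile (snd z) + \<phi> (cm z)"

definition radial_pol :: "(real^3 \<Rightarrow> real) \<Rightarrow> real \<times> real \<Rightarrow> real" where
  "radial_pol \<phi> z = profile (snd z) + grad \<phi> (cm z) \<bullet> \<gamma> (snd z)"

definition angular_pol :: "(real^3 \<Rightarrow> real) \<Rightarrow> real \<times> real \<Rightarrow> real" where
  "angular_pol \<phi> z = profile' (snd z) + grad \<phi> (cm z) \<bullet> \<gamma>' (snd z)"

lemma perturb_cm: "fst z \<ge> 0 \<Longrightarrow> perturb \<phi> (cm z) = perturb_pol \<phi> z"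
  by (cases z) (simp add: perturb_def perturb_pol_def u_cm)

lemma \<gamma>_snd_continuous: "continuous_on S (\<lambda>z::real \<times> real. \<gamma> (snd z))" "continuous_on S (\<lambda>z::real \<times> real. \<gamma>' (snd z))"
  "continuous_on S (\<lambda>z::real \<times> real. profile (snd z))" "continuous_on S (\<lambda>z::real \<times> real. speed (snd z))"
  by (rule continuous_on_compose2[OF \<gamma>_continuous[of UNIV]] continuous_on_compose2[OF \<gamma>'_continuous[of UNIV]]
      continuous_on_compose2[OF profile_continuous[of UNIV]] continuous_on_compose2[OF speed_continuous[of UNIV]];
      auto intro!: continuous_intros)+

lemma perturb_pol_continuous: assumes "Ck 1 \<phi>" shows "continuous_on S (perturb_pol \<phi>)"
  unfolding perturb_pol_def[abs_def]
  by (intro continuous_intros \<gamma>_snd_continuous continuous_on_compose2[OF Ck_1_continuous[OF assms] cm_continuous]) auto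

lemma radial_pol_lbb: assumes "Ck 1 \<phi>" shows "locally_bounded_borel (radial_pol \<phi>)"
  unfolding radial_pol_def[abs_def]
  by (intro lbb_continuous continuous_intros \<gamma>_snd_continuous
      continuous_on_compose2[OF continuous_grad[OF assms] cm_continuous]) auto

lemma angular_pol_lbb: assumes "Ck 1 \<phi>" shows "locally_bounded_borel (angular_pol \<phi>)"
  unfolding angular_pol_def[abs_def]
proof (intro lbb_add lbb_mult lbb_const lbb_snd profile'_lbb)
  show "locally_bounded_borel (\<lambda>z. grad \<phi> (cm z) \<bullet> \<gamma>' (snd z))"
    by (intro lbb_continuous continuous_intros \<gamma>_snd_continuous
      continuous_on_compose2[OF continuous_grad[OF assms] cm_continuous]) auto
qed

lemma perturb_pol_deriv_r: assumes "Ck 1 \<phi>"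
  shows "((\<lambda>r. perturb_pol \<phi> (r, t)) has_real_derivative radial_pol \<phi> (r, t)) (at r)"
proof -
  have "((\<lambda>r. r *\<^sub>R \<gamma> t) has_derivative (\<lambda>h. h *\<^sub>R \<gamma> t)) (at r)"
    by (auto intro!: derivative_eq_intros)
  from has_derivative_compose[OF this has_derivative_grad[OF assms]]
  have "((\<lambda>r. \<phi> (r *\<^sub>R \<gamma> t)) has_real_derivative grad \<phi> (r *\<^sub>R \<gamma> t) \<bullet> \<gamma> t) (at r)"
    by (simp add: has_field_derivative_def mult_commute_abs)
  then show ?thesis
    unfolding perturb_pol_def radial_pol_def by (auto intro!: derivative_eq_intros)
qed

lemma perturb_pol_deriv_t: assumes "Ck 1 \<phi>" "t \<notin> kinks"
  shows "((\<lambda>t. perturb_pol \<phi> (r, t)) has_real_derivative r * angular_pol \<phi> (r, t)) (at t)"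
proof -
  have "((\<lambda>t. r *\<^sub>R \<gamma> t) has_derivative (\<lambda>h. r *\<^sub>R (h *\<^sub>R \<gamma>' t))) (at t)"
    using \<gamma>_vector_derivative[of t] unfolding has_vector_derivative_def by (rule has_derivative_scaleR_right)
  from has_derivative_compose[OF this has_derivative_grad[OF assms(1)]]
  have "((\<lambda>t. \<phi> (r *\<^sub>R \<gamma> t)) has_real_derivative r * (grad \<phi> (r *\<^sub>R \<gamma> t) \<bullet> \<gamma>' t)) (at t)"
    by (simp add: has_field_derivative_def mult_ac mult_commute_abs)
  then show ?thesis
    unfolding perturb_pol_def angular_pol_def
    by (auto intro!: derivative_eq_intros profile_deriv[OF assms(2)] simp: algebra_simps)
qed

lemma grad_perturb_cm:
  assumes "fst z > 0"
  shows "grad_perturb \<phi> (cm z) =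
    radial_pol \<phi> z *\<^sub>R \<gamma> (snd z) + (angular_pol \<phi> z / (speed (snd z))\<^sup>2) *\<^sub>R \<gamma>' (snd z)"
  using assms
  by (cases z) (simp add: grad_perturb_def grad_u_def tan_grad_def \<tau>_cm frac_per per_frac per'_frac
      speed_frac radial_pol_def angular_pol_def algebra_simps add_divide_distrib)

lemma norm_grad_perturb_cm:
  assumes "fst z > 0"
  shows "(norm (grad_perturb \<phi> (cm z)))\<^sup>2 = (radial_pol \<phi> z)\<^sup>2 + (angular_pol \<phi> z / speed (snd z))\<^sup>2"
  using speed_pos[of "snd z"] unfolding grad_perturb_cm[OF assms] power2_norm_eq_inner
  by (simp add: inner_add_left inner_add_right power2_eq_square)

lemma borel_on_A:
  fixes P :: "real^3 \<Rightarrow> 'b::euclidean_space"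
  shows "P \<in> borel_measurable borel \<Longrightarrow> set_borel_measurable borel A P"
  unfolding set_borel_measurable_def using A_borel by measurable

lemma grad_perturb_borel: assumes "Ck 1 \<phi>" shows "grad_perturb \<phi> \<in> borel_measurable borel"
proof -
  note b = measurable_compose[OF \<tau>_borel borel_measurable_continuous_onI[OF \<gamma>_continuous]]
    measurable_compose[OF \<tau>_borel borel_measurable_continuous_onI[OF \<gamma>'_continuous]]
    measurable_compose[OF \<tau>_borel borel_measurable_continuous_onI[OF profile_continuous]]
    measurable_compose[OF \<tau>_borel speed_borel] measurable_compose[OF \<tau>_borel profile'_borel]
    borel_measurable_continuous_onI[OF continuous_grad[OF assms]]
  show ?thesis
    unfolding grad_perturb_def[abs_def] grad_u_def tan_grad_def using b by measurable
qed

lemma perturb_borel: assumes "Ck 1 \<phi>" shows "set_borel_measurable borel A (perturb \<phi>)"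
  unfolding set_borel_measurable_def perturb_def[abs_def]
  by (intro borel_measurable_continuous_on_indicator continuous_intros u_continuous_A A_borel
      continuous_on_subset[OF Ck_1_continuous[OF assms]]) auto

lemma weak_grad_perturb:
  assumes "Ck 1 \<phi>"
  shows "weak_tangential_gradient \<gamma> (perturb \<phi>) (grad_perturb \<phi>)"
  unfolding weak_tangential_gradient_def
proof (intro conjI ballI allI)
  show "set_borel_measurable borel A (grad_perturb \<phi>)" by (rule borel_on_A[OF grad_perturb_borel[OF assms]])
next
  fix z assume z: "z \<in> \<Omega>"
  obtain r t where rt: "z = (r, t)" by (cases z)
  have r: "r > 0" using z rt by auto
  have "grad_perturb \<phi> (cm z) =
      frechet_derivative cm (at z) (radial_pol \<phi> z, angular_pol \<phi> z / ((speed t)\<^sup>2 * r))"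
    using r grad_perturb_cm[of z \<phi>] unfolding rt cm_derivative by simp
  then show "grad_perturb \<phi> (cm z) \<in> range (frechet_derivative cm (at z))" by blast
next
  fix v
  have "weak_directional_derivative \<Omega> v (perturb_pol \<phi>)
      (\<lambda>z. fst v * radial_pol \<phi> z + snd v * (fst z * angular_pol \<phi> z))"
  proof (rule weak_derivative_piecewise_smooth[where N=kinks])
    show "locally_bounded_borel (\<lambda>z. fst z * angular_pol \<phi> z)"
      by (intro lbb_mult angular_pol_lbb assms lbb_continuous continuous_intros)
  qed (use perturb_pol_continuous perturb_pol_deriv_r perturb_pol_deriv_t finite_kinks radial_pol_lbb assms in auto)
  then show "weak_directional_derivative \<Omega> v (\<lambda>z. perturb \<phi> (cm z))
      (\<lambda>z. grad_perturb \<phi> (cm z) \<bullet> frechet_derivative cm (at z) v)"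
  proof (rule weak_directional_derivative_cong)
    fix z assume z: "z \<in> \<Omega>"
    obtain r t where rt: "z = (r, t)" by (cases z)
    have r: "r > 0" using z rt by auto
    show "perturb \<phi> (cm z) = perturb_pol \<phi> z" using r rt by (intro perturb_cm) simp
    show "grad_perturb \<phi> (cm z) \<bullet> frechet_derivative cm (at z) v
        = fst v * radial_pol \<phi> z + snd v * (fst z * angular_pol \<phi> z)"
      using r speed_pos[of t] grad_perturb_cm[of z \<phi>] unfolding rt cm_derivative
      by (simp add: inner_add_left inner_add_right algebra_simps)
  qed
qed

lemma lbb_integrable_\<mu>:
  assumes "locally_bounded_borel g" shows "integrable \<mu> g"
proof -
  have "g \<in> borel_measurable \<mu>" using assms by (intro borel_measurable_\<mu>) (simp add: locally_bounded_borel_def)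
  then show ?thesis
    using lbb_set_integrable[OF lbb_mult[OF weight_lbb assms] Q_bounded Q_borel]
    by (simp add: \<mu>_integrable_iff)
qed

lemma cone_L2_iff:
  fixes f :: "real^3 \<Rightarrow> 'b::euclidean_space"
  shows "f \<in> cone_L2 \<gamma> \<longleftrightarrow> set_borel_measurable borel A f \<and> integrable \<mu> (\<lambda>z. (norm (f (cm z)))\<^sup>2)"
proof -
  have "set_borel_measurable borel A (\<lambda>x. (norm (f x))\<^sup>2)" if "set_borel_measurable borel A f"
  proof -
    have "(\<lambda>x. (norm (indicat_real A x *\<^sub>R f x))\<^sup>2) \<in> borel_measurable borel"
      using that unfolding set_borel_measurable_def by measurable
    then show ?thesis unfolding set_borel_measurable_def
      by (rule back_subst[where P="\<lambda>f. f \<in> borel_measurable borel"]) (auto simp: fun_eq_iff indicator_def)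
  qed
  then show ?thesis
    unfolding cone_L2_def using cone_area_transfer(1)[of "\<lambda>x. (norm (f x))\<^sup>2"] by auto
qed

lemma perturb_L2: assumes "Ck 1 \<phi>" shows "perturb \<phi> \<in> cone_L2 \<gamma>"
proof -
  have "integrable \<mu> (\<lambda>z. (perturb_pol \<phi> z)\<^sup>2)"
    unfolding power2_eq_square
    by (intro lbb_integrable_\<mu> lbb_mult lbb_continuous perturb_pol_continuous assms)
  moreover have "(norm (perturb \<phi> (cm z)))\<^sup>2 = (perturb_pol \<phi> z)\<^sup>2" if "z \<in> space \<mu>" for z
    using that perturb_cm[of z \<phi>] by (auto simp: space_\<mu> Q_def)
  ultimately have "integrable \<mu> (\<lambda>z. (norm (perturb \<phi> (cm z)))\<^sup>2)"
    by (simp cong: Bochner_Integration.integrable_cong)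
  then show ?thesis
    unfolding cone_L2_iff using perturb_borel[OF assms] by blast
qed

lemma grad_perturb_L2: assumes "Ck 1 \<phi>" shows "grad_perturb \<phi> \<in> cone_L2 \<gamma>"
proof -
  have "locally_bounded_borel (\<lambda>z::real \<times> real. inverse (speed (snd z)))"
    using speed_pos by (intro lbb_continuous continuous_on_inverse \<gamma>_snd_continuous) (auto simp: less_imp_neq[symmetric])
  then have "integrable \<mu> (\<lambda>z. (radial_pol \<phi> z)\<^sup>2 + (angular_pol \<phi> z / speed (snd z))\<^sup>2)"
    unfolding divide_inverse
    by (intro lbb_integrable_\<mu> lbb_sum_square lbb_mult radial_pol_lbb angular_pol_lbb assms)
  moreover have "(norm (grad_perturb \<phi> (cm z)))\<^sup>2 = (radial_pol \<phi> z)\<^sup>2 + (angular_pol \<phi> z / speed (snd z))\<^sup>2"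
    if "z \<in> space \<mu>" for z
    using that by (intro norm_grad_perturb_cm) (auto simp: space_\<mu> Q_def)
  ultimately have "integrable \<mu> (\<lambda>z. (norm (grad_perturb \<phi> (cm z)))\<^sup>2)"
    by (simp cong: Bochner_Integration.integrable_cong)
  then show ?thesis
    unfolding cone_L2_iff using borel_on_A[OF grad_perturb_borel[OF assms]] by blast
qed

lemma tangential_gradient_weak:
  "weak_tangential_gradient \<gamma> f G \<Longrightarrow> weak_tangential_gradient \<gamma> f (tangential_gradient \<gamma> f)"
  unfolding tangential_gradient_def by (rule someI[of _ G])

text \<open>Uniqueness makes any explicit square integrable weak gradient as good as the chosen one.\<close>

lemma cone_H1I:
  assumes "f \<in> cone_L2 \<gamma>" "weak_tangential_gradient \<gamma> f G" "G \<in> cone_L2 \<gamma>"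
  shows "f \<in> cone_H1 \<gamma>" and "AE z in \<mu>. tangential_gradient \<gamma> f (cm z) = G (cm z)"
proof -
  note w = tangential_gradient_weak[OF assms(2)]
  show ae: "AE z in \<mu>. tangential_gradient \<gamma> f (cm z) = G (cm z)"
    by (rule weak_tangential_gradient_unique[OF w assms(2)])
  have sb: "set_borel_measurable borel A (tangential_gradient \<gamma> f)"
    using w by (simp add: weak_tangential_gradient_def)
  have sbG: "set_borel_measurable borel A G" and i: "integrable \<mu> (\<lambda>z. (norm (G (cm z)))\<^sup>2)"
    using assms(3) unfolding cone_L2_iff by auto
  have "integrable \<mu> (\<lambda>z. (norm (tangential_gradient \<gamma> f (cm z)))\<^sup>2)"
    by (rule integrable_cong_AE_imp[OF i])
       (use pullback_measurable[OF sb] ae in \<open>auto elim!: eventually_mono\<close>)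
  then show "f \<in> cone_H1 \<gamma>"
    unfolding cone_H1_def using assms sb by (auto simp: cone_L2_iff)
qed

end

section \<open>The calibration inequality\<close>

text \<open>A \<open>C\<^sup>1\<close> approximation of \<open>max 0 t\<close>. Its derivative, \<open>min 1 (max 0 (m t))\<close>, is Lipschitz, vanishes for
\<open>t \<le> 0\<close>, and tends to \<open>1\<close> for \<open>t > 0\<close> as \<open>m \<rightarrow> \<infinity>\<close>.\<close>

definition trunc :: "real \<Rightarrow> real \<Rightarrow> real" where
  "trunc m t = m / 2 * (pos_sq t - pos_sq (t - 1 / m))"

definition trunc' :: "real \<Rightarrow> real \<Rightarrow> real" where
  "trunc' m t = m * (max 0 t - max 0 (t - 1 / m))"

lemma trunc_deriv: "(trunc m has_real_derivative trunc' m t) (at t)"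
proof -
  have "((\<lambda>t. pos_sq (t - 1 / m)) has_real_derivative 2 * max 0 (t - 1 / m) * 1) (at t)"
    by (rule DERIV_chain2[OF pos_sq_deriv]) (auto intro!: derivative_eq_intros)
  then have "((\<lambda>t. m / 2 * (pos_sq t - pos_sq (t - 1 / m))) has_real_derivative
      m / 2 * (2 * max 0 t - 2 * max 0 (t - 1 / m) * 1)) (at t)"
    by (intro DERIV_cmult DERIV_diff pos_sq_deriv)
  then show ?thesis by (simp add: trunc_def[abs_def] trunc'_def algebra_simps)
qed

lemma trunc_nonneg: "m > 0 \<Longrightarrow> trunc m t \<ge> 0"
proof -
  assume "m > 0"
  then have "1 / m > 0" by simp
  then have "pos_sq (t - 1 / m) \<le> pos_sq t"
    unfolding pos_sq_def by (intro power_mono max.mono) (linarith | simp)+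
  then show ?thesis using \<open>m > 0\<close> by (simp add: trunc_def)
qed

lemma trunc_0: "m > 0 \<Longrightarrow> trunc m 0 = 0"
  by (simp add: trunc_def pos_sq_def)

lemma trunc'_alt: assumes "m > 0" shows "trunc' m t = min 1 (max 0 (m * t))"
proof -
  have m: "1 / m > 0" using assms by simp
  consider "t < 0" | "0 \<le> t" "t \<le> 1 / m" | "1 / m < t" by linarith
  then show ?thesis
  proof cases
    case 1
    then have "m * t < 0" using assms by (simp add: mult_pos_neg)
    moreover have "t - 1 / m \<le> 0" using 1 m by linarith
    ultimately show ?thesis using 1 by (simp only: trunc'_def max_absorb1 less_imp_le) simp
  next
    case 2
    then show ?thesis using assms by (simp add: trunc'_def field_simps)
  next
    case 3
    then have "t > 0" using m by linarith
    then show ?thesis using assms 3 by (simp add: trunc'_def field_simps)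
  qed
qed

lemma trunc'_props:
  assumes "m > 0"
  shows "0 \<le> trunc' m t" "trunc' m t \<le> 1" "t \<le> 0 \<Longrightarrow> trunc' m t = 0"
    "\<bar>trunc' m t - trunc' m t'\<bar> \<le> m * \<bar>t - t'\<bar>"
proof -
  show "0 \<le> trunc' m t" "trunc' m t \<le> 1" using trunc'_alt[OF assms] by auto
  show "t \<le> 0 \<Longrightarrow> trunc' m t = 0"
    using trunc'_alt[OF assms] assms by (simp add: mult_nonneg_nonpos)
  have "\<bar>trunc' m t - trunc' m t'\<bar> \<le> \<bar>m * t - m * t'\<bar>"
    unfolding trunc'_alt[OF assms] by (auto simp: min_def max_def)
  also have "\<dots> = m * \<bar>t - t'\<bar>" using assms by (simp add: abs_mult flip: right_diff_distrib)
  finally show "\<bar>trunc' m t - trunc' m t'\<bar> \<le> m * \<bar>t - t'\<bar>" .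
qed

lemma trunc'_tendsto:
  assumes "t > 0" shows "(\<lambda>n. trunc' (real (Suc n)) t) \<longlonglongrightarrow> 1"
proof -
  obtain k where k: "1 / t \<le> real k" using real_arch_simple by blast
  have "trunc' (real (Suc n)) t = 1" if "n \<ge> k" for n
  proof -
    have "1 / t \<le> real (Suc n)" using k that by simp
    then have "1 \<le> real (Suc n) * t" using assms by (simp add: divide_le_eq)
    then show ?thesis by (simp add: trunc'_alt)
  qed
  then have "\<forall>\<^sub>F n in sequentially. trunc' (real (Suc n)) t = 1"
    by (auto simp: eventually_sequentially)
  then show ?thesis by (rule tendsto_eventually)
qed

lemma continuous_on_trunc: "continuous_on S (trunc m)" "continuous_on S (trunc' m)"
  unfolding trunc_def[abs_def] trunc'_def[abs_def] by (intro continuous_intros)+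

context long_spherical_curve
begin

text \<open>The field \<open>e\<close> of the introduction; \<open>\<gamma>' / speed\<close> is the unit vector of the angular direction.\<close>

definition calib :: "real \<times> real \<Rightarrow> real^3" where
  "calib z = \<alpha> (snd z) *\<^sub>R \<gamma> (snd z) + (\<beta> (snd z) / speed (snd z)) *\<^sub>R \<gamma>' (snd z)"

definition flux :: "(real^3 \<Rightarrow> real) \<Rightarrow> real \<times> real \<Rightarrow> real" where
  "flux \<phi> z = \<alpha> (snd z) * radial_pol \<phi> z + \<beta> (snd z) * angular_pol \<phi> z / speed (snd z)"

lemma norm_calib: "norm (calib z) = 1"
proof -
  have "(norm (calib z))\<^sup>2 = 1"
    using speed_pos[of "snd z"] \<alpha>_\<beta>_square[of "snd z"] unfolding power2_norm_eq_inner calib_def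
    by (simp add: inner_add_left inner_add_right power2_eq_square)
  then show ?thesis by (metis norm_ge_zero power2_eq_1_iff abs_norm_cancel abs_1 abs_minus_cancel)
qed

lemma snd_borel: "(f :: real \<Rightarrow> 'b::euclidean_space) \<in> borel_measurable borel \<Longrightarrow> (\<lambda>z::real \<times> real. f (snd z)) \<in> borel_measurable borel"
proof -
  have "(snd :: real \<times> real \<Rightarrow> real) \<in> borel_measurable borel"
    by (rule borel_measurable_continuous_onI) (intro continuous_intros)
  then show "f \<in> borel_measurable borel \<Longrightarrow> (\<lambda>z::real \<times> real. f (snd z)) \<in> borel_measurable borel"
    by (rule measurable_compose)
qed

lemma calib_borel: "calib \<in> borel_measurable borel"
proof -
  note b = \<alpha>_\<beta>_borel[THEN snd_borel] speed_borel[THEN snd_borel]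
    borel_measurable_continuous_onI[OF \<gamma>_snd_continuous(1)]
    borel_measurable_continuous_onI[OF \<gamma>_snd_continuous(2)]
  show ?thesis unfolding calib_def[abs_def] using b by measurable
qed

lemma calib_grad_perturb:
  assumes "fst z > 0"
  shows "calib z \<bullet> grad_perturb \<phi> (cm z) = flux \<phi> z"
  using speed_pos[of "snd z"] unfolding grad_perturb_cm[OF assms] calib_def flux_def
  by (simp add: inner_add_left inner_add_right power2_eq_square)

lemma flux_lbb: assumes "Ck 1 \<phi>" shows "locally_bounded_borel (flux \<phi>)"
proof -
  have "locally_bounded_borel (\<lambda>z::real \<times> real. inverse (speed (snd z)))"
    using speed_pos by (intro lbb_continuous continuous_on_inverse \<gamma>_snd_continuous) (auto simp: less_imp_neq[symmetric])
  then show ?thesis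
    unfolding flux_def[abs_def] divide_inverse
    by (intro lbb_add lbb_mult lbb_snd[OF \<alpha>_\<beta>_lbb(1)] lbb_snd[OF \<alpha>_\<beta>_lbb(2)] radial_pol_lbb angular_pol_lbb assms)
qed

text \<open>The derivative of \<open>\<beta>\<close> off the kinks. The divergence of the calibration is
\<open>(\<alpha> + \<beta>' / speed) / r\<close>, that is \<open>0\<close> where \<open>\<theta> < 4\<pi>\<close> and \<open>- 1 / r\<close> elsewhere.\<close>

definition \<beta>' :: "real \<Rightarrow> real" where
  "\<beta>' t = (if \<theta> (frac t) < 4 * pi then - \<alpha> t * speed t else 0)"

lemma \<beta>'_lbb: "locally_bounded_borel \<beta>'"
proof (rule lbb_bound[OF _ _ lbb_continuous[OF speed_continuous]])
  show "\<beta>' \<in> borel_measurable borel"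
    unfolding \<beta>'_def[abs_def] using \<theta>_frac_borel \<alpha>_\<beta>_borel speed_borel by measurable
  show "\<bar>\<beta>' t\<bar> \<le> speed t" for t
    using \<alpha>_\<beta>_abs(1)[of t] speed_pos[of t] by (auto simp: \<beta>'_def abs_mult intro!: mult_left_le_one_le)
qed

lemma Q_integrable: "locally_bounded_borel g \<Longrightarrow> set_integrable lborel Q g"
  by (rule lbb_set_integrable[OF _ Q_bounded Q_borel])

text \<open>With \<open>Z = trunc m (u + \<phi>) - trunc m u\<close>, the difference of the two sides is the integral of
\<open>e \<bullet> DZ\<close> over the cone. Integration by parts leaves \<open>- Z div e\<close>. Boundary terms are absent: at
\<open>r = 1\<close> since \<open>\<phi>\<close> vanishes there, at \<open>r = 0\<close> because of the factor \<open>r\<close>, and along the seam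
because \<open>\<beta>\<close> vanishes on both sides. Where \<open>div e \<noteq> 0\<close>, \<open>u = 0\<close>, so that \<open>Z \<ge> 0\<close>.\<close>

lemma calibration_polar:
  assumes phi: "\<phi> \<in> C1c (ball 0 1)" and m: "m > 0"
  defines "z0 \<equiv> (\<lambda>_. 0) :: real^3 \<Rightarrow> real"
  shows "(LINT z|\<mu>. trunc' m (perturb_pol z0 z) * flux z0 z) \<le>
         (LINT z|\<mu>. trunc' m (perturb_pol \<phi> z) * flux \<phi> z)"
proof -
  have C: "Ck 1 \<phi>" using phi by (simp add: C1c_def)
  have C0: "Ck 1 z0" unfolding z0_def by (rule Ck_1I[of _ "\<lambda>_ _. 0"]) auto
  define Z where "Z z = trunc m (perturb_pol \<phi> z) - trunc m (perturb_pol z0 z)" for z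
  define P where "P z = trunc' m (perturb_pol \<phi> z) * radial_pol \<phi> z - trunc' m (perturb_pol z0 z) * radial_pol z0 z" for z
  define R where "R z = trunc' m (perturb_pol \<phi> z) * angular_pol \<phi> z - trunc' m (perturb_pol z0 z) * angular_pol z0 z" for z
  have tc: "continuous_on S (\<lambda>z. trunc m (perturb_pol \<psi> z))" "continuous_on S (\<lambda>z. trunc' m (perturb_pol \<psi> z))"
    if "Ck 1 \<psi>" for \<psi> S
    using continuous_on_compose2[OF continuous_on_trunc(1) perturb_pol_continuous[OF that, of S], of UNIV m]
      continuous_on_compose2[OF continuous_on_trunc(2) perturb_pol_continuous[OF that, of S], of UNIV m] by auto
  have Zc: "continuous_on S Z" for S
    unfolding Z_def[abs_def] by (intro continuous_intros tc C C0)
  have Zr: "((\<lambda>r. Z (r, t)) has_real_derivative P (r, t)) (at r)" for r t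
    unfolding Z_def P_def
    by (intro DERIV_diff DERIV_chain2[OF trunc_deriv] perturb_pol_deriv_r C C0)
  have Zt: "((\<lambda>t. Z (r, t)) has_real_derivative r * R (r, t)) (at t)" if "t \<notin> kinks" for r t
  proof -
    have "((\<lambda>t. Z (r, t)) has_real_derivative trunc' m (perturb_pol \<phi> (r, t)) * (r * angular_pol \<phi> (r, t)) -
        trunc' m (perturb_pol z0 (r, t)) * (r * angular_pol z0 (r, t))) (at t)"
      unfolding Z_def
      by (intro DERIV_diff DERIV_chain2[OF trunc_deriv] perturb_pol_deriv_t C C0 that)
    then show ?thesis by (simp add: R_def algebra_simps)
  qed
  have Zl: "locally_bounded_borel Z" by (rule lbb_continuous[OF Zc])
  have Pl: "locally_bounded_borel P" and Rl: "locally_bounded_borel R"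
    unfolding P_def[abs_def] R_def[abs_def]
    by (intro lbb_diff lbb_mult lbb_continuous[OF tc(2)] radial_pol_lbb angular_pol_lbb C C0)+
  have fl: "locally_bounded_borel (\<lambda>z::real \<times> real. fst z)" 
    by (intro lbb_continuous continuous_intros)
  have sl: "locally_bounded_borel (\<lambda>z::real \<times> real. speed (snd z))"
    by (intro lbb_continuous \<gamma>_snd_continuous)
  have Z1: "Z (1, t) = 0" for t
    using C1c_outside[OF phi, of "\<gamma> t"] by (simp add: Z_def perturb_pol_def z0_def)
  have Zper: "Z (r, 1) = Z (r, 0)" for r
    using per1[of 0] frac_per(3)[of 1] frac_per(3)[of 0] by (simp add: Z_def perturb_pol_def)
  \<comment> \<open>The integrands of the radial and the angular integration by parts; they are the derivatives of
    \<open>\<alpha> speed r Z\<close> in \<open>r\<close> and of \<open>\<beta> Z\<close> in \<open>t\<close>.\<close>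
  define h1 where "h1 z = \<alpha> (snd z) * speed (snd z) * (Z z + fst z * P z)" for z
  define h2 where "h2 z = \<beta>' (snd z) * Z z + fst z * R z * \<beta> (snd z)" for z
  have h1l: "locally_bounded_borel h1" and h2l: "locally_bounded_borel h2"
    unfolding h1_def[abs_def] h2_def[abs_def]
    by (intro lbb_mult lbb_add lbb_snd \<alpha>_\<beta>_lbb sl Zl Pl Rl fl \<beta>'_lbb)+
  have I: "bounded {0<..<1::real}" "{0<..<1::real} \<in> sets borel"
     "bounded {0..<1::real}" "{0..<1::real} \<in> sets borel" by auto
  have 1: "(LINT z:Q|lborel. h1 z) = 0"
    unfolding Q_def
  proof (rule set_integral_Times_zero[OF h1l I], rule disjI1, rule ballI)
    fix t
    show "(LINT r:{0<..<1}|lborel. h1 (r, t)) = 0"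
    proof (rule integral_of_derivative_zero[where a=0 and b=1 and S="{}" and F="\<lambda>r. \<alpha> t * speed t * (r * Z (r, t))"])
      show "((\<lambda>r. \<alpha> t * speed t * (r * Z (r, t))) has_real_derivative h1 (r, t)) (at r)" for r
        unfolding h1_def by (rule derivative_eq_intros Zr refl | simp)+
      show "continuous_on {0..1} (\<lambda>r. \<alpha> t * speed t * (r * Z (r, t)))"
        by (intro continuous_intros continuous_on_compose2[OF Zc[of UNIV]]) auto
    qed (use lbb_slice[OF h1l] Z1 in auto)
  qed
  have 2: "(LINT z:Q|lborel. h2 z) = 0"
    unfolding Q_def
  proof (rule set_integral_Times_zero[OF h2l I], rule disjI2, rule ballI)
    fix r
    show "(LINT t:{0..<1}|lborel. h2 (r, t)) = 0"
    proof (rule integral_of_derivative_zero[where a=0 and b=1 and S=kinks0 and F="\<lambda>t. \<beta> t * Z (r, t)"])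
      show "((\<lambda>t. \<beta> t * Z (r, t)) has_real_derivative h2 (r, t)) (at t)" if t: "t \<in> {0<..<1} - kinks0" for t
      proof -
        have fr: "frac t = t" using t by (simp add: frac_eq)
        then have "t \<notin> kinks" using t by (simp add: kinks_def)
        moreover have "(\<beta> has_real_derivative \<beta>' t) (at t)"
          unfolding \<beta>'_def fr using t by (intro \<alpha>_\<beta>_deriv(2)) auto
        ultimately show ?thesis
          unfolding h2_def using DERIV_mult[OF _ Zt] by fastforce
      qed
      show "continuous_on {0..1} (\<lambda>t. \<beta> t * Z (r, t))"
        by (intro continuous_intros \<alpha>_\<beta>_continuous continuous_on_compose2[OF Zc[of UNIV]]) auto
    qed (use lbb_slice[OF h2l] finite_kinks0 \<beta>_ends in auto)
  qed
  \<comment> \<open>This is \<open>- r speed Z div e\<close>.\<close>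
  define g where "g z = - ((\<alpha> (snd z) * speed (snd z) + \<beta>' (snd z)) * Z z)" for z
  have gl: "locally_bounded_borel g"
    using lbb_mult[OF lbb_const[of "-1"] lbb_mult[OF lbb_add[OF lbb_mult[OF lbb_snd[OF \<alpha>_\<beta>_lbb(1)] sl] lbb_snd[OF \<beta>'_lbb]] Zl]]
    by (simp add: g_def[abs_def])
  have g0: "g z \<ge> 0" if "z \<in> Q" for z
  proof (cases "\<theta> (frac (snd z)) < 4 * pi")
    case True then show ?thesis by (simp add: g_def \<beta>'_def)
  next
    case False
    then have a: "\<alpha> (snd z) = -1" by (simp add: \<alpha>_def min_def cos_4pi)
    then have "perturb_pol z0 z = 0" by (simp add: perturb_pol_def z0_def profile_def)
    then have "Z z \<ge> 0" using trunc_nonneg[OF m] trunc_0[OF m] by (simp add: Z_def)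
    then show ?thesis using False speed_pos[of "snd z"] by (simp add: g_def a \<beta>'_def)
  qed
  have X: "(LINT z|\<mu>. trunc' m (perturb_pol \<psi> z) * flux \<psi> z) =
      (LINT z:Q|lborel. fst z * speed (snd z) * (trunc' m (perturb_pol \<psi> z) * flux \<psi> z))"
    and Xi: "set_integrable lborel Q (\<lambda>z. fst z * speed (snd z) * (trunc' m (perturb_pol \<psi> z) * flux \<psi> z))"
    if "Ck 1 \<psi>" for \<psi>
  proof -
    have l: "locally_bounded_borel (\<lambda>z. trunc' m (perturb_pol \<psi> z) * flux \<psi> z)"
      by (intro lbb_mult lbb_continuous[OF tc(2)] flux_lbb that)
    then have "(\<lambda>z. trunc' m (perturb_pol \<psi> z) * flux \<psi> z) \<in> borel_measurable \<mu>"
      by (intro borel_measurable_\<mu>) (simp add: locally_bounded_borel_def)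
    then show "(LINT z|\<mu>. trunc' m (perturb_pol \<psi> z) * flux \<psi> z) =
      (LINT z:Q|lborel. fst z * speed (snd z) * (trunc' m (perturb_pol \<psi> z) * flux \<psi> z))"
      by (simp add: \<mu>_integral)
    show "set_integrable lborel Q (\<lambda>z. fst z * speed (snd z) * (trunc' m (perturb_pol \<psi> z) * flux \<psi> z))"
      by (intro Q_integrable lbb_mult[OF weight_lbb l])
  qed
  have "(LINT z|\<mu>. trunc' m (perturb_pol \<phi> z) * flux \<phi> z) - (LINT z|\<mu>. trunc' m (perturb_pol z0 z) * flux z0 z)
      = (LINT z:Q|lborel. fst z * speed (snd z) * (trunc' m (perturb_pol \<phi> z) * flux \<phi> z)
          - fst z * speed (snd z) * (trunc' m (perturb_pol z0 z) * flux z0 z))"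
    unfolding X[OF C] X[OF C0] by (rule set_integral_diff(2)[OF Xi[OF C] Xi[OF C0], symmetric])
  also have "\<dots> = (LINT z:Q|lborel. (h1 z + h2 z) + g z)"
  proof -
    have "fst z * speed (snd z) * (trunc' m (perturb_pol \<phi> z) * flux \<phi> z)
          - fst z * speed (snd z) * (trunc' m (perturb_pol z0 z) * flux z0 z) = (h1 z + h2 z) + g z" for z
      using speed_pos[of "snd z"]
      by (simp add: h1_def h2_def g_def flux_def P_def R_def field_simps)
    then show ?thesis by simp
  qed
  also have "\<dots> = (LINT z:Q|lborel. h1 z) + (LINT z:Q|lborel. h2 z) + (LINT z:Q|lborel. g z)"
    using set_integral_add[OF Q_integrable[OF h1l] Q_integrable[OF h2l]]
      set_integral_add[OF Q_integrable[OF lbb_add[OF h1l h2l]] Q_integrable[OF gl]] by simp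
  also have "\<dots> = (LINT z:Q|lborel. g z)" unfolding 1 2 by simp
  also have "\<dots> \<ge> 0"
    unfolding set_lebesgue_integral_def
    by (intro integral_nonneg_AE AE_I2) (simp add: g0 indicator_def)
  finally show ?thesis by simp
qed

end

section \<open>Minimality\<close>

text \<open>Passing to the limit in the calibration inequality: mean-square convergence enters through
  \<open>x y \<le> \<delta> y\<^sup>2 + x\<^sup>2 / \<delta>\<close>, and the Lipschitz bound on \<open>\<psi>\<close> controls the truncation without pointwise
  convergence.\<close>

lemma integral_limit_lower_bound:
  fixes G e :: "'a \<Rightarrow> 'b::euclidean_space" and Gn :: "nat \<Rightarrow> 'a \<Rightarrow> 'b"
    and w :: "'a \<Rightarrow> real" and wn :: "nat \<Rightarrow> 'a \<Rightarrow> real"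
  assumes "finite_measure M"
    and e: "e \<in> borel_measurable M" "\<And>x. norm (e x) \<le> 1"
    and \<psi>: "\<psi> \<in> borel_measurable borel" "\<And>t. 0 \<le> \<psi> t" "\<And>t. \<psi> t \<le> 1"
      "\<And>t t'. \<bar>\<psi> t - \<psi> t'\<bar> \<le> L * \<bar>t - t'\<bar>" "L \<ge> 0"
    and m: "w \<in> borel_measurable M" "G \<in> borel_measurable M"
      "\<And>n. wn n \<in> borel_measurable M" "\<And>n. Gn n \<in> borel_measurable M"
    and G2: "integrable M (\<lambda>x. (norm (G x))\<^sup>2)"
    and D: "\<And>n. integrable M (\<lambda>x. (wn n x - w x)\<^sup>2 + (norm (Gn n x - G x))\<^sup>2)"
    and lim: "(\<lambda>n. LINT x|M. (wn n x - w x)\<^sup>2 + (norm (Gn n x - G x))\<^sup>2) \<longlonglongrightarrow> 0"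
    and K: "\<And>n. K \<le> (LINT x|M. \<psi> (wn n x) * (e x \<bullet> Gn n x))"
  shows "K \<le> (LINT x|M. \<psi> (w x) * (e x \<bullet> G x))"
proof -
  interpret finite_measure M by fact
  have bd: "\<bar>\<psi> t * (e x \<bullet> y)\<bar> \<le> norm y" for t x y
  proof -
    have "\<bar>e x \<bullet> y\<bar> \<le> norm (e x) * norm y" by (rule Cauchy_Schwarz_ineq2)
    also have "\<dots> \<le> norm y" using e(2)[of x] by (simp add: mult_left_le_one_le)
    finally have 1: "\<bar>e x \<bullet> y\<bar> \<le> norm y" .
    have "\<psi> t * \<bar>e x \<bullet> y\<bar> \<le> \<bar>e x \<bullet> y\<bar>" using \<psi>(2,3)[of t] by (simp add: mult_left_le_one_le)
    then show ?thesis using 1 \<psi>(2)[of t] by (simp add: abs_mult)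
  qed
  have sq: "x \<le> 1 + x\<^sup>2" for x :: real using zero_le_power2[of "x - 1/2"] by (simp add: power2_eq_square algebra_simps)
  have meas: "(\<lambda>x. \<psi> (v x) * (e x \<bullet> H x)) \<in> borel_measurable M"
    if "v \<in> borel_measurable M" "H \<in> borel_measurable M" for v H
    using e(1) \<psi>(1) that by measurable
  have iG: "integrable M (\<lambda>x. \<psi> (w x) * (e x \<bullet> G x))"
  proof (rule Bochner_Integration.integrable_bound[of M "\<lambda>x. 1 + (norm (G x))\<^sup>2"])
    show "AE x in M. norm (\<psi> (w x) * (e x \<bullet> G x)) \<le> norm (1 + (norm (G x))\<^sup>2)"
      using bd sq by (intro AE_I2) (smt (verit) real_norm_def zero_le_power2)
  qed (use G2 meas m in auto)
  have iGn: "integrable M (\<lambda>x. \<psi> (wn n x) * (e x \<bullet> Gn n x))" for n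
  proof (rule Bochner_Integration.integrable_bound[of M
        "\<lambda>x. (1 + (norm (G x))\<^sup>2) + (1 + ((wn n x - w x)\<^sup>2 + (norm (Gn n x - G x))\<^sup>2))"])
    show "AE x in M. norm (\<psi> (wn n x) * (e x \<bullet> Gn n x)) \<le>
       norm ((1 + (norm (G x))\<^sup>2) + (1 + ((wn n x - w x)\<^sup>2 + (norm (Gn n x - G x))\<^sup>2)))"
    proof (rule AE_I2)
      fix x
      have "norm (Gn n x) \<le> norm (G x) + norm (Gn n x - G x)"
        using norm_triangle_ineq[of "G x" "Gn n x - G x"] by simp
      then show "norm (\<psi> (wn n x) * (e x \<bullet> Gn n x)) \<le>
       norm ((1 + (norm (G x))\<^sup>2) + (1 + ((wn n x - w x)\<^sup>2 + (norm (Gn n x - G x))\<^sup>2)))"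
        using bd[of "wn n x" x "Gn n x"] sq[of "norm (G x)"] sq[of "norm (Gn n x - G x)"]
          zero_le_power2[of "wn n x - w x"] unfolding real_norm_def by linarith
    qed
  qed (use G2 D meas m in \<open>auto intro!: Bochner_Integration.integrable_add\<close>)
  define I where "I = (LINT x|M. \<psi> (w x) * (e x \<bullet> G x))"
  define B where "B = (LINT x|M. 1 + (norm (G x))\<^sup>2)"
  have step: "K \<le> I + \<delta> * B" if \<delta>: "\<delta> > 0" for \<delta>
  proof -
    define E where "E n = (LINT x|M. (wn n x - w x)\<^sup>2 + (norm (Gn n x - G x))\<^sup>2)" for n
    have young: "x * y \<le> \<delta> * y\<^sup>2 + x\<^sup>2 / \<delta>" if "x \<ge> 0" "y \<ge> 0" for x y :: real
    proof -
      have "0 \<le> (x - \<delta> * y)\<^sup>2" by simp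
      then have "\<delta> * (x * y) \<le> \<delta> * (\<delta> * y\<^sup>2 + x\<^sup>2 / \<delta>)"
        using mult_nonneg_nonneg[OF less_imp_le[OF \<delta>] mult_nonneg_nonneg[OF that]] \<delta>
        by (simp add: power2_eq_square right_diff_distrib left_diff_distrib distrib_left mult_ac
            del: mult_nonneg_nonneg zero_le_mult_iff)
      then show ?thesis using \<delta> by simp
    qed
    have pt: "\<psi> (wn n x) * (e x \<bullet> Gn n x) \<le> \<psi> (w x) * (e x \<bullet> G x) + \<delta> * (1 + (norm (G x))\<^sup>2)
        + (1 + L\<^sup>2) / \<delta> * ((wn n x - w x)\<^sup>2 + (norm (Gn n x - G x))\<^sup>2)" for n x
    proof -
      define h where "h = \<bar>wn n x - w x\<bar>"
      define H where "H = norm (Gn n x - G x)"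
      have "\<psi> (wn n x) * (e x \<bullet> Gn n x) - \<psi> (w x) * (e x \<bullet> G x) =
          \<psi> (wn n x) * (e x \<bullet> (Gn n x - G x)) + (\<psi> (wn n x) - \<psi> (w x)) * (e x \<bullet> G x)"
        by (simp add: inner_diff_right algebra_simps)
      also have "\<dots> \<le> H + L * h * norm (G x)"
      proof (rule add_mono)
        show "\<psi> (wn n x) * (e x \<bullet> (Gn n x - G x)) \<le> H"
          using bd[of "wn n x" x "Gn n x - G x"] by (simp add: H_def)
        have "(\<psi> (wn n x) - \<psi> (w x)) * (e x \<bullet> G x) \<le> \<bar>\<psi> (wn n x) - \<psi> (w x)\<bar> * \<bar>e x \<bullet> G x\<bar>"
          by (metis abs_ge_self abs_mult)
        also have "\<dots> \<le> (L * h) * norm (G x)"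
        proof (rule mult_mono)
          show "\<bar>\<psi> (wn n x) - \<psi> (w x)\<bar> \<le> L * h" using \<psi>(4) by (simp add: h_def)
          show "\<bar>e x \<bullet> G x\<bar> \<le> norm (G x)"
            using Cauchy_Schwarz_ineq2[of "e x" "G x"] e(2)[of x]
            by (meson mult_left_le_one_le norm_ge_zero order_trans)
        qed (use \<psi>(5) in \<open>auto simp: h_def\<close>)
        finally show "(\<psi> (wn n x) - \<psi> (w x)) * (e x \<bullet> G x) \<le> L * h * norm (G x)" .
      qed
      also have "H \<le> \<delta> * 1\<^sup>2 + H\<^sup>2 / \<delta>" using young[of H 1] by (simp add: H_def)
      also have "L * h * norm (G x) \<le> \<delta> * (norm (G x))\<^sup>2 + (L * h)\<^sup>2 / \<delta>"
        using \<psi>(5) by (intro young) (auto simp: h_def)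
      finally have "\<psi> (wn n x) * (e x \<bullet> Gn n x) - \<psi> (w x) * (e x \<bullet> G x)
          \<le> \<delta> * (1 + (norm (G x))\<^sup>2) + (H\<^sup>2 + L\<^sup>2 * h\<^sup>2) / \<delta>"
        by (simp add: algebra_simps power_mult_distrib add_divide_distrib)
      also have "(H\<^sup>2 + L\<^sup>2 * h\<^sup>2) / \<delta> \<le> ((1 + L\<^sup>2) * (h\<^sup>2 + H\<^sup>2)) / \<delta>"
        using \<delta> by (intro divide_right_mono) (auto simp: algebra_simps)
      finally show ?thesis by (simp add: h_def H_def)
    qed
    have "K \<le> I + \<delta> * B + (1 + L\<^sup>2) / \<delta> * E n" for n
    proof -
      have i1: "integrable M (\<lambda>x. \<delta> * (1 + (norm (G x))\<^sup>2))" using G2 by auto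
      have i2: "integrable M (\<lambda>x. (1 + L\<^sup>2) / \<delta> * ((wn n x - w x)\<^sup>2 + (norm (Gn n x - G x))\<^sup>2))"
        using D by (intro integrable_mult_right) 
      have "K \<le> (LINT x|M. \<psi> (wn n x) * (e x \<bullet> Gn n x))" by (rule K)
      also have "\<dots> \<le> (LINT x|M. \<psi> (w x) * (e x \<bullet> G x) + \<delta> * (1 + (norm (G x))\<^sup>2)
        + (1 + L\<^sup>2) / \<delta> * ((wn n x - w x)\<^sup>2 + (norm (Gn n x - G x))\<^sup>2))"
        by (intro integral_mono iGn Bochner_Integration.integrable_add iG i1 i2 pt)
      also have "\<dots> = I + \<delta> * B + (1 + L\<^sup>2) / \<delta> * E n"
        unfolding I_def B_def E_def
          Bochner_Integration.integral_add[OF Bochner_Integration.integrable_add[OF iG i1] i2]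
          Bochner_Integration.integral_add[OF iG i1]
        by (simp only: integral_mult_right_zero)
      finally show ?thesis .
    qed
    moreover have "(\<lambda>n. I + \<delta> * B + (1 + L\<^sup>2) / \<delta> * E n) \<longlonglongrightarrow> I + \<delta> * B + (1 + L\<^sup>2) / \<delta> * 0"
      using lim unfolding E_def by (intro tendsto_intros)
    ultimately show ?thesis
      by (intro LIMSEQ_le_const[of _ "I + \<delta> * B"]) auto
  qed
  have B: "B \<ge> 0" unfolding B_def by (intro integral_nonneg_AE AE_I2) auto
  show ?thesis
    unfolding I_def[symmetric]
  proof (rule field_le_epsilon)
    fix \<epsilon> :: real assume "\<epsilon> > 0"
    have "K \<le> I + \<epsilon> / (B + 1) * B" using \<open>\<epsilon> > 0\<close> B by (intro step) auto
    also have "\<epsilon> / (B + 1) * B \<le> \<epsilon>" using \<open>\<epsilon> > 0\<close> B by (simp add: divide_le_eq algebra_simps)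
    finally show "K \<le> I + \<epsilon>" by simp
  qed
qed

lemma integrable_norm_diff_square:
  fixes a b :: "'a \<Rightarrow> 'b::euclidean_space"
  assumes "a \<in> borel_measurable M" "b \<in> borel_measurable M"
    and "integrable M (\<lambda>x. (norm (a x))\<^sup>2)" "integrable M (\<lambda>x. (norm (b x))\<^sup>2)"
  shows "integrable M (\<lambda>x. (norm (a x - b x))\<^sup>2)"
proof (rule Bochner_Integration.integrable_bound)
  show "integrable M (\<lambda>x. 2 * (norm (a x))\<^sup>2 + 2 * (norm (b x))\<^sup>2)" using assms by auto
  show "AE x in M. norm ((norm (a x - b x))\<^sup>2) \<le> norm (2 * (norm (a x))\<^sup>2 + 2 * (norm (b x))\<^sup>2)"
  proof (rule AE_I2)
    fix x
    have "(norm (a x - b x))\<^sup>2 \<le> (norm (a x) + norm (b x))\<^sup>2"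
      by (intro power_mono norm_triangle_ineq4) simp
    also have "\<dots> \<le> 2 * (norm (a x))\<^sup>2 + 2 * (norm (b x))\<^sup>2"
      using zero_le_power2[of "norm (a x) - norm (b x)"] by (simp add: power2_eq_square algebra_simps)
    finally show "norm ((norm (a x - b x))\<^sup>2) \<le> norm (2 * (norm (a x))\<^sup>2 + 2 * (norm (b x))\<^sup>2)" by simp
  qed
qed (use assms in measurable)

context long_spherical_curve
begin

abbreviation zero_fun :: "real^3 \<Rightarrow> real" where "zero_fun \<equiv> \<lambda>_. 0"

lemma Ck_zero: "Ck 1 zero_fun" by (rule Ck_1I[of _ "\<lambda>_ _. 0"]) auto

lemma u_perturb: "u = perturb zero_fun" by (simp add: perturb_def fun_eq_iff)

lemma u_H1: "u \<in> cone_H1 \<gamma>"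
  and grad_u_AE: "AE z in \<mu>. tangential_gradient \<gamma> u (cm z) = grad_perturb zero_fun (cm z)"
  unfolding u_perturb
  using cone_H1I[OF perturb_L2 weak_grad_perturb grad_perturb_L2, OF Ck_zero Ck_zero Ck_zero] by auto

lemma cone_H1D:
  assumes "w \<in> cone_H1 \<gamma>"
  shows "set_borel_measurable borel A w" "set_borel_measurable borel A (tangential_gradient \<gamma> w)"
    "integrable \<mu> (\<lambda>z. (norm (w (cm z)))\<^sup>2)" "integrable \<mu> (\<lambda>z. (norm (tangential_gradient \<gamma> w (cm z)))\<^sup>2)"
    "weak_tangential_gradient \<gamma> w (tangential_gradient \<gamma> w)"
  using assms tangential_gradient_weak unfolding cone_H1_def cone_L2_iff by auto

lemma functional_polar:
  assumes "w \<in> cone_H1 \<gamma>"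
  shows "one_phase_functional \<gamma> w =
      (LINT z|\<mu>. (norm (tangential_gradient \<gamma> w (cm z)))\<^sup>2 + indicator {y. w y > 0} (cm z))"
    and "integrable \<mu> (\<lambda>z. (norm (tangential_gradient \<gamma> w (cm z)))\<^sup>2 + indicator {y. w y > 0} (cm z))"
proof -
  note H = cone_H1D[OF assms]
  let ?f = "\<lambda>x. (norm (tangential_gradient \<gamma> w x))\<^sup>2 + indicat_real {y. w y > 0} x"
  have "(\<lambda>x. (norm (indicat_real A x *\<^sub>R tangential_gradient \<gamma> w x))\<^sup>2
      + indicat_real {y. indicat_real A y *\<^sub>R w y > 0} x) \<in> borel_measurable borel"
    using H(1,2) unfolding set_borel_measurable_def by measurable
  then have f: "set_borel_measurable borel A ?f"
    unfolding set_borel_measurable_def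
    by (rule back_subst[where P="\<lambda>f. f \<in> borel_measurable borel"]) (auto simp: fun_eq_iff indicator_def)
  show "one_phase_functional \<gamma> w = (LINT z|\<mu>. ?f (cm z))"
    unfolding one_phase_functional_def by (rule cone_area_transfer(2)[OF f])
  interpret finite_measure \<mu> by (rule finite_\<mu>)
  show "integrable \<mu> (\<lambda>z. ?f (cm z))"
  proof (rule Bochner_Integration.integrable_bound)
    show "integrable \<mu> (\<lambda>z. (norm (tangential_gradient \<gamma> w (cm z)))\<^sup>2 + 1)" using H(4) by auto
  qed (use pullback_measurable[OF f] in \<open>auto simp: indicator_def\<close>)
qed

definition pos_area :: real where
  "pos_area = (LINT z|\<mu>. indicat_real {t. \<alpha> t > 0} (snd z))"

lemma flux_zero: "flux zero_fun z = indicat_real {t. \<alpha> t > 0} (snd z)"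
  using speed_pos[of "snd z"] \<alpha>_\<beta>_square[of "snd z"] grad_zero_outside_support[OF Ck_zero]
  by (auto simp: flux_def radial_pol_def angular_pol_def profile_def profile'_def indicator_def max_def power2_eq_square)

text \<open>On each phase \<open>\<bar>Du\<bar> = 1\<close>, so both terms of the functional contribute the area of the phases.\<close>

lemma functional_u: "one_phase_functional \<gamma> u = 2 * pos_area"
proof -
  have "one_phase_functional \<gamma> u =
      (LINT z|\<mu>. (norm (tangential_gradient \<gamma> u (cm z)))\<^sup>2 + indicator {y. u y > 0} (cm z))"
    by (rule functional_polar(1)[OF u_H1])
  also have "\<dots> = (LINT z|\<mu>. 2 * indicat_real {t. \<alpha> t > 0} (snd z))"
  proof (rule integral_cong_AE)
    show "AE z in \<mu>. (norm (tangential_gradient \<gamma> u (cm z)))\<^sup>2 + indicator {y. u y > 0} (cm z) =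
        2 * indicat_real {t. \<alpha> t > 0} (snd z)"
      using grad_u_AE AE_space
    proof eventually_elim
      case (elim z)
      obtain r t where z: "z = (r, t)" "r > 0" using elim(2) by (cases z) (auto simp: space_\<mu> Q_def)
      have "(norm (tangential_gradient \<gamma> u (cm z)))\<^sup>2 = (profile t)\<^sup>2 + (profile' t / speed t)\<^sup>2"
        unfolding elim(1) using norm_grad_perturb_cm[of z zero_fun] z grad_zero_outside_support[OF Ck_zero]
        by (simp add: radial_pol_def angular_pol_def)
      also have "\<dots> = indicat_real {t. \<alpha> t > 0} t"
        using speed_pos[of t] \<alpha>_\<beta>_square[of t] by (auto simp: profile_def profile'_def indicator_def)
      finally show ?case
        using z u_cm[of r t] by (auto simp: indicator_def profile_def zero_less_mult_iff max_def)
    qed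
    show "(\<lambda>z. 2 * indicat_real {t. \<alpha> t > 0} (snd z)) \<in> borel_measurable \<mu>"
      using \<alpha>_\<beta>_borel by (intro borel_measurable_\<mu> snd_borel) measurable
  qed (use functional_polar(2)[OF u_H1] in \<open>rule borel_measurable_integrable\<close>)
  finally show ?thesis by (simp add: pos_area_def)
qed

lemma truncated_area_tendsto:
  "(\<lambda>n. LINT z|\<mu>. trunc' (real (Suc n)) (perturb_pol zero_fun z) * flux zero_fun z) \<longlonglongrightarrow> pos_area"
  unfolding pos_area_def
proof (rule integral_dominated_convergence[where w="\<lambda>_. 1"])
  interpret finite_measure \<mu> by (rule finite_\<mu>)
  show "integrable \<mu> (\<lambda>_. 1::real)" by simp
  show "(\<lambda>z. indicat_real {t. \<alpha> t > 0} (snd z)) \<in> borel_measurable \<mu>"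
    using \<alpha>_\<beta>_borel by (intro borel_measurable_\<mu> snd_borel) measurable
  have b: "locally_bounded_borel (\<lambda>z. trunc' m (perturb_pol zero_fun z) * flux zero_fun z)" for m
    by (intro lbb_mult flux_lbb Ck_zero lbb_continuous
        continuous_on_compose2[OF continuous_on_trunc(2) perturb_pol_continuous[OF Ck_zero]]) auto
  show "(\<lambda>z. trunc' (real (Suc n)) (perturb_pol zero_fun z) * flux zero_fun z) \<in> borel_measurable \<mu>" for n
    using b by (intro borel_measurable_\<mu>) (simp add: locally_bounded_borel_def)
  show "AE z in \<mu>. norm (trunc' (real (Suc n)) (perturb_pol zero_fun z) * flux zero_fun z) \<le> 1" for n
    using trunc'_props(1,2)[of "real (Suc n)"] by (intro AE_I2) (auto simp: flux_zero indicator_def)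
  show "AE z in \<mu>. (\<lambda>n. trunc' (real (Suc n)) (perturb_pol zero_fun z) * flux zero_fun z)
      \<longlonglongrightarrow> indicat_real {t. \<alpha> t > 0} (snd z)"
  proof (rule AE_I2)
    fix z assume "z \<in> space \<mu>"
    then have z: "fst z > 0" by (auto simp: space_\<mu> Q_def)
    show "(\<lambda>n. trunc' (real (Suc n)) (perturb_pol zero_fun z) * flux zero_fun z)
      \<longlonglongrightarrow> indicat_real {t. \<alpha> t > 0} (snd z)"
    proof (cases "\<alpha> (snd z) > 0")
      case True
      then have "perturb_pol zero_fun z > 0" using z by (simp add: perturb_pol_def profile_def)
      from trunc'_tendsto[OF this] show ?thesis using True by (simp add: flux_zero)
    qed (simp add: flux_zero)
  qed
qed

lemma trunc'_borel: "trunc' m \<in> borel_measurable borel"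
  by (rule borel_measurable_continuous_onI[OF continuous_on_trunc(2)])

text \<open>Each \<open>\<phi> - (w - u)\<close> equals \<open>(u + \<phi>) - w\<close>, which has an explicit weak gradient up to that of \<open>w\<close>;
so the norms that tend to \<open>0\<close> can be computed in polar coordinates.\<close>

lemma H10_approximation:
  assumes w: "w \<in> cone_H1 \<gamma>" and v: "(\<lambda>x. w x - u x) \<in> cone_H10 \<gamma>"
  obtains \<phi> :: "nat \<Rightarrow> real^3 \<Rightarrow> real" where "\<And>n. \<phi> n \<in> C1c (ball 0 1)"
    and "(\<lambda>n. LINT z|\<mu>. (perturb (\<phi> n) (cm z) - w (cm z))\<^sup>2 +
        (norm (grad_perturb (\<phi> n) (cm z) - tangential_gradient \<gamma> w (cm z)))\<^sup>2) \<longlonglongrightarrow> 0"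
proof -
  note H = cone_H1D[OF w]
  obtain \<phi> :: "nat \<Rightarrow> real^3 \<Rightarrow> real" where phi: "\<And>n. \<phi> n \<in> C1c (ball 0 1)"
    and lim: "(\<lambda>n. cone_H1_norm \<gamma> (\<lambda>x. \<phi> n x - (w x - u x))) \<longlonglongrightarrow> 0"
    using v unfolding cone_H10_def by blast
  define E where "E n = (LINT z|\<mu>. (perturb (\<phi> n) (cm z) - w (cm z))\<^sup>2 +
        (norm (grad_perturb (\<phi> n) (cm z) - tangential_gradient \<gamma> w (cm z)))\<^sup>2)" for n
  have "cone_H1_norm \<gamma> (\<lambda>x. \<phi> n x - (w x - u x)) = sqrt (E n)" for n
  proof -
    have C: "Ck 1 (\<phi> n)" using phi by (simp add: C1c_def)
    define h where "h x = \<phi> n x - (w x - u x)" for x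
    define G where "G x = grad_perturb (\<phi> n) x - tangential_gradient \<gamma> w x" for x
    have h: "h x = perturb (\<phi> n) x - w x" for x by (simp add: h_def perturb_def)
    have wG: "weak_tangential_gradient \<gamma> h G"
      using weak_tangential_gradient_linear[OF weak_grad_perturb[OF C] H(5), of 1 "-1"]
      by (simp add: h[abs_def] G_def[abs_def])
    have sh: "set_borel_measurable borel A h"
      using perturb_borel[OF C] H(1) unfolding set_borel_measurable_def h
      by (simp add: right_diff_distrib)
    note wt = tangential_gradient_weak[OF wG]
    have st: "set_borel_measurable borel A (tangential_gradient \<gamma> h)" and sG: "set_borel_measurable borel A G"
      using wt wG by (auto simp: weak_tangential_gradient_def)
    have "(\<lambda>x. (indicat_real A x *\<^sub>R h x)\<^sup>2 + (norm (indicat_real A x *\<^sub>R tangential_gradient \<gamma> h x))\<^sup>2)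
        \<in> borel_measurable borel"
      using sh st unfolding set_borel_measurable_def by measurable
    then have f: "set_borel_measurable borel A (\<lambda>x. (h x)\<^sup>2 + (norm (tangential_gradient \<gamma> h x))\<^sup>2)"
      unfolding set_borel_measurable_def
      by (rule back_subst[where P="\<lambda>f. f \<in> borel_measurable borel"]) (auto simp: fun_eq_iff indicator_def)
    have "(LINT z|\<mu>. (h (cm z))\<^sup>2 + (norm (tangential_gradient \<gamma> h (cm z)))\<^sup>2) =
        (LINT z|\<mu>. (h (cm z))\<^sup>2 + (norm (G (cm z)))\<^sup>2)"
    proof (rule integral_cong_AE)
      show "AE z in \<mu>. (h (cm z))\<^sup>2 + (norm (tangential_gradient \<gamma> h (cm z)))\<^sup>2 = (h (cm z))\<^sup>2 + (norm (G (cm z)))\<^sup>2"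
        using weak_tangential_gradient_unique[OF wt wG] by eventually_elim simp
    qed (use pullback_measurable[OF sh] pullback_measurable[OF st] pullback_measurable[OF sG] in measurable)
    moreover have "cone_H1_norm \<gamma> h =
        sqrt (LINT z|\<mu>. (h (cm z))\<^sup>2 + (norm (tangential_gradient \<gamma> h (cm z)))\<^sup>2)"
      unfolding cone_H1_norm_def cone_area_transfer(2)[OF f] ..
    moreover have "(\<lambda>x. \<phi> n x - (w x - u x)) = h" by (simp add: h_def fun_eq_iff)
    ultimately show ?thesis by (simp add: E_def G_def h)
  qed
  then have "(\<lambda>n. sqrt (E n)) \<longlonglongrightarrow> 0" using lim by simp
  then have "(\<lambda>n. (sqrt (E n))\<^sup>2) \<longlonglongrightarrow> 0\<^sup>2" by (rule tendsto_power)
  moreover have "E n \<ge> 0" for n unfolding E_def by (intro integral_nonneg_AE AE_I2) auto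
  ultimately have "E \<longlonglongrightarrow> 0" by simp
  with phi show ?thesis unfolding E_def[abs_def] by (rule that)
qed

text \<open>On \<open>{w > 0}\<close> the integrand of the functional is at least \<open>2 \<bar>Dw\<bar> \<ge> 2 trunc' m w (e \<bullet> Dw)\<close>, and
elsewhere \<open>trunc' m w = 0\<close>. The integral of the right-hand side is the limit of the same integrals
for \<open>u + \<phi>\<close>, to which the calibration inequality applies.\<close>

lemma functional_lower_bound:
  assumes w: "w \<in> cone_H1 \<gamma>" and v: "(\<lambda>x. w x - u x) \<in> cone_H10 \<gamma>" and m: "m > 0"
  shows "2 * (LINT z|\<mu>. trunc' m (perturb_pol zero_fun z) * flux zero_fun z) \<le> one_phase_functional \<gamma> w"
proof -
  interpret finite_measure \<mu> by (rule finite_\<mu>)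
  note H = cone_H1D[OF w]
  let ?G = "\<lambda>z. tangential_gradient \<gamma> w (cm z)"
  let ?K = "LINT z|\<mu>. trunc' m (perturb_pol zero_fun z) * flux zero_fun z"
  obtain \<phi> where phi: "\<And>n. \<phi> n \<in> C1c (ball 0 1)"
    and lim: "(\<lambda>n. LINT z|\<mu>. (perturb (\<phi> n) (cm z) - w (cm z))\<^sup>2 +
        (norm (grad_perturb (\<phi> n) (cm z) - ?G z))\<^sup>2) \<longlonglongrightarrow> 0"
    using H10_approximation[OF w v] by blast
  have C: "Ck 1 (\<phi> n)" for n using phi by (simp add: C1c_def)
  have cm1: "(\<lambda>z. perturb (\<phi> n) (cm z)) \<in> borel_measurable \<mu>"
    and cm2: "(\<lambda>z. grad_perturb (\<phi> n) (cm z)) \<in> borel_measurable \<mu>" for n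
    by (rule pullback_measurable[OF perturb_borel[OF C]] pullback_measurable[OF borel_on_A[OF grad_perturb_borel[OF C]]])+
  have wm: "(\<lambda>z. w (cm z)) \<in> borel_measurable \<mu>" "?G \<in> borel_measurable \<mu>"
    by (rule pullback_measurable H)+
  have em: "calib \<in> borel_measurable \<mu>" by (rule borel_measurable_\<mu>[OF calib_borel])
  have K: "?K \<le> (LINT z|\<mu>. trunc' m (w (cm z)) * (calib z \<bullet> ?G z))"
  proof (rule integral_limit_lower_bound[OF finite_\<mu> em _ trunc'_borel trunc'_props(1,2)[OF m] trunc'_props(4)[OF m]
        less_imp_le[OF m] wm cm1 cm2 H(4) _ lim])
    show "norm (calib z) \<le> 1" for z by (simp add: norm_calib)
    show "integrable \<mu> (\<lambda>z. (perturb (\<phi> n) (cm z) - w (cm z))\<^sup>2 + (norm (grad_perturb (\<phi> n) (cm z) - ?G z))\<^sup>2)" for n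
    proof (rule Bochner_Integration.integrable_add)
      show "integrable \<mu> (\<lambda>z. (perturb (\<phi> n) (cm z) - w (cm z))\<^sup>2)"
        using integrable_norm_diff_square[OF cm1[of n] wm(1)] perturb_L2[OF C, of n] H(3)
        by (simp add: cone_L2_iff)
      show "integrable \<mu> (\<lambda>z. (norm (grad_perturb (\<phi> n) (cm z) - ?G z))\<^sup>2)"
        using integrable_norm_diff_square[OF cm2[of n] wm(2)] grad_perturb_L2[OF C, of n] H(4)
        by (simp add: cone_L2_iff)
    qed
    show "?K \<le> (LINT z|\<mu>. trunc' m (perturb (\<phi> n) (cm z)) * (calib z \<bullet> grad_perturb (\<phi> n) (cm z)))" for n
    proof -
      have "(LINT z|\<mu>. trunc' m (perturb (\<phi> n) (cm z)) * (calib z \<bullet> grad_perturb (\<phi> n) (cm z))) =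
          (LINT z|\<mu>. trunc' m (perturb_pol (\<phi> n) z) * flux (\<phi> n) z)"
        by (rule Bochner_Integration.integral_cong[OF refl])
           (simp add: space_\<mu> Q_def perturb_cm calib_grad_perturb mem_Times_iff)
      then show ?thesis using calibration_polar[OF phi m, of n] by simp
    qed
  qed
  have pt: "2 * (trunc' m (w (cm z)) * (calib z \<bullet> ?G z)) \<le> (norm (?G z))\<^sup>2 + indicator {y. w y > 0} (cm z)" for z
  proof (cases "w (cm z) > 0")
    case True
    have "calib z \<bullet> ?G z \<le> norm (?G z)" using norm_cauchy_schwarz[of "calib z" "?G z"] by (simp add: norm_calib)
    then have "trunc' m (w (cm z)) * (calib z \<bullet> ?G z) \<le> trunc' m (w (cm z)) * norm (?G z)"
      using trunc'_props(1)[OF m] by (rule mult_left_mono)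
    also have "\<dots> \<le> norm (?G z)"
      using trunc'_props(1,2)[OF m] by (simp add: mult_left_le_one_le)
    finally show ?thesis
      using True zero_le_power2[of "norm (?G z) - 1"] by (simp add: power2_eq_square algebra_simps)
  next
    case False
    then show ?thesis using trunc'_props(3)[OF m] by simp
  qed
  have i: "integrable \<mu> (\<lambda>z. 2 * (trunc' m (w (cm z)) * (calib z \<bullet> ?G z)))"
  proof (rule Bochner_Integration.integrable_bound)
    show "integrable \<mu> (\<lambda>z. 1 + (norm (?G z))\<^sup>2)" using H(4) by auto
    show "(\<lambda>z. 2 * (trunc' m (w (cm z)) * (calib z \<bullet> ?G z))) \<in> borel_measurable \<mu>"
      using em wm trunc'_borel by measurable
    show "AE z in \<mu>. norm (2 * (trunc' m (w (cm z)) * (calib z \<bullet> ?G z))) \<le> norm (1 + (norm (?G z))\<^sup>2)"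
    proof (rule AE_I2)
      fix z
      have "\<bar>calib z \<bullet> ?G z\<bar> \<le> norm (?G z)" using Cauchy_Schwarz_ineq2[of "calib z" "?G z"] by (simp add: norm_calib)
      moreover have "trunc' m (w (cm z)) * \<bar>calib z \<bullet> ?G z\<bar> \<le> \<bar>calib z \<bullet> ?G z\<bar>"
        using trunc'_props(1,2)[OF m] by (simp add: mult_left_le_one_le)
      ultimately show "norm (2 * (trunc' m (w (cm z)) * (calib z \<bullet> ?G z))) \<le> norm (1 + (norm (?G z))\<^sup>2)"
        using trunc'_props(1)[OF m, of "w (cm z)"] zero_le_power2[of "norm (?G z) - 1"]
        by (simp add: abs_mult power2_eq_square algebra_simps)
    qed
  qed
  have "2 * ?K \<le> (LINT z|\<mu>. 2 * (trunc' m (w (cm z)) * (calib z \<bullet> ?G z)))" using K by simp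
  also have "\<dots> \<le> one_phase_functional \<gamma> w"
    unfolding functional_polar(1)[OF w] by (intro integral_mono i functional_polar(2)[OF w] pt)
  finally show ?thesis .
qed

lemma u_minimizer: "is_minimizer \<gamma> u"
  unfolding is_minimizer_def
proof (intro conjI ballI impI u_H1)
  fix w assume w: "w \<in> cone_H1 \<gamma>" "(\<lambda>x. w x - u x) \<in> cone_H10 \<gamma>"
  have "(\<lambda>n. 2 * (LINT z|\<mu>. trunc' (real (Suc n)) (perturb_pol zero_fun z) * flux zero_fun z))
      \<longlonglongrightarrow> one_phase_functional \<gamma> u"
    unfolding functional_u by (intro tendsto_mult_left truncated_area_tendsto)
  then show "one_phase_functional \<gamma> u \<le> one_phase_functional \<gamma> w"
    by (rule LIMSEQ_le_const2) (auto intro!: functional_lower_bound[OF w])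
qed

section \<open>Two phases at the vertex\<close>

abbreviation P :: "(real^3) set" where "P \<equiv> positivity_set \<gamma> u"

lemma P_iff: "r > 0 \<Longrightarrow> r *\<^sub>R \<gamma> t \<in> P \<longleftrightarrow> r < 1 \<and> \<alpha> t > 0"
  using cm_in_A_iff[of r t] by (auto simp: positivity_set_def u_cm profile_def zero_less_mult_iff max_def)

lemma zero_notin_P: "0 \<notin> P" by (simp add: positivity_set_def u_def)

text \<open>The ray \<open>\<theta> = 2\<pi>\<close> is the axis of the gap between the two phases; together with the seam it cuts
the cone into two closed sectors.\<close>

definition \<sigma> :: real where "\<sigma> = (SOME t. t \<in> {0..1} \<and> \<theta> t = 2 * pi)"

lemma \<sigma>: "\<sigma> \<in> {0..1}" "\<theta> \<sigma> = 2 * pi"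
proof -
  have "\<exists>t. t \<in> {0..1} \<and> \<theta> t = 2 * pi" 
    by (rule \<theta>_attains[of "2 * pi"]) (use pi_gt_zero in auto)
  from someI_ex[OF this] show "\<sigma> \<in> {0..1}" "\<theta> \<sigma> = 2 * pi" unfolding \<sigma>_def by auto
qed

definition sector1 :: "(real^3) set" where "sector1 = cm ` ({0..1} \<times> {0..\<sigma>})"
definition sector2 :: "(real^3) set" where "sector2 = cm ` ({0..1} \<times> {\<sigma>..1})"

lemma sectors_cover: "P \<subseteq> sector1 \<union> sector2"
proof -
  have "P \<subseteq> cm ` ({0..1} \<times> {0..1})" using A_subset_K by (auto simp: positivity_set_def)
  also have "\<dots> \<subseteq> sector1 \<union> sector2"
    unfolding sector1_def sector2_def image_Un[symmetric] by (intro image_mono) auto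
  finally show ?thesis .
qed

lemma seam_negative: "\<alpha> 0 = -1" "\<alpha> 1 = -1" "\<alpha> \<sigma> = -1"
  using \<theta>_0 \<theta>_1 \<sigma> pi_gt_zero by (auto simp: \<alpha>_eq min_def cos_4pi)

text \<open>The sectors meet in the rays \<open>\<theta> = 0\<close> and \<open>\<theta> = 2\<pi>\<close>, where \<open>\<alpha> = - 1\<close>, and in the vertex.\<close>

lemma sectors_disjoint: "sector1 \<inter> sector2 \<inter> P = {}"
proof (rule ccontr)
  assume "sector1 \<inter> sector2 \<inter> P \<noteq> {}"
  then obtain x where x: "x \<in> sector1" "x \<in> sector2" "x \<in> P" by blast
  from x(1) obtain r t where e1: "x = r *\<^sub>R \<gamma> t" "r \<ge> 0" "t \<in> {0..\<sigma>}"
    unfolding sector1_def by auto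
  from x(2) obtain r' t' where e2: "x = r' *\<^sub>R \<gamma> t'" "r' \<ge> 0" "t' \<in> {\<sigma>..1}"
    unfolding sector2_def by auto
  note e = e1 e2
  have "r > 0" using e x zero_notin_P by (cases "r = 0") auto
  have a: "\<alpha> t > 0" using x(3) \<open>r > 0\<close> e(1) P_iff by auto
  have fr: "frac t = frac t'" using ray_eq_iff[OF \<open>r > 0\<close> e(5), of t t'] e by simp
  then have a': "\<alpha> t' > 0" using a frac_per(1)[of t] frac_per(1)[of t'] by simp
  have "t \<noteq> 0" "t \<noteq> 1" "t' \<noteq> 1" "t \<noteq> \<sigma>" using a a' seam_negative by auto
  then have "0 < t" "t < \<sigma>" "t' < 1" using e(3,6) by auto
  then have "frac t = t" "frac t' = t'" using e(6) \<sigma>(1) by (auto simp: frac_eq)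
  with fr have "t = t'" by linarith
  then show False using \<open>t < \<sigma>\<close> e(6) by simp
qed

text \<open>A component contains with a point the whole open ray through it, because \<open>u\<close> is homogeneous, and
so it reaches the vertex.\<close>

lemma phase_at_vertex:
  assumes "\<alpha> t > 0"
  defines "X \<equiv> connected_component_set P ((1 / 2) *\<^sub>R \<gamma> t)"
  shows "X \<in> components P" and "(1 / 2) *\<^sub>R \<gamma> t \<in> X"
    and "0 \<in> (top_of_set A) frontier_of X"
proof -
  have p: "(1 / 2) *\<^sub>R \<gamma> t \<in> P" using assms P_iff[of "1/2" t] by simp
  then show "X \<in> components P" unfolding X_def by (rule componentsI)
  show pX: "(1 / 2) *\<^sub>R \<gamma> t \<in> X" unfolding X_def using p by simp
  have "(\<lambda>r. r *\<^sub>R \<gamma> t) ` {0<..<1} \<subseteq> X"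
    unfolding X_def
  proof (rule connected_component_maximal)
    show "(1 / 2) *\<^sub>R \<gamma> t \<in> (\<lambda>r. r *\<^sub>R \<gamma> t) ` {0<..<1}" by (rule image_eqI[of _ _ "1/2"]) auto
    show "connected ((\<lambda>r. r *\<^sub>R \<gamma> t) ` {0<..<1})"
      by (intro connected_continuous_image continuous_intros) auto
    show "(\<lambda>r. r *\<^sub>R \<gamma> t) ` {0<..<1} \<subseteq> P" using assms P_iff by auto
  qed
  then have ray: "r *\<^sub>R \<gamma> t \<in> X" if "0 < r" "r < 1" for r
    using that by (simp add: image_subset_iff)
  have XP: "X \<subseteq> P" unfolding X_def by (rule connected_component_subset)
  have "0 \<notin> X" using XP zero_notin_P by blast
  then have "0 \<notin> (top_of_set A) interior_of X"
    using interior_of_subset[of "top_of_set A" X] by (rule contra_subsetD[rotated])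
  moreover have "0 \<in> (top_of_set A) closure_of X"
    unfolding in_closure_of
  proof (intro conjI allI impI)
    show "0 \<in> topspace (top_of_set A)" using zero_in_A by simp
    fix T assume "0 \<in> T \<and> openin (top_of_set A) T"
    then obtain U where U: "open U" "T = A \<inter> U" "0 \<in> U" by (auto simp: openin_open)
    then obtain \<epsilon> where \<epsilon>: "\<epsilon> > 0" "ball 0 \<epsilon> \<subseteq> U" using open_contains_ball by blast
    define r where "r = min (\<epsilon> / 2) (1 / 2)"
    have r: "0 < r" "r < 1" "r < \<epsilon>" using \<epsilon> by (auto simp: r_def min_def)
    then have "r *\<^sub>R \<gamma> t \<in> T" using U \<epsilon> cm_in_A_iff[of r t] by auto
    then show "\<exists>y. y \<in> X \<and> y \<in> T" using ray[OF r(1,2)] by blast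
  qed
  ultimately show "0 \<in> (top_of_set A) frontier_of X"
    unfolding frontier_of_def by (rule DiffI[rotated])
qed

lemma two_phases:
  "\<exists>X\<in>components P. \<exists>Y\<in>components P. X \<noteq> Y \<and>
     0 \<in> (top_of_set A) frontier_of X \<and> 0 \<in> (top_of_set A) frontier_of Y"
proof -
  have pi: "0 \<le> pi" "pi \<le> 4 * pi" "0 \<le> 3 * pi" "3 * pi \<le> 4 * pi" using pi_gt_zero by auto
  obtain t1 where t1: "t1 \<in> {0..1}" "\<theta> t1 = pi" by (rule \<theta>_attains[OF pi(1,2)])
  obtain t2 where t2: "t2 \<in> {0..1}" "\<theta> t2 = 3 * pi" by (rule \<theta>_attains[OF pi(3,4)])
  have "cos (3 * pi) = - 1" using cos_npi[of 3] by simp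
  then have a: "\<alpha> t1 > 0" "\<alpha> t2 > 0" using t1 t2 pi_gt_zero by (auto simp: \<alpha>_eq min_def)
  define X where "X = connected_component_set P ((1 / 2) *\<^sub>R \<gamma> t1)"
  define Y where "Y = connected_component_set P ((1 / 2) *\<^sub>R \<gamma> t2)"
  note X = phase_at_vertex[OF a(1), folded X_def] and Y = phase_at_vertex[OF a(2), folded Y_def]
  have "t1 \<le> \<sigma>" using \<theta>_less[of \<sigma> t1] \<sigma> t1 pi_gt_zero by force
  then have s1: "(1 / 2) *\<^sub>R \<gamma> t1 \<in> sector1"
    unfolding sector1_def using t1 by (intro image_eqI[of _ _ "(1/2, t1)"]) auto
  have "\<sigma> \<le> t2" using \<theta>_less[of t2 \<sigma>] \<sigma> t2 pi_gt_zero by force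
  then have s2: "(1 / 2) *\<^sub>R \<gamma> t2 \<in> sector2"
    unfolding sector2_def using t2 by (intro image_eqI[of _ _ "(1/2, t2)"]) auto
  have "X \<noteq> Y"
  proof
    assume "X = Y"
    then have y: "(1 / 2) *\<^sub>R \<gamma> t2 \<in> X" using Y(2) by simp
    have XP: "X \<subseteq> P" and con: "connected X" unfolding X_def
      by (auto intro: connected_component_subset[THEN subsetD])
    have cl: "closed sector1" "closed sector2"
      unfolding sector1_def sector2_def by (intro compact_imp_closed compact_sector)+
    show False
      using con cl s1 s2 X(2) y XP sectors_cover sectors_disjoint
      unfolding connected_closed by blast
  qed
  then show ?thesis using X Y by blast
qed

end

theorem mainTheorem3:
  fixes \<gamma> :: "real \<Rightarrow> real^3"
  assumes "smooth_simple_closed_curve \<gamma>"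
    and "range \<gamma> \<subseteq> sphere 0 1"
    and "curve_length \<gamma> \<ge> 4 * pi"
  shows "\<exists>u. is_minimizer \<gamma> u \<and>
             continuous_on (cone_ball \<gamma>) u \<and>
             (\<forall>x \<in> cone_ball \<gamma>. u x \<ge> 0) \<and>
             (\<exists>A \<in> components (positivity_set \<gamma> u). \<exists>B \<in> components (positivity_set \<gamma> u).
                A \<noteq> B \<and>
                0 \<in> (top_of_set (cone_ball \<gamma>)) frontier_of A \<and>
                0 \<in> (top_of_set (cone_ball \<gamma>)) frontier_of B)"
proof -
  interpret long_spherical_curve \<gamma> by unfold_locales (use assms in auto)
  have "\<forall>x\<in>cone_ball \<gamma>. u x \<ge> 0" using profile_bounds by (auto simp: u_def)
  then show ?thesis using u_minimizer u_continuous_A two_phases by blast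
qed

end
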